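(* Let $\theta\in(0,1)$ be an irrational number. Suppose $\gamma$ is a non-negative function in $C(\mathbb{T})$ and there exists $\lambda\in\mathbb{T}$ such that $\gamma(\lambda e^{2\pi in\theta})\neq 0$ for all nonnegative integers $n$. Then for every $\alpha\in(\mathbb{Z}+\mathbb{Z}\theta)\cap[0,1]$ there is a projection $p\in A_{\theta,\gamma}$ such that $\tau(p)=\alpha$.
   Context: $\mathbb{T}$ is the unit circle. $A_{\theta,\gamma}=C^*(x,w)$ is the universal unital $C^*$-algebra generated by elements $x,w$ subject to the relations $w^*w=ww^*=1$, $x^*x=\gamma(w)$, $xx^*=\gamma(e^{-2\pi i\theta}w)$, $xw=e^{-2\pi i\theta}wx$ (functions of the unitary $w$ are taken by continuous functional calculus). The spectrum of $w$ is $\mathbb{T}$, so $C^*(w)$ is identified with $C(\mathbb{T})$. For $t\in[0,1]$ let $\rho_t$ be the automorphism of $A_{\theta,\gamma}$ with $\rho_t(x)=e^{2\pi it}x$, $\rho_t(w)=w$, and let $\Phi(a)=\int_0^1\rho_t(a)\,dt$, which is a conditional expectation of $A_{\theta,\gamma}$ onto $C^*(w)$. The trace $\tau$ is the faithful tracial state on $A_{\theta,\gamma}$ given by $\tau(a)=\int_{\mathbb{T}}\Phi(a)\,dm$, where $m$ is the normalized Haar measure on $\mathbb{T}$. *)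

theory Defs
  imports "HOL-Analysis.Analysis" "HOL-Algebra.Module"
begin

section \<open>Unital C*-algebras\<close>

text \<open>Unital C*-algebras occur in two forms. The algebra under investigation is a type of class
  \<open>cstar_algebra\<close>, so that the limits and integrals of the library apply to it. The algebras
  that its universal property ranges over are records with a carrier set.\<close>

class cstar_algebra = real_normed_algebra_1 + banach +
  fixes scaleC :: "complex \<Rightarrow> 'a \<Rightarrow> 'a"  (infixr \<open>*\<^sub>C\<close> 75)
    and adj :: "'a \<Rightarrow> 'a"
  assumes scaleC_of_real: "complex_of_real r *\<^sub>C a = r *\<^sub>R a"
    and scaleC_add_left: "(c + d) *\<^sub>C a = c *\<^sub>C a + d *\<^sub>C a"
    and scaleC_add_right: "c *\<^sub>C (a + b) = c *\<^sub>C a + c *\<^sub>C b"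
    and scaleC_scaleC: "c *\<^sub>C (d *\<^sub>C a) = (c * d) *\<^sub>C a"
    and mult_scaleC_left: "(c *\<^sub>C a) * b = c *\<^sub>C (a * b)"
    and mult_scaleC_right: "a * (c *\<^sub>C b) = c *\<^sub>C (a * b)"
    and norm_scaleC: "norm (c *\<^sub>C a) = cmod c * norm a"
    and adj_adj: "adj (adj a) = a"
    and adj_add: "adj (a + b) = adj a + adj b"
    and adj_scaleC: "adj (c *\<^sub>C a) = cnj c *\<^sub>C adj a"
    and adj_mult: "adj (a * b) = adj b * adj a"
    and cstar_identity: "norm (adj a * a) = (norm a)\<^sup>2"

definition complex_field :: "complex ring" where
  "complex_field = \<lparr>carrier = UNIV, mult = (*), one = 1, zero = 0, add = (+)\<rparr>"

record 'b cstar = "(complex, 'b) module" +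
  star :: "'b \<Rightarrow> 'b"
  nrm :: "'b \<Rightarrow> real"

text \<open>The zero algebra is allowed here.\<close>

locale cstar_alg = ring B + Module.module complex_field B for B :: "'b cstar" (structure) +
  assumes smult_mult_left: "\<lbrakk>a \<in> carrier B; b \<in> carrier B\<rbrakk> \<Longrightarrow> (c \<odot> a) \<otimes> b = c \<odot> (a \<otimes> b)"
    and smult_mult_right: "\<lbrakk>a \<in> carrier B; b \<in> carrier B\<rbrakk> \<Longrightarrow> a \<otimes> (c \<odot> b) = c \<odot> (a \<otimes> b)"
    and nrm_nonneg: "a \<in> carrier B \<Longrightarrow> 0 \<le> nrm B a"
    and nrm_eq_0: "a \<in> carrier B \<Longrightarrow> nrm B a = 0 \<longleftrightarrow> a = \<zero>"
    and nrm_triangle: "\<lbrakk>a \<in> carrier B; b \<in> carrier B\<rbrakk> \<Longrightarrow> nrm B (a \<oplus> b) \<le> nrm B a + nrm B b"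
    and nrm_smult: "a \<in> carrier B \<Longrightarrow> nrm B (c \<odot> a) = cmod c * nrm B a"
    and nrm_mult: "\<lbrakk>a \<in> carrier B; b \<in> carrier B\<rbrakk> \<Longrightarrow> nrm B (a \<otimes> b) \<le> nrm B a * nrm B b"
    and complete: "\<lbrakk>range s \<subseteq> carrier B;
        \<forall>e>0. \<exists>N. \<forall>m\<ge>N. \<forall>n\<ge>N. nrm B (s m \<ominus> s n) < e\<rbrakk>
        \<Longrightarrow> \<exists>l\<in>carrier B. (\<lambda>n. nrm B (s n \<ominus> l)) \<longlonglongrightarrow> 0"
    and star_closed: "a \<in> carrier B \<Longrightarrow> star B a \<in> carrier B"
    and star_star: "a \<in> carrier B \<Longrightarrow> star B (star B a) = a"
    and star_add: "\<lbrakk>a \<in> carrier B; b \<in> carrier B\<rbrakk> \<Longrightarrow> star B (a \<oplus> b) = star B a \<oplus> star B b"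
    and star_smult: "a \<in> carrier B \<Longrightarrow> star B (c \<odot> a) = cnj c \<odot> star B a"
    and star_mult: "\<lbrakk>a \<in> carrier B; b \<in> carrier B\<rbrakk> \<Longrightarrow> star B (a \<otimes> b) = star B b \<otimes> star B a"
    and nrm_star_mult: "a \<in> carrier B \<Longrightarrow> nrm B (star B a \<otimes> a) = (nrm B a)\<^sup>2"

definition type_alg :: "'a::cstar_algebra cstar" where
  "type_alg = \<lparr>carrier = UNIV, mult = (*), one = 1, zero = 0, add = (+),
     smult = scaleC, star = adj, nrm = norm\<rparr>"

lemma cring_complex_field: "cring complex_field"
  by (intro cringI abelian_groupI comm_monoidI)
    (auto simp: complex_field_def algebra_simps intro: exI[of _ "- x" for x])

lemma ring_type_alg: "ring (type_alg :: 'a::cstar_algebra cstar)"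
  by (intro ringI abelian_groupI monoidI)
    (auto simp: type_alg_def algebra_simps intro: exI[of _ "- x" for x])

lemma cstar_alg_type_alg: "cstar_alg (type_alg :: 'a::cstar_algebra cstar)"
proof -
  let ?A = "type_alg :: 'a cstar"
  interpret R: ring ?A by (rule ring_type_alg)
  have one: "1 *\<^sub>C a = a" for a :: 'a
    using scaleC_of_real[of 1 a] by simp
  have mod: "Module.module complex_field ?A"
    by (rule moduleI[OF cring_complex_field R.abelian_group_axioms])
      (simp_all add: complex_field_def type_alg_def scaleC_add_left scaleC_add_right
        scaleC_scaleC one)
  have minus: "a \<ominus>\<^bsub>?A\<^esub> b = a - b" for a b :: 'a
  proof -
    have "\<ominus>\<^bsub>?A\<^esub> b = - b"
      by (rule R.minus_equality) (simp_all add: type_alg_def)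
    then show ?thesis
      by (simp add: a_minus_def type_alg_def)
  qed
  have compl: "\<exists>l. (\<lambda>n. norm (s n - l)) \<longlonglongrightarrow> 0"
    if "\<forall>e>0. \<exists>N. \<forall>m\<ge>N. \<forall>n\<ge>N. norm (s m - s n) < e" for s :: "nat \<Rightarrow> 'a"
  proof -
    have "Cauchy s"
      using that by (simp add: Cauchy_def dist_norm)
    then obtain l where "s \<longlonglongrightarrow> l"
      using Cauchy_convergent convergent_def by blast
    then show ?thesis
      using tendsto_norm_zero[of "\<lambda>n. s n - l" sequentially] LIM_zero by blast
  qed
  show ?thesis
    unfolding cstar_alg_def cstar_alg_axioms_def
    using ring_type_alg mod compl
    by (auto simp: minus)
      (auto simp: type_alg_def mult_scaleC_left mult_scaleC_right norm_triangle_ineq norm_scaleC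
        norm_mult_ineq adj_adj adj_add adj_scaleC adj_mult cstar_identity)
qed

text \<open>Unital, since \<open>ring_hom\<close> requires the unit to be preserved.\<close>

definition star_hom :: "'a cstar \<Rightarrow> 'b cstar \<Rightarrow> ('a \<Rightarrow> 'b) \<Rightarrow> bool" where
  "star_hom B C \<phi> \<longleftrightarrow> \<phi> \<in> ring_hom B C \<and>
     (\<forall>c. \<forall>a\<in>carrier B. \<phi> (c \<odot>\<^bsub>B\<^esub> a) = c \<odot>\<^bsub>C\<^esub> \<phi> a) \<and>
     (\<forall>a\<in>carrier B. \<phi> (star B a) = star C (\<phi> a))"

definition projection :: "'a::cstar_algebra \<Rightarrow> bool" where
  "projection p \<longleftrightarrow> p * p = p \<and> adj p = p"


section \<open>Continuous functional calculus of a unitary\<close>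

abbreviation circle :: "complex set" where
  "circle \<equiv> sphere 0 1"

text \<open>The C*-algebra of continuous functions on the circle; an element is made unique as a
  function on the whole plane by being \<open>undefined\<close> off the circle.\<close>

definition circle_alg :: "(complex \<Rightarrow> complex) cstar" where
  "circle_alg =
     \<lparr>carrier = {f \<in> extensional circle. continuous_on circle f},
      mult = (\<lambda>f g. restrict (\<lambda>z. f z * g z) circle),
      one = restrict (\<lambda>_. 1) circle,
      zero = restrict (\<lambda>_. 0) circle,
      add = (\<lambda>f g. restrict (\<lambda>z. f z + g z) circle),
      smult = (\<lambda>c f. restrict (\<lambda>z. c * f z) circle),
      star = (\<lambda>f. restrict (\<lambda>z. cnj (f z)) circle),
      nrm = (\<lambda>f. SUP z\<in>circle. cmod (f z))\<rparr>"

definition unitary_in :: "'b cstar \<Rightarrow> 'b \<Rightarrow> bool" where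
  "unitary_in B w \<longleftrightarrow> w \<in> carrier B \<and>
     star B w \<otimes>\<^bsub>B\<^esub> w = \<one>\<^bsub>B\<^esub> \<and> w \<otimes>\<^bsub>B\<^esub> star B w = \<one>\<^bsub>B\<^esub>"

text \<open>For a unitary \<open>w\<close>, the value \<open>f(w)\<close> of the functional calculus: the image of \<open>f\<close> under the
  unique unital *-homomorphism from the continuous functions on the circle that sends the
  coordinate function to \<open>w\<close> (its kernel consists of the functions vanishing on the spectrum).\<close>

definition cfc :: "'b cstar \<Rightarrow> 'b \<Rightarrow> (complex \<Rightarrow> complex) \<Rightarrow> 'b" where
  "cfc B w f = (THE y. \<exists>\<Psi>. star_hom circle_alg B \<Psi> \<and> \<Psi> (restrict (\<lambda>z. z) circle) = w \<and>
     y = \<Psi> (restrict f circle))"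


section \<open>The algebra generated by \<open>x\<close> and \<open>w\<close>\<close>

definition rotation_rels :: "real \<Rightarrow> (complex \<Rightarrow> real) \<Rightarrow> 'b cstar \<Rightarrow> 'b \<Rightarrow> 'b \<Rightarrow> bool" where
  "rotation_rels \<theta> \<gamma> B x w \<longleftrightarrow>
     x \<in> carrier B \<and> unitary_in B w \<and>
     star B x \<otimes>\<^bsub>B\<^esub> x = cfc B w (\<lambda>z. of_real (\<gamma> z)) \<and>
     x \<otimes>\<^bsub>B\<^esub> star B x = cfc B w (\<lambda>z. of_real (\<gamma> (cis (- 2 * pi * \<theta>) * z))) \<and>
     x \<otimes>\<^bsub>B\<^esub> w = cis (- 2 * pi * \<theta>) \<odot>\<^bsub>B\<^esub> (w \<otimes>\<^bsub>B\<^esub> x)"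

definition cstar_subalgebra :: "'a::cstar_algebra set \<Rightarrow> bool" where
  "cstar_subalgebra S \<longleftrightarrow> closed S \<and> 1 \<in> S \<and>
     (\<forall>a\<in>S. \<forall>b\<in>S. a + b \<in> S \<and> a * b \<in> S) \<and> (\<forall>c. \<forall>a\<in>S. c *\<^sub>C a \<in> S) \<and> (\<forall>a\<in>S. adj a \<in> S)"

text \<open>The type \<open>'a\<close> together with \<open>x\<close> and \<open>w\<close> is the universal unital C*-algebra given by the
  relations: \<open>x\<close> and \<open>w\<close> generate it, and every pair satisfying the relations in a C*-algebra \<open>B\<close>
  is the image of \<open>(x, w)\<close> under a *-homomorphism, which is unique since \<open>x\<close> and \<open>w\<close> generate.
  HOL cannot quantify over the type carrying \<open>B\<close>; ranging over the C*-algebras whose carrier is a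
  set of elements of \<open>'a\<close> loses nothing. Indeed, it suffices to consider algebras \<open>B\<close> generated by
  the given pair; these are separable, hence of at most the cardinality of the continuum, while
  \<open>'a\<close> contains the distinct multiples of \<open>1 \<noteq> 0\<close> by complex scalars, so each of them has an
  isomorphic copy on a subset of \<open>'a\<close>.\<close>

definition universal_rotation_alg ::
    "real \<Rightarrow> (complex \<Rightarrow> real) \<Rightarrow> 'a::cstar_algebra \<Rightarrow> 'a \<Rightarrow> bool" where
  "universal_rotation_alg \<theta> \<gamma> x w \<longleftrightarrow>
     rotation_rels \<theta> \<gamma> type_alg x w \<and>
     (\<forall>S. cstar_subalgebra S \<and> x \<in> S \<and> w \<in> S \<longrightarrow> S = UNIV) \<and>
     (\<forall>(B :: 'a cstar) x' w'. cstar_alg B \<and> rotation_rels \<theta> \<gamma> B x' w' \<longrightarrow>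
        (\<exists>\<phi>. star_hom type_alg B \<phi> \<and> \<phi> x = x' \<and> \<phi> w = w'))"

definition gauge_aut :: "'a::cstar_algebra \<Rightarrow> 'a \<Rightarrow> real \<Rightarrow> 'a \<Rightarrow> 'a" where
  "gauge_aut x w t =
     (THE \<rho>. star_hom type_alg type_alg \<rho> \<and> bij \<rho> \<and> \<rho> x = cis (2 * pi * t) *\<^sub>C x \<and> \<rho> w = w)"

definition cond_exp :: "'a::cstar_algebra \<Rightarrow> 'a \<Rightarrow> 'a \<Rightarrow> 'a" where
  "cond_exp x w a = integral {0..1} (\<lambda>t. gauge_aut x w t a)"

text \<open>The integral against normalized Haar measure, in the parametrization
  \<open>t \<mapsto> exp(2 \<pi> i t)\<close> of the circle.\<close>

definition haar_integral :: "(complex \<Rightarrow> complex) \<Rightarrow> complex" where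
  "haar_integral f = integral {0..1} (\<lambda>t. f (cis (2 * pi * t)))"

text \<open>The inverse of the functional calculus is the identification of \<open>C*(w)\<close> with the algebra of
  continuous functions on the circle.\<close>

definition rotation_trace :: "'a::cstar_algebra \<Rightarrow> 'a \<Rightarrow> 'a \<Rightarrow> complex" where
  "rotation_trace x w a =
     haar_integral (inv_into (carrier circle_alg) (cfc type_alg w) (cond_exp x w a))"

end

theory Submission
  imports Defs
begin

text \<open>
The elements \<open>x ^ k\<close> satisfy the relations of the algebra for the angle \<open>k \<theta>\<close>, with weight
\<open>G z = (\<Prod>j<k. \<gamma> (cis (2 \<pi> j \<theta>) z))\<close>, so for \<open>k > 0\<close> one imitates a Powers-Rieffel projection
\<open>a(w) + x ^ k b(w) + b(w) (x ^ k)\<^sup>*\<close> whose trace, the integral of \<open>a\<close>, is the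
fractional part of \<open>k \<theta>\<close>. The equation
\<open>b\<^sup>2 G = a - a\<^sup>2\<close> needs \<open>G\<close> to be nonzero only on a short arc, which is placed at the given point of
the circle. Negative \<open>k\<close> are covered by complementary projections.

That the trace reads off the integral of \<open>a\<close> requires \<open>f \<mapsto> f(w)\<close> to be injective. The
universal property yields a homomorphism to operators on \<open>\<ell>\<^sup>2(\<int>)\<close>, where \<open>w\<close> becomes multiplication
by a dense orbit of the rotation.
\<close>

section \<open>Homomorphisms from the functions on the circle\<close>

text \<open>\<open>cfc\<close> and \<open>gauge_aut\<close> are definite descriptions and
  \<open>rotation_trace\<close> inverts the first, so each has to be pinned down before any trace
  can be computed. The lever is automatic contractivity: a real function bounded by 1, or a
  self-adjoint element of norm below 1, is an average of two unitaries, and homomorphisms preserve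
  unitaries. Contractivity makes sets of agreement closed, so homomorphisms are determined by their
  values on generators. To construct \<open>f(w)\<close> one needs that its norm is at most the
  supremum of \<open>|f|\<close>. For trigonometric polynomials a crude bound has an extra factor
  linear in the degree, and passing to high powers by the C*-identity removes it.

  The hypothesis on \<gamma> concerns a forward orbit because the weight of \<open>x ^ k\<close> at
  a point is the product of \<gamma> over its first k forward rotations. A single starting point
  thus serves all k. The off-diagonal function b lives only where a rises, and the length of that
  rise does not affect the integral of a. It can therefore be chosen after k, as short as the weight
  of \<open>x ^ k\<close> requires.\<close>

lemma circle_induct:
  assumes "continuous_on circle f"
    and const: "\<And>c. P (\<lambda>z. c)" and ident: "P (\<lambda>z. z)" and conj: "P cnj"
    and add: "\<And>f g. \<lbrakk>continuous_on circle f; continuous_on circle g; P f; P g\<rbrakk> \<Longrightarrow> P (\<lambda>z. f z + g z)"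
    and mult: "\<And>f g. \<lbrakk>continuous_on circle f; continuous_on circle g; P f; P g\<rbrakk> \<Longrightarrow> P (\<lambda>z. f z * g z)"
    and lim: "\<And>f. \<lbrakk>continuous_on circle f; \<And>e::real. e > 0 \<Longrightarrow>
      \<exists>g. continuous_on circle g \<and> P g \<and> (\<forall>z\<in>circle. cmod (f z - g z) < e)\<rbrakk> \<Longrightarrow> P f"
  shows "P f"
proof (rule lim[OF assms(1)])
  fix e :: real assume "e > 0"
  \<comment> \<open>Stone-Weierstrass in the real coordinates of the plane. It remains to express
    such polynomials through constants, \<open>z\<close> and \<open>cnj z\<close>.\<close>
  then obtain g where g: "polynomial_function g" "\<And>z. z \<in> circle \<Longrightarrow> cmod (f z - g z) < e"
    using Stone_Weierstrass_polynomial_function[OF compact_sphere assms(1)] by metis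
  have cont: "continuous_on circle (\<lambda>z. complex_of_real (r z))"
    if "real_polynomial_function r" for r
    by (intro continuous_intros continuous_on_polymonial_function)
      (use that in \<open>simp add: real_polynomial_function_eq\<close>)
  have P: "P (\<lambda>z. complex_of_real (r z))" if "real_polynomial_function r" for r
    using that
  proof (induction r rule: real_polynomial_function.induct)
    case (linear r)
    then interpret r: bounded_linear r .
    define a b where "a = r 1" and "b = r \<i>"
    have rz: "r z = Re z * a + Im z * b" for z
    proof -
      have "r z = r (Re z *\<^sub>R 1 + Im z *\<^sub>R \<i>)"
        by (rule arg_cong[of _ _ r]) (simp add: complex_eq_iff)
      also have "\<dots> = Re z * a + Im z * b"
        by (simp only: r.add r.scaleR real_scaleR_def a_def b_def)
      finally show ?thesis .
    qed
    \<comment> \<open>A real-linear functional on the plane is a complex combination of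
      \<open>z\<close> and \<open>cnj z\<close>, hence the base case for \<open>cnj\<close>.\<close>
    have rz': "complex_of_real (r z) = (a - \<i> * b) / 2 * z + (a + \<i> * b) / 2 * cnj z" for z
      unfolding rz by (simp add: complex_eq_iff field_simps)
    show ?case
      unfolding rz' by (intro assms(5,6) const ident conj continuous_intros)
  next
    case (add f g)
    then show ?case
      by (auto intro!: assms(5) cont)
  next
    case (mult f g)
    then show ?case
      by (auto intro!: assms(6) cont)
  qed (simp add: const)
  have re: "real_polynomial_function (\<lambda>z. Re (g z))" and im: "real_polynomial_function (\<lambda>z. Im (g z))"
    using g(1) bounded_linear_Re bounded_linear_Im by (auto simp: polynomial_function_def o_def)
  have "P (\<lambda>z. complex_of_real (Re (g z)) + \<i> * complex_of_real (Im (g z)))"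
    by (intro add mult P re im cont const continuous_intros)
  then have "P g"
    by (simp flip: complex_eq)
  then show "\<exists>g. continuous_on circle g \<and> P g \<and> (\<forall>z\<in>circle. cmod (f z - g z) < e)"
    using g continuous_on_polymonial_function by blast
qed

lemma restrict_mem_circle_alg [simp]:
  "continuous_on circle f \<Longrightarrow> restrict f circle \<in> carrier circle_alg"
  using continuous_on_cong[of circle circle "restrict f circle" f] by (simp add: circle_alg_def)

lemma circle_alg_carrierE:
  assumes "f \<in> carrier circle_alg"
  shows "continuous_on circle f" "restrict f circle = f"
  using assms by (auto simp: circle_alg_def extensional_restrict)

lemma circle_alg_simps:
  "mult circle_alg = (\<lambda>f g. restrict (\<lambda>z. f z * g z) circle)"
  "one circle_alg = restrict (\<lambda>_. 1) circle"
  "add circle_alg = (\<lambda>f g. restrict (\<lambda>z. f z + g z) circle)"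
  "smult circle_alg = (\<lambda>c f. restrict (\<lambda>z. c * f z) circle)"
  "star circle_alg = (\<lambda>f. restrict (\<lambda>z. cnj (f z)) circle)"
  by (simp_all add: circle_alg_def)

lemma restrict_cong_circle: "(\<And>z. z \<in> circle \<Longrightarrow> f z = g z) \<Longrightarrow> restrict f circle = restrict g circle"
  by auto

lemma
  assumes "star_hom circle_alg B \<Psi>"
  shows circle_hom_closed: "continuous_on circle f \<Longrightarrow> \<Psi> (restrict f circle) \<in> carrier B"
    and circle_hom_add: "\<lbrakk>continuous_on circle f; continuous_on circle g\<rbrakk> \<Longrightarrow>
      \<Psi> (restrict (\<lambda>z. f z + g z) circle) = \<Psi> (restrict f circle) \<oplus>\<^bsub>B\<^esub> \<Psi> (restrict g circle)"
    and circle_hom_mult: "\<lbrakk>continuous_on circle f; continuous_on circle g\<rbrakk> \<Longrightarrow>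
      \<Psi> (restrict (\<lambda>z. f z * g z) circle) = \<Psi> (restrict f circle) \<otimes>\<^bsub>B\<^esub> \<Psi> (restrict g circle)"
    and circle_hom_smult: "continuous_on circle f \<Longrightarrow>
      \<Psi> (restrict (\<lambda>z. c * f z) circle) = c \<odot>\<^bsub>B\<^esub> \<Psi> (restrict f circle)"
    and circle_hom_star: "continuous_on circle f \<Longrightarrow>
      \<Psi> (restrict (\<lambda>z. cnj (f z)) circle) = star B (\<Psi> (restrict f circle))"
    and circle_hom_one: "\<Psi> (restrict (\<lambda>z. 1) circle) = \<one>\<^bsub>B\<^esub>"
    and circle_hom_const: "\<Psi> (restrict (\<lambda>z. c) circle) = c \<odot>\<^bsub>B\<^esub> \<one>\<^bsub>B\<^esub>"
proof -
  have h: "\<Psi> \<in> ring_hom circle_alg B"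
    and s: "\<And>c a. a \<in> carrier circle_alg \<Longrightarrow> \<Psi> (c \<odot>\<^bsub>circle_alg\<^esub> a) = c \<odot>\<^bsub>B\<^esub> \<Psi> a"
    and st: "\<And>a. a \<in> carrier circle_alg \<Longrightarrow> \<Psi> (star circle_alg a) = star B (\<Psi> a)"
    using assms by (auto simp: star_hom_def)
  show "\<Psi> (restrict f circle) \<in> carrier B" if "continuous_on circle f" for f
    using that by (intro ring_hom_closed[OF h]) simp
  show "\<Psi> (restrict (\<lambda>z. f z + g z) circle) = \<Psi> (restrict f circle) \<oplus>\<^bsub>B\<^esub> \<Psi> (restrict g circle)"
    if "continuous_on circle f" "continuous_on circle g" for f g
    using that ring_hom_add[OF h, of "restrict f circle" "restrict g circle"]
    by (simp add: circle_alg_simps cong: restrict_cong)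
  show "\<Psi> (restrict (\<lambda>z. f z * g z) circle) = \<Psi> (restrict f circle) \<otimes>\<^bsub>B\<^esub> \<Psi> (restrict g circle)"
    if "continuous_on circle f" "continuous_on circle g" for f g
    using that ring_hom_mult[OF h, of "restrict f circle" "restrict g circle"]
    by (simp add: circle_alg_simps cong: restrict_cong)
  show sm: "\<Psi> (restrict (\<lambda>z. c * f z) circle) = c \<odot>\<^bsub>B\<^esub> \<Psi> (restrict f circle)"
    if "continuous_on circle f" for f c
    using that s[of "restrict f circle" c]
    by (simp add: circle_alg_simps cong: restrict_cong)
  show "\<Psi> (restrict (\<lambda>z. cnj (f z)) circle) = star B (\<Psi> (restrict f circle))"
    if "continuous_on circle f" for f
    using that st[of "restrict f circle"]
    by (simp add: circle_alg_simps cong: restrict_cong)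
  show one: "\<Psi> (restrict (\<lambda>z. 1) circle) = \<one>\<^bsub>B\<^esub>"
    using ring_hom_one[OF h] by (simp add: circle_alg_simps)
  show "\<Psi> (restrict (\<lambda>z. c) circle) = c \<odot>\<^bsub>B\<^esub> \<one>\<^bsub>B\<^esub>" for c
    using sm[of "\<lambda>_. 1" c] one by simp
qed

section \<open>Contractivity and uniqueness of homomorphisms from C(T)\<close>

context cstar_alg
begin

lemma star_one: "star B \<one> = \<one>"
proof -
  have "star B \<one> = star B (star B (star B \<one> \<otimes> \<one>))"
    by (simp add: star_closed star_star)
  also have "\<dots> = star B (star B \<one> \<otimes> \<one>)"
    by (subst star_mult) (simp_all add: star_closed star_star)
  also have "\<dots> = \<one>"
    by (simp add: star_closed star_star)
  finally show ?thesis .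
qed

lemma nrm_unitary_le:
  assumes "u \<in> carrier B" "star B u \<otimes> u = \<one>"
  shows "nrm B u \<le> 1"
proof -
  have "(nrm B \<one>)\<^sup>2 = nrm B \<one>"
    using nrm_star_mult[of \<one>] by (simp add: star_one)
  then have "nrm B \<one> \<le> 1"
    by (auto simp: power2_eq_square)
  moreover have "(nrm B u)\<^sup>2 = nrm B \<one>"
    using nrm_star_mult[OF assms(1)] assms(2) by simp
  ultimately show ?thesis
    by (metis abs_square_le_1 abs_le_D1)
qed

lemma one_smult_B: "a \<in> carrier B \<Longrightarrow> 1 \<odot> a = a"
  using smult_one by (simp add: complex_field_def)

lemma minus_eq_smult: 
  assumes "a \<in> carrier B" "b \<in> carrier B"
  shows "a \<ominus> b = a \<oplus> (-1) \<odot> b"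
proof -
  have c: "(-1) \<odot> b \<in> carrier B"
    using smult_closed[of "-1" b] assms by (simp add: complex_field_def)
  have "((-1) \<odot> b) \<oplus> (1 \<odot> b) = (0::complex) \<odot> b"
    using smult_l_distr[of "-1" 1 b] assms by (simp add: complex_field_def)
  moreover have "(0::complex) \<odot> b = \<zero>"
    using assms smult_l_null[of b] by (simp add: complex_field_def)
  ultimately have "(-1) \<odot> b \<oplus> b = \<zero>"
    using assms by (simp add: one_smult_B)
  moreover have "(-1) \<odot> b = ((-1) \<odot> b \<oplus> b) \<ominus> b"
    using assms c by algebra
  ultimately have "(-1) \<odot> b = \<ominus> b"
    using assms by (simp add: a_minus_def)
  then show ?thesis
    by (simp add: a_minus_def)
qed

text \<open>A real function bounded by \<open>1\<close> is the average of the unitaries \<open>f \<plusminus> \<i> sqrt (1 - f\<^sup>2)\<close>.\<close>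

lemma circle_hom_real_le:
  assumes "star_hom circle_alg B \<Psi>" "continuous_on circle f" "\<And>z. z \<in> circle \<Longrightarrow> \<bar>f z\<bar> \<le> 1"
  shows "nrm B (\<Psi> (restrict (\<lambda>z. complex_of_real (f z)) circle)) \<le> 1"
proof -
  note H = assms(1)
  define g where "g z = complex_of_real (f z) + \<i> * complex_of_real (sqrt (1 - (f z)\<^sup>2))" for z
  have cg: "continuous_on circle g"
    unfolding g_def by (intro continuous_intros assms)
  have gg: "cnj (g z) * g z = 1" if "z \<in> circle" for z
  proof -
    have "(f z)\<^sup>2 \<le> 1"
      using assms(3)[OF that] by (simp add: abs_square_le_1)
    then show ?thesis
      by (simp add: g_def complex_eq_iff flip: power2_eq_square)
  qed
  let ?u = "\<Psi> (restrict g circle)" and ?v = "\<Psi> (restrict (\<lambda>z. cnj (g z)) circle)"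
  have cg': "continuous_on circle (\<lambda>z. cnj (g z))"
    by (intro continuous_intros cg)
  have u: "?u \<in> carrier B" and v: "?v \<in> carrier B"
    by (simp_all add: circle_hom_closed[OF H] cg cg')
  have sv: "star B ?u = ?v" "star B ?v = ?u"
    using circle_hom_star[OF H cg] u by (simp_all add: star_star)
  have gg': "g z * cnj (g z) = 1" if "z \<in> circle" for z
    using gg[OF that] by (simp add: mult.commute)
  have vu: "?v \<otimes> ?u = \<one>"
    unfolding circle_hom_mult[OF H cg' cg, symmetric] circle_hom_one[OF H, symmetric]
    by (intro arg_cong[of _ _ \<Psi>] restrict_cong_circle gg)
  have uv: "?u \<otimes> ?v = \<one>"
    unfolding circle_hom_mult[OF H cg cg', symmetric] circle_hom_one[OF H, symmetric]
    by (intro arg_cong[of _ _ \<Psi>] restrict_cong_circle gg')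
  then have le: "nrm B ?u \<le> 1" "nrm B ?v \<le> 1"
    using nrm_unitary_le[OF u] nrm_unitary_le[OF v] sv uv vu by simp_all
  have "\<Psi> (restrict (\<lambda>z. complex_of_real (f z)) circle) =
      \<Psi> (restrict (\<lambda>z. (1/2) * (g z + cnj (g z))) circle)"
    by (intro arg_cong[of _ _ \<Psi>] restrict_cong_circle) (simp add: g_def complex_eq_iff)
  also have "\<dots> = (1/2) \<odot> (?u \<oplus> ?v)"
    by (subst circle_hom_smult[OF H], intro continuous_intros cg) (simp add: circle_hom_add[OF H] cg cg')
  also have "nrm B \<dots> \<le> 1"
    using nrm_smult[of "?u \<oplus> ?v" "1/2"] nrm_triangle[OF u v] le u v by simp
  finally show ?thesis .
qed

text \<open>By the C*-identity the squared norm is the norm of the image of the real function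
  \<open>|f|^2\<close>, to which the averaging argument applies.\<close>

lemma circle_hom_le_1:
  assumes "star_hom circle_alg B \<Psi>" "continuous_on circle f" "\<And>z. z \<in> circle \<Longrightarrow> cmod (f z) \<le> 1"
  shows "nrm B (\<Psi> (restrict f circle)) \<le> 1"
proof -
  note H = assms(1)
  let ?y = "\<Psi> (restrict f circle)"
  have y: "?y \<in> carrier B"
    by (simp add: circle_hom_closed[OF H] assms)
  have "(nrm B ?y)\<^sup>2 = nrm B (star B ?y \<otimes> ?y)"
    using nrm_star_mult[OF y] by simp
  also have "star B ?y \<otimes> ?y = \<Psi> (restrict (\<lambda>z. cnj (f z) * f z) circle)"
    by (subst circle_hom_mult[OF H])
      (auto intro!: continuous_intros assms simp: circle_hom_star[OF H assms(2)])
  also have "\<dots> = \<Psi> (restrict (\<lambda>z. complex_of_real ((cmod (f z))\<^sup>2)) circle)"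
    by (intro arg_cong[of _ _ \<Psi>] restrict_cong_circle)
      (simp add: complex_norm_square mult.commute del: of_real_power)
  also have "nrm B \<dots> \<le> 1"
    by (rule circle_hom_real_le[OF H])
      (auto intro!: continuous_intros assms simp: abs_square_le_1)
  finally show ?thesis
    by (metis abs_square_le_1 abs_le_D1)
qed

lemma circle_hom_le:
  assumes "star_hom circle_alg B \<Psi>" "continuous_on circle f" "\<And>z. z \<in> circle \<Longrightarrow> cmod (f z) \<le> M" "M > 0"
  shows "nrm B (\<Psi> (restrict f circle)) \<le> M"
proof -
  note H = assms(1)
  have c: "continuous_on circle (\<lambda>z. f z / M)"
    using assms by (intro continuous_intros) auto
  have "\<Psi> (restrict f circle) = \<Psi> (restrict (\<lambda>z. of_real M * (f z / M)) circle)"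
    using assms by simp
  also have "\<dots> = of_real M \<odot> \<Psi> (restrict (\<lambda>z. f z / M) circle)"
    by (rule circle_hom_smult[OF H c])
  also have "nrm B \<dots> = M * nrm B (\<Psi> (restrict (\<lambda>z. f z / M) circle))"
    using assms c by (simp add: nrm_smult circle_hom_closed[OF H])
  also have "\<dots> \<le> M * 1"
    using assms c by (intro mult_left_mono circle_hom_le_1[OF H]) (auto simp: norm_divide divide_simps)
  finally show ?thesis by simp
qed

lemma circle_hom_diff:
  assumes "star_hom circle_alg B \<Psi>" "continuous_on circle f" "continuous_on circle g"
  shows "\<Psi> (restrict (\<lambda>z. f z - g z) circle) = \<Psi> (restrict f circle) \<ominus> \<Psi> (restrict g circle)"
proof -
  note H = assms(1)
  have "\<Psi> (restrict (\<lambda>z. f z - g z) circle) = \<Psi> (restrict (\<lambda>z. f z + (-1) * g z) circle)"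
    by simp
  also have "\<dots> = \<Psi> (restrict f circle) \<oplus> (-1) \<odot> \<Psi> (restrict g circle)"
    using assms circle_hom_smult[OF H, of g "-1"]
    by (subst circle_hom_add[OF H]) (auto intro!: continuous_intros)
  finally show ?thesis
    using assms by (simp add: minus_eq_smult circle_hom_closed[OF H])
qed

lemma nrm_diff_triangle:
  assumes "a \<in> carrier B" "b \<in> carrier B" "c \<in> carrier B"
  shows "nrm B (a \<ominus> c) \<le> nrm B (a \<ominus> b) + nrm B (b \<ominus> c)"
proof -
  have "a \<ominus> c = (a \<ominus> b) \<oplus> (b \<ominus> c)"
    using assms by algebra
  then show ?thesis
    using assms nrm_triangle by simp
qed

lemma nrm_diff_commute:
  assumes "a \<in> carrier B" "b \<in> carrier B"
  shows "nrm B (a \<ominus> b) = nrm B (b \<ominus> a)"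
proof -
  have "(-1) \<odot> (b \<ominus> a) = \<ominus> (b \<ominus> a)"
    using minus_eq_smult[of \<zero> "b \<ominus> a"] assms smult_closed[of "-1" "b \<ominus> a"]
    by (simp add: complex_field_def a_minus_def)
  then have "a \<ominus> b = (-1) \<odot> (b \<ominus> a)"
    using assms by algebra
  then show ?thesis
    using nrm_smult[of "b \<ominus> a" "-1"] assms by simp
qed

text \<open>The functions on which two homomorphisms agree are closed under the algebra operations
  and, by contractivity, under uniform limits. This is the uniqueness behind the definite
  description in \<open>cfc\<close>.\<close>

lemma circle_hom_unique:
  assumes H: "star_hom circle_alg B \<Psi>" and H': "star_hom circle_alg B \<Psi>'"
    and id: "\<Psi> (restrict (\<lambda>z. z) circle) = \<Psi>' (restrict (\<lambda>z. z) circle)"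
    and f: "continuous_on circle f"
  shows "\<Psi> (restrict f circle) = \<Psi>' (restrict f circle)"
proof (rule circle_induct[OF f, where P = "\<lambda>f. \<Psi> (restrict f circle) = \<Psi>' (restrict f circle)"])
  show "\<Psi> (restrict cnj circle) = \<Psi>' (restrict cnj circle)"
    using circle_hom_star[OF H, of "\<lambda>z. z"] circle_hom_star[OF H', of "\<lambda>z. z"] id
    by (simp add: continuous_intros)
next
  fix f :: "complex \<Rightarrow> complex"
  assume 6: "continuous_on circle f" "\<And>e::real. e > 0 \<Longrightarrow> \<exists>g. continuous_on circle g \<and>
    \<Psi> (restrict g circle) = \<Psi>' (restrict g circle) \<and> (\<forall>z\<in>circle. cmod (f z - g z) < e)"
  let ?y = "\<Psi> (restrict f circle)" and ?y' = "\<Psi>' (restrict f circle)"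
  note cl = circle_hom_closed[OF H] circle_hom_closed[OF H']
  have "nrm B (?y \<ominus> ?y') \<le> 0 + e" if "e > 0" for e
  proof -
    obtain g where g: "continuous_on circle g" "\<And>z. z \<in> circle \<Longrightarrow> cmod (f z - g z) < e/2"
      "\<Psi> (restrict g circle) = \<Psi>' (restrict g circle)"
      using 6(2)[of "e/2"] \<open>e > 0\<close> by auto
    let ?g = "\<Psi> (restrict g circle)"
    have "nrm B (?y \<ominus> ?g) \<le> e/2"
      using circle_hom_le[OF H, of "\<lambda>z. f z - g z" "e/2"] g(1) g(2)[THEN less_imp_le] 6(1) \<open>e > 0\<close>
      by (simp add: circle_hom_diff[OF H] continuous_on_diff)
    moreover have "nrm B (?y' \<ominus> ?g) \<le> e/2"
      using circle_hom_le[OF H', of "\<lambda>z. f z - g z" "e/2"] g(1) g(2)[THEN less_imp_le] 6(1) \<open>e > 0\<close>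
      by (simp add: circle_hom_diff[OF H'] continuous_on_diff g(3))
    ultimately show ?thesis
      using nrm_diff_triangle[of ?y ?g ?y'] nrm_diff_commute[of ?g ?y'] g 6 by (simp add: cl)
  qed
  then have "nrm B (?y \<ominus> ?y') \<le> 0"
    by (rule field_le_epsilon)
  then have "?y \<ominus> ?y' = \<zero>"
    using nrm_eq_0[of "?y \<ominus> ?y'"] nrm_nonneg[of "?y \<ominus> ?y'"] 6 by (simp add: cl)
  moreover have "?y = (?y \<ominus> ?y') \<oplus> ?y'"
    using cl[OF 6(1)] by algebra
  ultimately show "?y = ?y'"
    using cl[OF 6(1)] by simp
qed (simp_all add: id circle_hom_const[OF H] circle_hom_const[OF H'] circle_hom_add[OF H] circle_hom_add[OF H']
    circle_hom_mult[OF H] circle_hom_mult[OF H'])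

text \<open>Any homomorphism that sends the coordinate function to \<open>w\<close> may be used to
  evaluate \<open>cfc\<close>. For operators on l^2 an explicit one is available; for a unitary of
  the given type it has to be built.\<close>

lemma cfc_eqI:
  assumes H: "star_hom circle_alg B \<Psi>" and w: "\<Psi> (restrict (\<lambda>z. z) circle) = w"
    and f: "continuous_on circle f"
  shows "cfc B w f = \<Psi> (restrict f circle)"
  unfolding cfc_def
proof (rule the_equality)
  show "\<exists>\<Psi>'. star_hom circle_alg B \<Psi>' \<and> \<Psi>' (restrict (\<lambda>z. z) circle) = w \<and>
      \<Psi> (restrict f circle) = \<Psi>' (restrict f circle)"
    using H w by blast
next
  fix y assume "\<exists>\<Psi>. star_hom circle_alg B \<Psi> \<and> \<Psi> (restrict (\<lambda>z. z) circle) = w \<and> y = \<Psi> (restrict f circle)"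
  then obtain \<Psi>' where H': "star_hom circle_alg B \<Psi>'"
      "\<Psi>' (restrict (\<lambda>z. z) circle) = w" "y = \<Psi>' (restrict f circle)"
    by blast
  then show "y = \<Psi> (restrict f circle)"
    using circle_hom_unique[OF H'(1) H _ f] w by simp
qed

end

section \<open>Functional calculus of a unitary\<close>

lemma scaleC_one [simp]: "1 *\<^sub>C a = a"
  using scaleC_of_real[of 1 a] by simp

lemma scaleC_zero_left [simp]: "0 *\<^sub>C a = 0"
  using scaleC_of_real[of 0 a] by simp

lemma scaleC_minus1: "(-1) *\<^sub>C a = - a"
  using scaleC_of_real[of "-1" a] by simp

lemma bounded_linear_scaleC_right: "bounded_linear (\<lambda>a::'a::cstar_algebra. c *\<^sub>C a)"
  by (rule bounded_linear_intro[where K = "cmod c"])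
    (simp_all add: scaleC_add_right scaleC_scaleC norm_scaleC mult.commute flip: scaleC_of_real)

lemma bounded_linear_scaleC_left: "bounded_linear (\<lambda>c. c *\<^sub>C (a::'a::cstar_algebra))"
  by (rule bounded_linear_intro[where K = "norm a"])
    (simp_all add: scaleC_add_left norm_scaleC scaleR_conv_of_real scaleC_scaleC[symmetric] scaleC_of_real)

lemma scaleC_zero_right [simp]: "c *\<^sub>C 0 = 0"
  by (rule linear_0[OF bounded_linear.linear[OF bounded_linear_scaleC_right]])

lemma adj_zero [simp]: "adj 0 = 0"
  using adj_scaleC[of 0 0] by simp

lemma adj_diff: "adj (a - b) = adj a - adj b"
  using adj_add[of a "(-1) *\<^sub>C b"] adj_scaleC[of "-1" b] by (simp add: scaleC_minus1)

lemma adj_one [simp]: "adj 1 = (1::'a::cstar_algebra)"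
  by (metis adj_adj adj_mult mult.left_neutral mult.right_neutral)

lemma adj_power: "adj (a ^ n) = adj a ^ n"
  by (induction n) (simp_all add: adj_mult power_commutes)

lemma norm_adj [simp]: "norm (adj a) = norm (a::'a::cstar_algebra)"
proof -
  have "norm a \<le> norm (adj a)" for a :: 'a
  proof (cases "norm a = 0")
    case False
    have "norm a * norm a \<le> norm (adj a) * norm a"
      using cstar_identity[of a] norm_mult_ineq[of "adj a" a] by (simp add: power2_eq_square)
    with False show ?thesis by simp
  qed simp
  from this[of a] this[of "adj a"] show ?thesis
    by (simp add: adj_adj)
qed

lemma bounded_linear_adj: "bounded_linear (adj :: 'a::cstar_algebra \<Rightarrow> 'a)"
proof (rule bounded_linear_intro[where K = 1])
  show "adj (r *\<^sub>R a) = r *\<^sub>R adj a" for r and a :: 'a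
    using adj_scaleC[of "of_real r" a] by (simp add: scaleC_of_real)
qed (simp_all add: adj_add)

lemma norm_unitary: "adj u * u = 1 \<Longrightarrow> norm (u::'a::cstar_algebra) = 1"
  using cstar_identity[of u] norm_ge_zero[of u] by (simp add: power2_eq_1_iff)

text \<open>Each squaring of a self-adjoint element squares its norm, by the C*-identity. A bound on
  high powers therefore says something sharp about the element itself.\<close>

lemma norm_self_adjoint_power2:
  assumes "adj h = (h::'a::cstar_algebra)"
  shows "norm (h ^ (2 ^ n)) = norm h ^ (2 ^ n)"
proof (induction n)
  case (Suc n)
  have "norm (h ^ (2 ^ Suc n)) = norm (adj (h ^ (2 ^ n)) * h ^ (2 ^ n))"
    by (simp add: adj_power assms mult_2 power_add)
  then show ?case
    by (simp add: cstar_identity Suc flip: power_mult) (simp add: mult.commute)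
qed simp

lemma type_alg_simps [simp]:
  "carrier (type_alg :: 'a::cstar_algebra cstar) = UNIV"
  "mult (type_alg :: 'a cstar) = (*)" "one (type_alg :: 'a cstar) = 1"
  "add (type_alg :: 'a cstar) = (+)" "zero (type_alg :: 'a cstar) = 0"
  "smult (type_alg :: 'a cstar) = scaleC" "star (type_alg :: 'a cstar) = adj"
  "nrm (type_alg :: 'a cstar) = norm"
  by (simp_all add: type_alg_def)

section \<open>Fourier coefficients and trigonometric polynomials in a unitary\<close>

lemma has_integral_cis:
  "((\<lambda>t. cis (2 * pi * of_int k * t)) has_integral (if k = 0 then 1 else 0)) {0..1}"
proof (cases "k = 0")
  case True
  then show ?thesis
    using has_integral_const_real[of "1::complex" 0 1] by simp
next
  case False
  define a where "a = \<i> * (2 * pi * real_of_int k)"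
  have cis: "cis (2 * pi * of_int k * t) = exp (a * of_real t)" for t
    by (simp add: cis_conv_exp a_def mult.assoc)
  have "a \<noteq> 0" using False by (simp add: a_def)
  moreover have "exp a = 1"
    using cis[of 1] cis_multiple_2pi[of "real_of_int k"] by simp
  ultimately have "integral {0..1} (\<lambda>t. exp (a * complex_of_real t)) = 0"
    using integral_exp[of 1 a] by simp
  moreover have "(\<lambda>t. exp (a * complex_of_real t)) integrable_on {0..1}"
    by (intro integrable_continuous_real continuous_intros)
  ultimately show ?thesis
    using False integrable_integral by (simp add: cis) fastforce
qed

text \<open>Orthogonality of the characters writes \<open>c l\<close> as the integral of
  \<open>f z * z powi (- l)\<close>, whose integrand is bounded by \<open>M\<close> on the
  circle.\<close>

lemma trig_poly_coeff_le:
  assumes "finite K" and f: "\<And>z. z \<in> circle \<Longrightarrow> f z = (\<Sum>k\<in>K. c k * z powi k)"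
    and M: "\<And>z. z \<in> circle \<Longrightarrow> cmod (f z) \<le> M" and "l \<in> K"
  shows "cmod (c l) \<le> M"
proof -
  have "((\<lambda>t. \<Sum>k\<in>K. c k * cis (2 * pi * of_int (k - l) * t)) has_integral
      (\<Sum>k\<in>K. c k * (if k - l = 0 then 1 else 0))) {0..1}"
    by (intro has_integral_sum assms has_integral_mult_right has_integral_cis)
  also have "(\<Sum>k\<in>K. c k * (if k - l = 0 then 1 else 0)) = c l"
    using assms by (simp add: if_distrib cong: if_cong)
  also have "(\<lambda>t. \<Sum>k\<in>K. c k * cis (2 * pi * of_int (k - l) * t)) =
      (\<lambda>t. f (cis (2 * pi * t)) * cis (- (2 * pi * of_int l * t)))"
    by (simp add: f sum_distrib_left sum_distrib_right cis_power_int cis_mult algebra_simps fun_eq_iff)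
  finally have I: "((\<lambda>t. f (cis (2 * pi * t)) * cis (- (2 * pi * of_int l * t))) has_integral c l) {0..1}" .
  have "0 \<le> M"
    using M[of 1] norm_ge_zero order_trans by (metis mem_sphere_0 norm_one)
  then show ?thesis
    using has_integral_bound[of M, OF _ I[folded cbox_interval]] M by (simp add: norm_mult)
qed

definition unitary_power :: "'a::cstar_algebra \<Rightarrow> int \<Rightarrow> 'a" where
  "unitary_power w k = (if k \<ge> 0 then w ^ nat k else adj w ^ nat (- k))"

text \<open>A relation instead of a map, since it is not yet known that the values of
  \<open>f\<close> on the circle determine \<open>y\<close>. The degree bound \<open>N\<close> is
  recorded because the first norm estimate depends on it.\<close>

inductive trig_poly :: "'a::cstar_algebra \<Rightarrow> nat \<Rightarrow> (complex \<Rightarrow> complex) \<Rightarrow> 'a \<Rightarrow> bool"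
  for w where
  monom: "\<bar>k\<bar> \<le> int N \<Longrightarrow> trig_poly w N (\<lambda>z. z powi k) (unitary_power w k)"
| add: "\<lbrakk>trig_poly w N f y; trig_poly w N g v\<rbrakk> \<Longrightarrow> trig_poly w N (\<lambda>z. f z + g z) (y + v)"
| scale: "trig_poly w N f y \<Longrightarrow> trig_poly w N (\<lambda>z. c * f z) (c *\<^sub>C y)"
| cong: "\<lbrakk>trig_poly w N f y; \<And>z. z \<in> circle \<Longrightarrow> f z = g z\<rbrakk> \<Longrightarrow> trig_poly w N g y"

lemma trig_poly_mono: "trig_poly w N f y \<Longrightarrow> N \<le> M \<Longrightarrow> trig_poly w M f y"
  by (induction rule: trig_poly.induct) (auto intro: trig_poly.intros)

lemma trig_poly_coeffs:
  assumes "trig_poly w N f y"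
  obtains c where "\<And>z. z \<in> circle \<Longrightarrow> f z = (\<Sum>k\<in>{- int N..int N}. c k * z powi k)"
    "y = (\<Sum>k\<in>{- int N..int N}. c k *\<^sub>C unitary_power w k)"
proof -
  let ?K = "{- int N..int N}"
  have "\<exists>c. (\<forall>z\<in>circle. f z = (\<Sum>k\<in>?K. c k * z powi k)) \<and>
      y = (\<Sum>k\<in>?K. c k *\<^sub>C unitary_power w k)"
    using assms
  proof (induction rule: trig_poly.induct)
    case (monom k N)
    then have k: "k \<in> {- int N..int N}" by auto
    then show ?case
      by (intro exI[of _ "\<lambda>j. if j = k then 1 else 0"])
        (auto simp: if_distrib if_distribR sum.delta cong: if_cong)
  next
    case (add N f y g v)
    then obtain c d where
      "\<forall>z\<in>circle. f z = (\<Sum>k\<in>{- int N..int N}. c k * z powi k)"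
      "y = (\<Sum>k\<in>{- int N..int N}. c k *\<^sub>C unitary_power w k)"
      "\<forall>z\<in>circle. g z = (\<Sum>k\<in>{- int N..int N}. d k * z powi k)"
      "v = (\<Sum>k\<in>{- int N..int N}. d k *\<^sub>C unitary_power w k)"
      by blast
    then show ?case
      by (intro exI[of _ "\<lambda>k. c k + d k"]) (simp add: scaleC_add_left sum.distrib distrib_right)
  next
    case (scale N f y a)
    then obtain c where
      "\<forall>z\<in>circle. f z = (\<Sum>k\<in>{- int N..int N}. c k * z powi k)"
      "y = (\<Sum>k\<in>{- int N..int N}. c k *\<^sub>C unitary_power w k)"
      by blast
    then show ?case
      by (intro exI[of _ "\<lambda>k. a * c k"])
        (simp add: sum_distrib_left mult.assoc scaleC_scaleC
          linear_sum[OF bounded_linear.linear[OF bounded_linear_scaleC_right]] flip: scaleC_scaleC)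
  qed auto
  with that show ?thesis by blast
qed

locale unitary =
  fixes w :: "'a::cstar_algebra"
  assumes adj_w_w: "adj w * w = 1" and w_adj_w: "w * adj w = 1"
begin

lemma unitary_power_Suc: "unitary_power w (k + 1) = w * unitary_power w k"
proof (cases "k \<ge> 0")
  case False
  then have "nat (- k) = Suc (nat (- (k + 1)))" by simp
  then have "w * unitary_power w k = (w * adj w) * adj w ^ nat (- (k + 1))"
    using False by (simp add: unitary_power_def mult.assoc)
  then show ?thesis
    using False by (cases "k = -1") (simp_all add: unitary_power_def w_adj_w)
qed (simp add: unitary_power_def nat_add_distrib)

lemma unitary_power_add: "unitary_power w (j + k) = unitary_power w j * unitary_power w k"
proof (induction j rule: int_induct[where k = 0])
  case base
  show ?case by (simp add: unitary_power_def)
next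
  case (step1 i)
  show ?case
    using unitary_power_Suc[of i] unitary_power_Suc[of "i + k"] step1
    by (simp add: mult.assoc add.assoc add.left_commute add.commute)
next
  case (step2 i)
  have "w * unitary_power w (i - 1 + k) = w * (unitary_power w (i - 1) * unitary_power w k)"
    using unitary_power_Suc[of "i - 1"] unitary_power_Suc[of "i - 1 + k"] step2
    by (simp add: mult.assoc algebra_simps)
  then have "adj w * (w * unitary_power w (i - 1 + k)) = adj w * (w * (unitary_power w (i - 1) * unitary_power w k))"
    by simp
  then show ?case
    by (simp add: adj_w_w flip: mult.assoc)
qed

lemma adj_unitary_power: "adj (unitary_power w k) = unitary_power w (- k)"
  by (cases k "0::int" rule: linorder_cases) (simp_all add: unitary_power_def adj_power adj_adj)

lemma norm_unitary_power: "norm (unitary_power w k) = 1"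
  by (rule norm_unitary, subst adj_unitary_power, subst unitary_power_add[symmetric])
    (simp add: unitary_power_def)

text \<open>There are \<open>2 * N + 1\<close> coefficients, each of modulus at most
  \<open>M\<close>, and the powers of \<open>w\<close> have norm 1. The factor is crude but only
  linear in the degree, which makes it removable.\<close>

lemma trig_poly_norm_le:
  assumes "trig_poly w N f y" and M: "\<And>z. z \<in> circle \<Longrightarrow> cmod (f z) \<le> M"
  shows "norm y \<le> real (2 * N + 1) * M"
proof -
  let ?K = "{- int N..int N}"
  obtain c where c: "\<And>z. z \<in> circle \<Longrightarrow> f z = (\<Sum>k\<in>?K. c k * z powi k)"
    "y = (\<Sum>k\<in>?K. c k *\<^sub>C unitary_power w k)"
    using trig_poly_coeffs[OF assms(1)] by blast
  have "norm y \<le> (\<Sum>k\<in>?K. norm (c k *\<^sub>C unitary_power w k))"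
    unfolding c by (rule norm_sum)
  also have "\<dots> \<le> (\<Sum>k\<in>?K. M)"
    using trig_poly_coeff_le[of ?K f c M] c(1) M
    by (intro sum_mono) (simp add: norm_scaleC norm_unitary_power)
  finally show ?thesis by (simp add: add.commute)
qed

lemma trig_poly_mult:
  assumes "trig_poly w N f y" "trig_poly w M g v"
  shows "trig_poly w (N + M) (\<lambda>z. f z * g z) (y * v)"
  using assms
proof (induction rule: trig_poly.induct)
  case (monom j N)
  from monom(2,1) show ?case
  proof (induction rule: trig_poly.induct)
    case (monom k M)
    then have "trig_poly w (N + M) (\<lambda>z. z powi (j + k)) (unitary_power w (j + k))"
      by (intro trig_poly.monom) auto
    then show ?case
      unfolding unitary_power_add by (rule trig_poly.cong) (auto intro!: power_int_add)
  next
    case (add M f y g v)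
    then show ?case
      by (simp add: distrib_left trig_poly.add)
  next
    case (scale M f y c)
    then show ?case
      using trig_poly.scale[of w "N + M" "\<lambda>z. z powi j * f z" "unitary_power w j * y" c]
      by (simp add: mult_scaleC_right mult.left_commute)
  next
    case (cong M f y g)
    then show ?case
      by (auto intro!: trig_poly.cong[OF cong(3)])
  qed
next
  case (add N f y g v)
  then show ?case
    by (simp add: distrib_right trig_poly.add)
next
  case (scale N f y c)
  then show ?case
    by (simp add: mult_scaleC_left mult.assoc trig_poly.scale)
next
  case (cong N f y g')
  then show ?case
    by (auto intro!: trig_poly.cong[OF cong(3)])
qed

lemma trig_poly_adj:
  "trig_poly w N f y \<Longrightarrow> trig_poly w N (\<lambda>z. cnj (f z)) (adj y)"
proof (induction rule: trig_poly.induct)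
  case (monom k N)
  have "trig_poly w N (\<lambda>z. z powi (- k)) (adj (unitary_power w k))"
    unfolding adj_unitary_power using monom by (intro trig_poly.monom) auto
  then show ?case
  proof (rule trig_poly.cong)
    fix z :: complex assume "z \<in> circle"
    then have "cnj z = inverse z"
      using divide_conv_cnj[of z 1] by (simp add: inverse_eq_divide)
    then show "z powi (- k) = cnj (z powi k)"
      by (simp add: power_int_minus power_int_inverse)
  qed
qed (auto simp: adj_add adj_scaleC intro: trig_poly.add trig_poly.scale trig_poly.cong)

lemma trig_poly_one: "trig_poly w 0 (\<lambda>z. 1) 1"
  using trig_poly.monom[of 0 0 w] by (simp add: unitary_power_def)

lemma trig_poly_power:
  assumes "trig_poly w N f y"
  shows "trig_poly w (n * N) (\<lambda>z. f z ^ n) (y ^ n)"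
  by (induction n) (auto simp: trig_poly_one intro: trig_poly_mult assms)

text \<open>The C*-identity reduces this to a self-adjoint \<open>h\<close>, for which the norm of \<open>h\<close> to the power
  \<open>2 ^ n\<close> is at most a linear function of \<open>2 ^ n\<close> times \<open>M\<close> to that power.\<close>

lemma trig_poly_norm_le_sup:
  assumes y: "trig_poly w N f y" and M: "\<And>z. z \<in> circle \<Longrightarrow> cmod (f z) \<le> M" and "M > 0"
  shows "norm y \<le> M"
proof -
  define h where "h = adj y * y"
  have h: "trig_poly w (N + N) (\<lambda>z. cnj (f z) * f z) h"
    unfolding h_def by (intro trig_poly_mult trig_poly_adj y)
  have adj_h: "adj h = h"
    by (simp add: h_def adj_mult adj_adj)
  \<comment> \<open>\<open>h\<close> has degree at most \<open>N + N\<close>, so this power has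
    degree at most \<open>2 ^ n * (N + N)\<close>; twice that plus one counts the
    coefficients.\<close>
  have *: "norm h ^ (2 ^ n) \<le> (real (4 * N) * 2 ^ n + 1) * (M\<^sup>2) ^ (2 ^ n)" for n
  proof -
    have "norm (h ^ (2 ^ n)) \<le> real (2 * (2 ^ n * (N + N)) + 1) * (M\<^sup>2) ^ (2 ^ n)"
      using M by (intro trig_poly_norm_le[OF trig_poly_power[OF h]])
        (auto simp: norm_power norm_mult power2_eq_square intro!: power_mono mult_mono norm_ge_zero
          intro: order_trans[OF norm_ge_zero])
    then show ?thesis
      by (simp add: norm_self_adjoint_power2[OF adj_h] algebra_simps)
  qed
  have "norm h \<le> M\<^sup>2"
  proof (rule ccontr)
    assume less: "\<not> norm h \<le> M\<^sup>2"
    define r where "r = M\<^sup>2 / norm h"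
    have h0: "norm h > 0"
      using less by (smt (verit) zero_le_power2)
    have r: "0 \<le> r" "r < 1"
      using less h0 by (auto simp: r_def)
    \<comment> \<open>Dividing the bound above by the power of \<open>norm h\<close> shows that this
      sequence is at least 1 at every index \<open>2 ^ n\<close>. As \<open>r < 1\<close>, it tends
      to 0.\<close>
    have "(\<lambda>n. real (4 * N) * (real n * r ^ n) + r ^ n) \<longlonglongrightarrow> real (4 * N) * 0 + 0"
      using r by (intro tendsto_intros powser_times_n_limit_0 LIMSEQ_power_zero) auto
    then have "((\<lambda>n. real (4 * N) * (real n * r ^ n) + r ^ n) \<circ> (\<lambda>n. 2 ^ n)) \<longlonglongrightarrow> 0"
      by (intro LIMSEQ_subseq_LIMSEQ) (auto simp: strict_mono_def)
    moreover have "1 \<le> (\<lambda>n. real (4 * N) * (real n * r ^ n) + r ^ n) (2 ^ n)" for n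
      using *[of n] h0 by (simp add: r_def power_divide field_simps)
    ultimately have "1 \<le> (0::real)"
      by (intro LIMSEQ_le_const[of _ 0 1]) (auto simp: o_def)
    then show False by simp
  qed
  then have "(norm y)\<^sup>2 \<le> M\<^sup>2"
    by (simp add: h_def cstar_identity)
  then show ?thesis
    using \<open>M > 0\<close> by (simp add: power2_le_iff_abs_le)
qed

end

section \<open>The functional calculus as a limit of trigonometric polynomials\<close>

lemma uniform_limit_sequentiallyE:
  assumes "uniform_limit X h f sequentially" "e > 0"
  obtains n0 where "\<And>n z. n \<ge> n0 \<Longrightarrow> z \<in> X \<Longrightarrow> dist (h n z) (f z) < e"
  using assms unfolding uniform_limit_iff eventually_sequentially by metis

context unitary
begin

text \<open>The closure of \<open>trig_poly\<close>, uniformly in the function and in norm in the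
  element. The degrees \<open>N n\<close> may grow, so arguments about it need the estimate that is
  free of the degree.\<close>

definition fun_calc :: "(complex \<Rightarrow> complex) \<Rightarrow> 'a \<Rightarrow> bool" where
  "fun_calc f y \<longleftrightarrow> (\<exists>N h u. (\<forall>n. trig_poly w (N n) (h n) (u n)) \<and>
     uniform_limit circle h f sequentially \<and> u \<longlonglongrightarrow> y)"

lemma fun_calcI:
  assumes "\<And>n. trig_poly w (N n) (h n) (u n)" "uniform_limit circle h f sequentially" "u \<longlonglongrightarrow> y"
  shows "fun_calc f y"
  using assms unfolding fun_calc_def by blast

lemma trig_poly_continuous: "trig_poly w N f y \<Longrightarrow> continuous_on circle f"
proof (induction rule: trig_poly.induct)
  case (monom k N)
  have "\<forall>z\<in>circle. z \<noteq> (0::complex)" by auto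
  then show ?case by (intro continuous_on_power_int continuous_intros) auto
next
  case (cong N f y g)
  then show ?case
    using continuous_on_cong[of circle circle f g] by simp
qed (auto intro!: continuous_intros)

lemma trig_poly_bounded: "trig_poly w N f y \<Longrightarrow> bounded (f ` circle)"
  by (intro compact_imp_bounded compact_continuous_image trig_poly_continuous compact_sphere)

lemma trig_poly_diff:
  assumes "trig_poly w N f y" "trig_poly w M g v"
  shows "trig_poly w (max N M) (\<lambda>z. f z - g z) (y - v)"
proof -
  have "trig_poly w (max N M) (\<lambda>z. f z + (-1) * g z) (y + (-1) *\<^sub>C v)"
    using assms by (intro trig_poly.add trig_poly.scale) (auto intro: trig_poly_mono)
  then show ?thesis
    by (simp add: scaleC_minus1)
qed

text \<open>A difference of trigonometric polynomials is bounded by its supremum whatever the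
  degrees, so uniform convergence of the functions forces convergence of the elements.\<close>

lemma Cauchy_trig_poly:
  assumes u: "\<And>n::nat. trig_poly w (N n) (h n) (u n)" and h: "uniform_limit circle h f sequentially"
  shows "Cauchy u"
proof (rule metric_CauchyI)
  fix e :: real assume "e > 0"
  then obtain n0 where n0: "\<And>n z. n \<ge> n0 \<Longrightarrow> z \<in> circle \<Longrightarrow> cmod (h n z - f z) < e / 4"
    using uniform_limit_sequentiallyE[OF h, of "e / 4"] unfolding dist_norm by (metis zero_less_divide_iff zero_less_numeral)
  have "dist (u m) (u n) < e" if "m \<ge> n0" "n \<ge> n0" for m n
  proof -
    have "cmod (h m z - h n z) \<le> e / 2" if "z \<in> circle" for z
      using n0[OF \<open>m \<ge> n0\<close> that] n0[OF \<open>n \<ge> n0\<close> that]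
        norm_triangle_ineq4[of "h m z - f z" "h n z - f z"] by simp
    then have "norm (u m - u n) \<le> e / 2"
      using \<open>e > 0\<close> by (intro trig_poly_norm_le_sup[OF trig_poly_diff[OF u u]]) auto
    then show ?thesis
      using \<open>e > 0\<close> by (simp add: dist_norm)
  qed
  then show "\<exists>M. \<forall>m\<ge>M. \<forall>n\<ge>M. dist (u m) (u n) < e"
    by blast
qed

lemma fun_calc_unique:
  assumes "fun_calc f y" "fun_calc f y'"
  shows "y = y'"
proof -
  obtain N h u N' h' u' where
    1: "\<And>n. trig_poly w (N n) (h n) (u n)" "uniform_limit circle h f sequentially" "u \<longlonglongrightarrow> y" and
    2: "\<And>n. trig_poly w (N' n) (h' n) (u' n)" "uniform_limit circle h' f sequentially" "u' \<longlonglongrightarrow> y'"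
    using assms unfolding fun_calc_def by metis
  have lim: "uniform_limit circle (\<lambda>n z. h n z - h' n z) (\<lambda>z. f z - f z) sequentially"
    by (intro uniform_limit_intros 1 2)
  have "(\<lambda>n. u n - u' n) \<longlonglongrightarrow> 0"
  proof (rule metric_LIMSEQ_I)
    fix e :: real assume "e > 0"
    then obtain n0 where n0: "\<And>n z. n \<ge> n0 \<Longrightarrow> z \<in> circle \<Longrightarrow> cmod (h n z - h' n z) < e / 2"
      using uniform_limit_sequentiallyE[OF lim, of "e / 2"] unfolding dist_norm diff_self diff_0_right
      by (metis zero_less_divide_iff zero_less_numeral)
    have "norm (u n - u' n) \<le> e / 2" if "n \<ge> n0" for n
      using \<open>e > 0\<close> n0[OF that]
      by (intro trig_poly_norm_le_sup[OF trig_poly_diff[OF 1(1) 2(1)]]) (auto intro: less_imp_le)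
    then show "\<exists>n0. \<forall>n\<ge>n0. dist (u n - u' n) 0 < e"
      using \<open>e > 0\<close> by (intro exI[of _ n0]) fastforce
  qed
  moreover have "(\<lambda>n. u n - u' n) \<longlonglongrightarrow> y - y'"
    by (intro tendsto_intros 1 2)
  ultimately show ?thesis
    using LIMSEQ_unique by fastforce
qed

lemma fun_calc_add:
  assumes "fun_calc f y" "fun_calc g v"
  shows "fun_calc (\<lambda>z. f z + g z) (y + v)"
proof -
  obtain N h u N' h' u' where
    1: "\<And>n. trig_poly w (N n) (h n) (u n)" "uniform_limit circle h f sequentially" "u \<longlonglongrightarrow> y" and
    2: "\<And>n. trig_poly w (N' n) (h' n) (u' n)" "uniform_limit circle h' g sequentially" "u' \<longlonglongrightarrow> v"
    using assms unfolding fun_calc_def by metis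
  have 3: "trig_poly w (max (N n) (N' n)) (\<lambda>z. h n z + h' n z) (u n + u' n)" for n
    by (intro trig_poly.add) (auto intro: trig_poly_mono 1 2)
  show ?thesis
    by (rule fun_calcI[where h = "\<lambda>n z. h n z + h' n z" and u = "\<lambda>n. u n + u' n", OF 3])
      (intro uniform_limit_intros tendsto_intros 1 2)+
qed

text \<open>Boundedness is what allows uniform limits to be multiplied in
  \<open>fun_calc_mult\<close>.\<close>

lemma fun_calc_bounded:
  assumes "fun_calc f y"
  shows "bounded (f ` circle)"
proof -
  obtain N h u where
    1: "\<And>n. trig_poly w (N n) (h n) (u n)" "uniform_limit circle h f sequentially"
    using assms unfolding fun_calc_def by metis
  then obtain n where "\<And>z. z \<in> circle \<Longrightarrow> cmod (h n z - f z) < 1"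
    using uniform_limit_sequentiallyE[OF 1(2), of 1] unfolding dist_norm by (metis zero_less_one order_refl)
  moreover obtain B where "\<And>z. z \<in> circle \<Longrightarrow> cmod (h n z) \<le> B"
    using trig_poly_bounded[OF 1(1)[of n]] unfolding bounded_iff ball_simps by blast
  ultimately have "cmod (f z) \<le> B + 1" if "z \<in> circle" for z
    using that norm_triangle_ineq4[of "h n z" "h n z - f z"] by fastforce
  then show ?thesis
    unfolding bounded_iff ball_simps by blast
qed

lemma fun_calc_mult:
  assumes "fun_calc f y" "fun_calc g v"
  shows "fun_calc (\<lambda>z. f z * g z) (y * v)"
proof -
  obtain N h u N' h' u' where
    1: "\<And>n. trig_poly w (N n) (h n) (u n)" "uniform_limit circle h f sequentially" "u \<longlonglongrightarrow> y" and
    2: "\<And>n. trig_poly w (N' n) (h' n) (u' n)" "uniform_limit circle h' g sequentially" "u' \<longlonglongrightarrow> v"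
    using assms unfolding fun_calc_def by metis
  have "uniform_limit circle (\<lambda>n z. h n z * h' n z) (\<lambda>z. f z * g z) sequentially"
    by (intro uniform_lim_mult 1 2 assms[THEN fun_calc_bounded])
  moreover have "(\<lambda>n. u n * u' n) \<longlonglongrightarrow> y * v"
    by (intro tendsto_intros 1 2)
  ultimately show ?thesis
    by (rule fun_calcI[OF trig_poly_mult[OF 1(1) 2(1)]])
qed

lemma fun_calc_trig_poly: "trig_poly w N f y \<Longrightarrow> fun_calc f y"
  unfolding fun_calc_def
  by (rule exI[of _ "\<lambda>_. N"], rule exI[of _ "\<lambda>_. f"], rule exI[of _ "\<lambda>_. y"])
    (auto intro: uniform_limit_const)

lemma fun_calc_const: "fun_calc (\<lambda>z. c) (c *\<^sub>C 1)"
  using trig_poly.scale[OF trig_poly_one, of c] by (intro fun_calc_trig_poly) simp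

lemma fun_calc_id: "fun_calc (\<lambda>z. z) w"
  using trig_poly.monom[of 1 1 w] by (intro fun_calc_trig_poly[of 1]) (simp add: unitary_power_def)

lemma fun_calc_adj:
  assumes "fun_calc f y"
  shows "fun_calc (\<lambda>z. cnj (f z)) (adj y)"
proof -
  obtain N h u where
    1: "\<And>n. trig_poly w (N n) (h n) (u n)" "uniform_limit circle h f sequentially" "u \<longlonglongrightarrow> y"
    using assms unfolding fun_calc_def by metis
  have "uniform_limit circle (\<lambda>n z. cnj (h n z)) (\<lambda>z. cnj (f z)) sequentially"
    using 1(2) by (simp add: uniform_limit_iff dist_norm flip: complex_cnj_diff)
  moreover have "(\<lambda>n. adj (u n)) \<longlonglongrightarrow> adj y"
    by (intro bounded_linear.tendsto[OF bounded_linear_adj] 1)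
  ultimately show ?thesis
    by (rule fun_calcI[OF trig_poly_adj[OF 1(1)]])
qed

lemma fun_calc_cong:
  assumes "fun_calc f y" "\<And>z. z \<in> circle \<Longrightarrow> f z = g z"
  shows "fun_calc g y"
  using assms(1) unfolding fun_calc_def
  by (metis (no_types, lifting) assms(2) uniform_limit_cong' )

lemma fun_calc_exists:
  assumes "continuous_on circle f"
  shows "\<exists>y. fun_calc f y"
  using assms
proof (rule circle_induct[where P = "\<lambda>f. \<exists>y. fun_calc f y"])
  show "\<exists>y. fun_calc cnj y"
    using fun_calc_adj[OF fun_calc_id] by blast
next
  fix f :: "complex \<Rightarrow> complex"
  assume f: "\<And>e::real. e > 0 \<Longrightarrow>
      \<exists>g. continuous_on circle g \<and> (\<exists>y. fun_calc g y) \<and> (\<forall>z\<in>circle. cmod (f z - g z) < e)"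
  \<comment> \<open>Half of the error goes into approximating by some \<open>g\<close> that has a
    calculus, half into approximating \<open>g\<close> by a trigonometric polynomial. The errors
    \<open>inverse (Suc n)\<close> then yield a diagonal sequence.\<close>
  have "\<exists>N h u. trig_poly w N h u \<and> (\<forall>z\<in>circle. cmod (h z - f z) < e)" if "e > 0" for e :: real
  proof -
    obtain g y where g: "fun_calc g y" "\<And>z. z \<in> circle \<Longrightarrow> cmod (f z - g z) < e / 2"
      using f[OF half_gt_zero[OF \<open>e > 0\<close>]] by metis
    then obtain N h u where
      1: "\<And>n. trig_poly w (N n) (h n) (u n)" "uniform_limit circle h g sequentially"
      unfolding fun_calc_def by metis
    then obtain n where n: "\<And>z. z \<in> circle \<Longrightarrow> cmod (h n z - g z) < e / 2"
      using uniform_limit_sequentiallyE[OF 1(2) half_gt_zero[OF \<open>e > 0\<close>]] unfolding dist_norm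
      by (metis order_refl)
    have "cmod (h n z - f z) < e" if "z \<in> circle" for z
      using g(2)[OF that] n[OF that] norm_triangle_ineq4[of "h n z - g z" "f z - g z"] by simp
    then show ?thesis
      using 1(1) by blast
  qed
  then have "\<forall>n. \<exists>N h u. trig_poly w N h u \<and> (\<forall>z\<in>circle. cmod (h z - f z) < inverse (real (Suc n)))"
    by simp
  then obtain N h u where
    1: "\<And>n. trig_poly w (N n) (h n) (u n)"
    and lt: "\<And>n z. z \<in> circle \<Longrightarrow> cmod (h n z - f z) < inverse (real (Suc n))"
    by metis
  have 2: "uniform_limit circle h f sequentially"
    unfolding uniform_limit_iff
  proof (intro allI impI)
    fix e :: real assume "e > 0"
    then obtain n0 where n0: "inverse (real (Suc n0)) < e"
      using reals_Archimedean by blast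
    have "cmod (h n z - f z) < e" if "n \<ge> n0" "z \<in> circle" for n z
    proof -
      have "inverse (real (Suc n)) \<le> inverse (real (Suc n0))"
        using that by (intro le_imp_inverse_le) auto
      with lt[OF that(2), of n] n0 show ?thesis by linarith
    qed
    then show "\<forall>\<^sub>F n in sequentially. \<forall>z\<in>circle. dist (h n z) (f z) < e"
      unfolding eventually_sequentially dist_norm by blast
  qed
  obtain y where "u \<longlonglongrightarrow> y"
    using Cauchy_trig_poly[OF 1 2] Cauchy_convergent_iff convergent_def by metis
  then show "\<exists>y. fun_calc f y"
    using fun_calcI[OF 1 2] by blast
qed (use fun_calc_const fun_calc_id fun_calc_add fun_calc_mult in blast)+

lemma circle_hom_exists:
  obtains \<Psi> where "star_hom circle_alg type_alg \<Psi>" "\<Psi> (restrict (\<lambda>z. z) circle) = w"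
proof -
  define \<Psi> where "\<Psi> f = (THE y. fun_calc f y)" for f
  have eq: "\<Psi> g = y" if "fun_calc f y" "\<And>z. z \<in> circle \<Longrightarrow> f z = g z" for f g y
    unfolding \<Psi>_def using fun_calc_cong[OF that] fun_calc_unique by blast
  have ex: "fun_calc f (\<Psi> f)" if "f \<in> carrier circle_alg" for f
    using fun_calc_exists[OF circle_alg_carrierE(1)[OF that]] eq by metis
  have "star_hom circle_alg type_alg \<Psi>"
    unfolding star_hom_def
  proof (intro conjI ring_hom_memI ballI allI)
    fix f g assume fg: "f \<in> carrier circle_alg" "g \<in> carrier circle_alg"
    show "\<Psi> (f \<otimes>\<^bsub>circle_alg\<^esub> g) = \<Psi> f \<otimes>\<^bsub>type_alg\<^esub> \<Psi> g"
      using eq[OF fun_calc_mult[OF ex ex], OF fg] by (simp add: circle_alg_simps)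
    show "\<Psi> (f \<oplus>\<^bsub>circle_alg\<^esub> g) = \<Psi> f \<oplus>\<^bsub>type_alg\<^esub> \<Psi> g"
      using eq[OF fun_calc_add[OF ex ex], OF fg] by (simp add: circle_alg_simps)
  next
    show "\<Psi> \<one>\<^bsub>circle_alg\<^esub> = \<one>\<^bsub>type_alg\<^esub>"
      using eq[OF fun_calc_const[of 1]] by (simp add: circle_alg_simps)
  next
    fix c f assume f: "f \<in> carrier circle_alg"
    show "\<Psi> (c \<odot>\<^bsub>circle_alg\<^esub> f) = c \<odot>\<^bsub>type_alg\<^esub> \<Psi> f"
      using eq[OF fun_calc_mult[OF fun_calc_const ex[OF f]]]
      by (simp add: circle_alg_simps mult_scaleC_left)
  next
    fix f assume f: "f \<in> carrier circle_alg"
    show "\<Psi> (star circle_alg f) = star type_alg (\<Psi> f)"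
      using eq[OF fun_calc_adj[OF ex[OF f]]] by (simp add: circle_alg_simps)
  qed simp
  moreover have "\<Psi> (restrict (\<lambda>z. z) circle) = w"
    using eq[OF fun_calc_id] by simp
  ultimately show ?thesis
    using that by blast
qed

end

section \<open>Contractivity of homomorphisms\<close>

text \<open>Successive coefficients have the ratio \<open>(1/2 - n) / (n + 1)\<close>, of modulus at
  most 1. The binomial series of \<open>sqrt (1 - t)\<close> is thus dominated by a geometric
  series.\<close>

lemma gbinomial_half_le: "\<bar>(1/2::real) gchoose n\<bar> \<le> 1"
proof (induction n)
  case (Suc n)
  have "((1/2::real) gchoose Suc n) = ((1/2 - real n) / real (Suc n)) * (1/2 gchoose n)"
    using gbinomial_absorb_comp[of "1/2::real" n] gbinomial_absorption'[of "Suc n" "1/2::real"]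
      gbinomial_mult_1[of "1/2::real" n]
    by (simp add: field_simps)
  moreover have "\<bar>(1/2 - real n) / real (Suc n)\<bar> \<le> 1"
    by (simp add: abs_if field_simps)
  ultimately show ?case
    using Suc mult_mono[of "\<bar>(1/2 - real n) / real (Suc n)\<bar>" 1 "\<bar>(1/2::real) gchoose n\<bar>" 1]
    by (simp add: abs_mult)
qed simp

text \<open>\<open>b\<close> is \<open>sqrt (1 - a * a)\<close> as a binomial series in
  \<open>a * a\<close>. The strict bound on \<open>norm a\<close> gives absolute convergence, and
  every term is self-adjoint and commutes with \<open>a\<close>.\<close>

lemma self_adjoint_sqrt:
  fixes a :: "'a::cstar_algebra"
  assumes a: "adj a = a" "norm a < 1"
  obtains b where "adj b = b" "a * b = b * a" "a * a + b * b = 1"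
proof -
  define c :: "nat \<Rightarrow> real" where "c n = (1/2 gchoose n) * (-1) ^ n" for n
  define s where "s n = c n *\<^sub>R (a * a) ^ n" for n
  have "norm (s n) \<le> norm (a * a) ^ n" for n
  proof -
    have "norm (s n) \<le> 1 * norm ((a * a) ^ n)"
      unfolding s_def c_def using gbinomial_half_le[of n]
      by (simp add: abs_mult mult_left_le_one_le)
    then show ?thesis
      using norm_power_ineq[of "a * a" n] by simp
  qed
  moreover have "norm (a * a) < 1"
    using a cstar_identity[of a] by (simp add: abs_square_less_1)
  ultimately have sum: "summable (\<lambda>n. norm (s n))"
    by (intro summable_comparison_test[OF _ summable_geometric[of "norm (a * a)"]]) auto
  define b where "b = suminf s"
  have sb: "s sums b"
    using summable_norm_cancel[OF sum] by (simp add: b_def summable_sums)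
  have "adj b = b"
  proof -
    have "adj (s n) = s n" for n
      unfolding s_def using a
      by (simp add: linear_scale[OF bounded_linear.linear[OF bounded_linear_adj]] adj_power adj_mult)
    then show ?thesis
      using bounded_linear.sums[OF bounded_linear_adj sb] sb sums_unique2 by simp blast
  qed
  moreover have "a * b = b * a"
  proof -
    have "a * s n = s n * a" for n
      unfolding s_def by (simp add: power_commuting_commutes mult.assoc)
    then show ?thesis
      using sums_mult[OF sb, of a] sums_mult2[OF sb, of a] sums_unique2 by simp blast
  qed
  moreover have "b * b = 1 - a * a"
  proof -
    \<comment> \<open>Vandermonde turns the Cauchy product into the binomial series with exponent
      \<open>1/2 + 1/2 = 1\<close>, so only the terms giving \<open>1 - a * a\<close>
      survive.\<close>
    have "(\<Sum>i\<le>n. s i * s (n - i)) = (of_nat (1 choose n) * (-1) ^ n) *\<^sub>R (a * a) ^ n" for n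
    proof -
      have "(\<Sum>i\<le>n. s i * s (n - i)) = (\<Sum>i\<le>n. (c i * c (n - i)) *\<^sub>R (a * a) ^ n)"
        by (intro sum.cong) (simp_all add: s_def flip: power_add)
      also have "\<dots> = (\<Sum>i\<le>n. c i * c (n - i)) *\<^sub>R (a * a) ^ n"
        by (rule scaleR_sum_left[symmetric])
      also have "(\<Sum>i\<le>n. c i * c (n - i)) =
          (\<Sum>i\<in>{0..n}. ((1/2) gchoose i) * ((1/2) gchoose (n - i))) * (-1) ^ n"
        unfolding sum_distrib_right atLeast0AtMost
        by (intro sum.cong) (auto simp: c_def simp flip: power_add)
      also have "\<dots> = ((1::real) gchoose n) * (-1) ^ n"
        by (subst gbinomial_Vandermonde) simp
      also have "(1::real) gchoose n = of_nat (1 choose n)"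
        using binomial_gbinomial[of 1 n, where 'a = real] by simp
      finally show ?thesis .
    qed
    then have "(\<lambda>n. (of_nat (1 choose n) * (-1) ^ n) *\<^sub>R (a * a) ^ n) sums (b * b)"
      using Cauchy_product_sums[OF sum sum] by (simp add: b_def)
    moreover have "(\<lambda>n. (of_nat (1 choose n) * (-1) ^ n) *\<^sub>R (a * a) ^ n) sums
        (\<Sum>n\<in>{0,1}. (of_nat (1 choose n) * (-1) ^ n) *\<^sub>R (a * a) ^ n)"
      by (rule sums_finite) auto
    ultimately show ?thesis
      using sums_unique2 by fastforce
  qed
  ultimately show ?thesis
    using that by simp
qed

lemma
  assumes "star_hom (type_alg :: 'a::cstar_algebra cstar) (type_alg :: 'b::cstar_algebra cstar) \<phi>"
  shows star_hom_add: "\<phi> (a + b) = \<phi> a + \<phi> b"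
    and star_hom_mult: "\<phi> (a * b) = \<phi> a * \<phi> b"
    and star_hom_one: "\<phi> 1 = 1"
    and star_hom_scaleC: "\<phi> (c *\<^sub>C a) = c *\<^sub>C \<phi> a"
    and star_hom_adj: "\<phi> (adj a) = adj (\<phi> a)"
  using assms by (auto simp: star_hom_def ring_hom_def)

text \<open>As for functions on the circle, a self-adjoint \<open>a\<close> with norm less than \<open>1\<close> is the average of
  the unitaries \<open>a \<plusminus> \<i> b\<close>, and unitaries are mapped to unitaries.\<close>

lemma star_hom_norm_le:
  fixes \<phi> :: "'a::cstar_algebra \<Rightarrow> 'b::cstar_algebra"
  assumes H: "star_hom type_alg type_alg \<phi>"
  shows "norm (\<phi> a) \<le> norm a"
proof -
  note simps = star_hom_add[OF H] star_hom_mult[OF H] star_hom_one[OF H] star_hom_scaleC[OF H]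
    star_hom_adj[OF H]
  have le1: "norm (\<phi> a) \<le> 1" if a: "adj a = a" "norm a < 1" for a
  proof -
    obtain b where b: "adj b = b" "a * b = b * a" "a * a + b * b = 1"
      using self_adjoint_sqrt[OF a] by metis
    define u v where "u = a + \<i> *\<^sub>C b" and "v = a + (- \<i>) *\<^sub>C b"
    have adj: "adj u = v" "adj v = u"
      by (simp_all add: u_def v_def adj_add adj_scaleC a b)
    have "v * u = a * a + b * b + (\<i> *\<^sub>C (a * b) + (- \<i>) *\<^sub>C (b * a))"
      "u * v = a * a + b * b + (\<i> *\<^sub>C (b * a) + (- \<i>) *\<^sub>C (a * b))"
      by (simp_all add: u_def v_def algebra_simps mult_scaleC_left mult_scaleC_right scaleC_scaleC
          scaleC_add_right scaleC_add_left)
    then have "v * u = (a * a + b * b) + (\<i> + (- \<i>)) *\<^sub>C (a * b)"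
      "u * v = (a * a + b * b) + (\<i> + (- \<i>)) *\<^sub>C (a * b)"
      unfolding scaleC_add_left by (simp_all add: b(2))
    then have "v * u = 1" "u * v = 1"
      using b(3) by simp_all
    then have n: "norm (\<phi> u) = 1" "norm (\<phi> v) = 1"
      by (simp_all add: norm_unitary adj flip: simps)
    have "u + v = (1 + 1) *\<^sub>C a + (\<i> + (- \<i>)) *\<^sub>C b"
      by (simp only: u_def v_def scaleC_add_left scaleC_one ac_simps)
    then have "a = (1/2) *\<^sub>C (u + v)"
      by (simp add: scaleC_scaleC)
    then have "\<phi> a = (1/2) *\<^sub>C (\<phi> u + \<phi> v)"
      using simps(4)[of "1/2" "u + v"] simps(1)[of u v] by argo
    then show ?thesis
      using n norm_triangle_ineq[of "\<phi> u" "\<phi> v"] by (simp add: norm_scaleC)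
  qed
  have le: "norm (\<phi> a) \<le> norm a" if "adj a = a" for a
  proof (rule field_le_epsilon)
    fix e :: real assume "e > 0"
    \<comment> \<open>\<open>le1\<close> requires norm strictly below 1, so \<open>a\<close> is
      scaled by slightly more than its norm. This also covers \<open>a = 0\<close>.\<close>
    define r where "r = norm a + e"
    have r: "r > 0" "norm a < r"
      using \<open>e > 0\<close> norm_ge_zero[of a] by (auto simp: r_def simp del: norm_ge_zero)
    have "norm (\<phi> (of_real (1 / r) *\<^sub>C a)) \<le> 1"
    proof (rule le1)
      show "adj (of_real (1 / r) *\<^sub>C a) = of_real (1 / r) *\<^sub>C a"
        by (simp only: adj_scaleC that complex_cnj_complex_of_real)
      show "norm (of_real (1 / r) *\<^sub>C a) < 1"
        unfolding norm_scaleC using r by (simp add: norm_divide)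
    qed
    then show "norm (\<phi> a) \<le> norm a + e"
      unfolding simps norm_scaleC norm_of_real using r \<open>e > 0\<close> by (simp add: r_def divide_simps mult.commute)
  qed
  have "(norm (\<phi> a))\<^sup>2 = norm (\<phi> (adj a * a))"
    by (simp add: simps cstar_identity)
  also have "\<dots> \<le> norm (adj a * a)"
    by (rule le) (simp add: adj_mult adj_adj)
  finally have "(norm (\<phi> a))\<^sup>2 \<le> (norm a)\<^sup>2"
    by (simp add: cstar_identity)
  then show ?thesis
    by (simp add: power2_le_iff_abs_le)
qed

lemma star_hom_bounded_linear:
  fixes \<phi> :: "'a::cstar_algebra \<Rightarrow> 'b::cstar_algebra"
  assumes H: "star_hom type_alg type_alg \<phi>"
  shows "bounded_linear \<phi>"
proof (rule bounded_linear_intro[where K = 1])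
  show "\<phi> (r *\<^sub>R a) = r *\<^sub>R \<phi> a" for r a
    using star_hom_scaleC[OF H, of "of_real r"] by (simp add: scaleC_of_real)
qed (simp_all add: star_hom_add[OF H] star_hom_norm_le[OF H])

text \<open>The set of agreement is closed by contractivity, hence a C*-subalgebra, and it contains
  generators.\<close>

lemma star_hom_eqI:
  fixes \<phi> \<psi> :: "'a::cstar_algebra \<Rightarrow> 'b::cstar_algebra"
  assumes H: "star_hom type_alg type_alg \<phi>" and H': "star_hom type_alg type_alg \<psi>"
    and gen: "\<And>S. cstar_subalgebra S \<Longrightarrow> X \<subseteq> S \<Longrightarrow> S = UNIV"
    and X: "\<And>a. a \<in> X \<Longrightarrow> \<phi> a = \<psi> a"
  shows "\<phi> = \<psi>"
proof -
  have "cstar_subalgebra {a. \<phi> a = \<psi> a}"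
    unfolding cstar_subalgebra_def
    by (simp add: star_hom_add[OF H] star_hom_add[OF H'] star_hom_mult[OF H] star_hom_mult[OF H']
        star_hom_one[OF H] star_hom_one[OF H'] star_hom_scaleC[OF H] star_hom_scaleC[OF H']
        star_hom_adj[OF H] star_hom_adj[OF H'] closed_Collect_eq linear_continuous_on[OF star_hom_bounded_linear[OF H]]
        linear_continuous_on[OF star_hom_bounded_linear[OF H']])
  then show ?thesis
    using gen[of "{a. \<phi> a = \<psi> a}"] X by (auto simp: fun_eq_iff)
qed

lemma star_hom_comp:
  assumes "star_hom A B \<phi>" "star_hom B C \<psi>"
  shows "star_hom A C (\<psi> \<circ> \<phi>)"
proof -
  have "\<phi> a \<in> carrier B" if "a \<in> carrier A" for a
    using assms(1) that by (auto simp: star_hom_def ring_hom_closed)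
  then show ?thesis
    using assms ring_hom_trans[of \<phi> A B \<psi> C] by (simp add: star_hom_def)
qed

section \<open>Operators on \<open>\<ell>\<^sup>2(\<int>)\<close>\<close>

typedef ell2 = "{f :: int \<Rightarrow> complex. (\<lambda>n. (cmod (f n))\<^sup>2) summable_on UNIV}"
  morphisms coef ell2
  by (rule exI[of _ "\<lambda>_. 0"]) simp

definition square_summable :: "(int \<Rightarrow> complex) \<Rightarrow> bool" where
  "square_summable f \<longleftrightarrow> (\<lambda>n. (cmod (f n))\<^sup>2) summable_on UNIV"

lemma coef_ell2: "square_summable f \<Longrightarrow> coef (ell2 f) = f"
  by (simp add: ell2_inverse square_summable_def)

lemma square_summable_coef [simp]: "square_summable (coef u)"
  using coef[of u] by (simp add: square_summable_def)

lemma ell2_eqI: "(\<And>n. coef u n = coef v n) \<Longrightarrow> u = v"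
  by (metis coef_inject ext)

lemma square_summable_bounded_mult:
  assumes "square_summable f" "\<And>n. cmod (g n) \<le> M * cmod (f n)"
  shows "square_summable g"
  unfolding square_summable_def
proof (rule summable_on_comparison_test)
  show "(\<lambda>n. M\<^sup>2 * (cmod (f n))\<^sup>2) summable_on UNIV"
    using assms(1) unfolding square_summable_def by (rule summable_on_cmult_right)
  show "(cmod (g n))\<^sup>2 \<le> M\<^sup>2 * (cmod (f n))\<^sup>2" for n
    using power_mono[OF assms(2) norm_ge_zero, of n 2] by (simp add: power_mult_distrib)
qed simp

lemma square_summable_zero [simp]: "square_summable (\<lambda>n. 0)"
  by (simp add: square_summable_def)

lemma square_summable_add:
  assumes "square_summable f" "square_summable g"
  shows "square_summable (\<lambda>n. f n + g n)"
  unfolding square_summable_def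
proof (rule summable_on_comparison_test)
  show "(\<lambda>n. 2 * (cmod (f n))\<^sup>2 + 2 * (cmod (g n))\<^sup>2) summable_on UNIV"
    using assms unfolding square_summable_def by (intro summable_on_add summable_on_cmult_right)
  show "(cmod (f n + g n))\<^sup>2 \<le> 2 * (cmod (f n))\<^sup>2 + 2 * (cmod (g n))\<^sup>2" for n
  proof -
    have "(cmod (f n + g n))\<^sup>2 \<le> (cmod (f n) + cmod (g n))\<^sup>2"
      by (intro power_mono norm_triangle_ineq) simp
    also have "\<dots> \<le> 2 * (cmod (f n))\<^sup>2 + 2 * (cmod (g n))\<^sup>2"
      using zero_le_power2[of "cmod (f n) - cmod (g n)"] by (simp add: power2_eq_square algebra_simps)
    finally show ?thesis .
  qed
qed simp

lemma square_summable_shift: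
  assumes "square_summable f"
  shows "square_summable (\<lambda>n. f (n - j))"
proof -
  have "bij_betw (\<lambda>n. n - j) UNIV (UNIV :: int set)"
    by (rule bij_betwI[of _ _ _ "\<lambda>n. n + j"]) auto
  then show ?thesis
    using assms summable_on_reindex_bij_betw[of "\<lambda>n. n - j" UNIV UNIV "\<lambda>n. (cmod (f n))\<^sup>2"]
    by (simp add: square_summable_def)
qed

lemma square_summable_inner:
  assumes "square_summable f" "square_summable g"
  shows "(\<lambda>n. f n \<bullet> g n) summable_on UNIV"
proof (rule abs_summable_summable, rule summable_on_comparison_test)
  show "(\<lambda>n. (cmod (f n))\<^sup>2 + (cmod (g n))\<^sup>2) summable_on UNIV"
    using assms unfolding square_summable_def by (rule summable_on_add)
  show "norm (f n \<bullet> g n) \<le> (cmod (f n))\<^sup>2 + (cmod (g n))\<^sup>2" for n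
  proof -
    have "norm (f n \<bullet> g n) \<le> cmod (f n) * cmod (g n)"
      using Cauchy_Schwarz_ineq2 by simp
    also have "\<dots> \<le> (cmod (f n))\<^sup>2 + (cmod (g n))\<^sup>2"
      using sum_squares_bound[of "cmod (f n)" "cmod (g n)"] mult_nonneg_nonneg[OF norm_ge_zero norm_ge_zero, of "f n" "g n"]
      by linarith
    finally show ?thesis .
  qed
qed simp

instantiation ell2 :: real_inner
begin

definition "0 = ell2 (\<lambda>n. 0)"
definition "u + v = ell2 (\<lambda>n. coef u n + coef v n)"
definition "r *\<^sub>R u = ell2 (\<lambda>n. r *\<^sub>R coef u n)"
definition "- u = ell2 (\<lambda>n. - coef u n)"
definition "u - v = u + - (v :: ell2)"
text \<open>The summands use the real inner product of the plane, so this is the real part of the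
  usual inner product of l^2, with the same norm. Complex scalars enter later as operators.\<close>

definition "u \<bullet> v = (\<Sum>\<^sub>\<infinity>n. coef u n \<bullet> coef v n)"
definition "norm (u :: ell2) = sqrt (u \<bullet> u)"
definition "sgn (u :: ell2) = inverse (norm u) *\<^sub>R u"
definition "dist u v = norm (u - v :: ell2)"
definition [code del]: "(uniformity :: (ell2 \<times> ell2) filter) = (INF e\<in>{0<..}. principal {(u, v). dist u v < e})"
definition [code del]: "open (U :: ell2 set) \<longleftrightarrow> (\<forall>u\<in>U. eventually (\<lambda>(u', v). u' = u \<longrightarrow> v \<in> U) uniformity)"

lemma coef_zero: "coef 0 n = 0"
  by (simp add: zero_ell2_def coef_ell2)

lemma coef_add: "coef (u + v) n = coef u n + coef v n"
  by (simp add: plus_ell2_def coef_ell2 square_summable_add)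

lemma coef_scaleR: "coef (r *\<^sub>R u) n = r *\<^sub>R coef u n"
proof -
  have "square_summable (\<lambda>n. r *\<^sub>R coef u n)"
    by (rule square_summable_bounded_mult[of "coef u" _ "\<bar>r\<bar>"]) auto
  then show ?thesis
    by (simp add: scaleR_ell2_def coef_ell2)
qed

lemma coef_uminus: "coef (- u) n = - coef u n"
proof -
  have "square_summable (\<lambda>n. - coef u n)"
    by (rule square_summable_bounded_mult[of "coef u" _ "1"]) auto
  then show ?thesis
    by (simp add: uminus_ell2_def coef_ell2)
qed

lemmas coef_simps = coef_zero coef_add coef_scaleR coef_uminus

instance
proof
  fix u v x :: ell2 and r s :: real
  show "u + v + x = u + (v + x)" "u + v = v + u" "0 + u = u" "- u + u = 0" "u - v = u + - v"
    "r *\<^sub>R (u + v) = r *\<^sub>R u + r *\<^sub>R v" "(r + s) *\<^sub>R u = r *\<^sub>R u + s *\<^sub>R u"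
    "r *\<^sub>R s *\<^sub>R u = (r * s) *\<^sub>R u" "1 *\<^sub>R u = u"
    by (auto intro!: ell2_eqI simp: coef_simps minus_ell2_def algebra_simps)
  show "u \<bullet> v = v \<bullet> u"
    by (simp add: inner_ell2_def inner_commute)
  show "(u + v) \<bullet> x = u \<bullet> x + v \<bullet> x"
    by (simp add: inner_ell2_def coef_simps inner_add_left infsum_add square_summable_inner)
  show "(r *\<^sub>R u) \<bullet> v = r * (u \<bullet> v)"
    by (simp add: inner_ell2_def coef_simps infsum_cmult_right' del: inner_complex_def)
  show "0 \<le> u \<bullet> u"
    by (simp add: inner_ell2_def infsum_nonneg)
  show "u \<bullet> u = 0 \<longleftrightarrow> u = 0"
  proof
    assume "u \<bullet> u = 0"
    then have "coef u n \<bullet> coef u n = 0" for n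
      using nonneg_infsum_le_0D[of "\<lambda>n. coef u n \<bullet> coef u n" UNIV n] square_summable_inner[of "coef u" "coef u"]
      by (simp add: inner_ell2_def)
    then show "u = 0"
      by (intro ell2_eqI) (simp add: coef_simps)
  qed (simp add: inner_ell2_def coef_simps)
qed (simp_all add: norm_ell2_def sgn_ell2_def dist_ell2_def uniformity_ell2_def open_ell2_def)

end

lemma coef_diff: "coef (u - v) n = coef u n - coef v n"
  unfolding minus_ell2_def coef_simps by simp

lemma norm_ell2_power2: "(norm u)\<^sup>2 = (\<Sum>\<^sub>\<infinity>n. (cmod (coef u n))\<^sup>2)"
  by (simp add: power2_norm_eq_inner inner_ell2_def)

lemma sum_le_norm_ell2:
  assumes "finite F"
  shows "(\<Sum>n\<in>F. (cmod (coef u n))\<^sup>2) \<le> (norm u)\<^sup>2"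
  unfolding norm_ell2_power2
  using square_summable_coef[of u] assms by (intro finite_sum_le_infsum) (auto simp: square_summable_def)

lemma cmod_coef_le: "cmod (coef u n) \<le> norm u"
  using sum_le_norm_ell2[of "{n}" u] by (simp add: power2_le_iff_abs_le)

text \<open>Membership and norm bound are both read off from finite partial sums, the form in which
  coordinatewise limits can be controlled.\<close>

lemma ell2_bound:
  assumes "\<And>F. finite F \<Longrightarrow> (\<Sum>n\<in>F. (cmod (f n))\<^sup>2) \<le> B\<^sup>2" "B \<ge> 0"
  shows "square_summable f" "norm (ell2 f) \<le> B"
proof -
  show f: "square_summable f"
    unfolding square_summable_def
    by (rule nonneg_bdd_above_summable_on) (use assms in \<open>auto simp: bdd_above_def\<close>)
  have "(norm (ell2 f))\<^sup>2 \<le> B\<^sup>2"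
    unfolding norm_ell2_power2 coef_ell2[OF f]
    using f assms by (intro infsum_le_finite_sums) (auto simp: square_summable_def)
  then show "norm (ell2 f) \<le> B"
    using assms(2) by (simp add: power2_le_iff_abs_le)
qed

instance ell2 :: banach
proof
  fix X :: "nat \<Rightarrow> ell2" assume X: "Cauchy X"
  have "convergent (\<lambda>k. coef (X k) n)" for n
  proof (rule Cauchy_convergent, rule CauchyI)
    fix e :: real assume "e > 0"
    then obtain M where "\<And>k m. k \<ge> M \<Longrightarrow> m \<ge> M \<Longrightarrow> norm (X k - X m) < e"
      using CauchyD[OF X] by blast
    then show "\<exists>M. \<forall>k\<ge>M. \<forall>m\<ge>M. norm (coef (X k) n - coef (X m) n) < e"
      using cmod_coef_le[of "X _ - X _" n] by (metis coef_diff order_le_less_trans)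
  qed
  then obtain f where f: "\<And>n. (\<lambda>k. coef (X k) n) \<longlonglongrightarrow> f n"
    unfolding convergent_def by metis
  have bound: "\<exists>M. \<forall>k\<ge>M. square_summable (\<lambda>n. coef (X k) n - f n) \<and>
      norm (ell2 (\<lambda>n. coef (X k) n - f n)) \<le> e" if "e > 0" for e
  proof -
    obtain M where M: "\<And>k m. k \<ge> M \<Longrightarrow> m \<ge> M \<Longrightarrow> norm (X k - X m) < e"
      using CauchyD[OF X \<open>e > 0\<close>] by blast
    \<comment> \<open>On a finite index set the Cauchy estimate survives the coordinatewise limit in
      \<open>m\<close>; \<open>ell2_bound\<close> then lifts it to the full norm, for all
      \<open>k \<ge> M\<close> at once.\<close>
    have "(\<Sum>n\<in>F. (cmod (coef (X k) n - f n))\<^sup>2) \<le> e\<^sup>2" if "finite F" "k \<ge> M" for F k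
    proof (rule tendsto_upperbound)
      show "(\<lambda>m. \<Sum>n\<in>F. (cmod (coef (X k) n - coef (X m) n))\<^sup>2) \<longlonglongrightarrow>
          (\<Sum>n\<in>F. (cmod (coef (X k) n - f n))\<^sup>2)"
        by (intro tendsto_intros f)
      show "\<forall>\<^sub>F m in sequentially. (\<Sum>n\<in>F. (cmod (coef (X k) n - coef (X m) n))\<^sup>2) \<le> e\<^sup>2"
        unfolding eventually_sequentially
      proof (intro exI[of _ M] allI impI)
        fix m assume "M \<le> m"
        then have "(norm (X k - X m))\<^sup>2 \<le> e\<^sup>2"
          using M[of k m] that by (intro power_mono) auto
        then show "(\<Sum>n\<in>F. (cmod (coef (X k) n - coef (X m) n))\<^sup>2) \<le> e\<^sup>2"
          using sum_le_norm_ell2[OF that(1), of "X k - X m"] by (simp add: coef_diff)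
      qed
    qed simp
    then show ?thesis
      using ell2_bound[of _ e] \<open>e > 0\<close> by (intro exI[of _ M]) auto
  qed
  obtain M where "square_summable (\<lambda>n. coef (X M) n - f n)"
    using bound[of 1] by auto
  \<comment> \<open>\<open>f\<close> is a member of the sequence minus a square summable
    error.\<close>
  then have "square_summable (\<lambda>n. coef (X M) n + - (coef (X M) n - f n))"
    by (intro square_summable_add square_summable_coef)
      (rule square_summable_bounded_mult[of "\<lambda>n. coef (X M) n - f n" _ 1], auto simp: norm_minus_commute)
  then have sf: "square_summable f" by simp
  have "X \<longlonglongrightarrow> ell2 f"
  proof (rule LIMSEQ_I)
    fix e :: real assume "e > 0"
    then obtain M where M: "\<forall>k\<ge>M. square_summable (\<lambda>n. coef (X k) n - f n) \<and>
      norm (ell2 (\<lambda>n. coef (X k) n - f n)) \<le> e / 2"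
      using bound[of "e / 2"] by auto
    have "norm (X k - ell2 f) < e" if "k \<ge> M" for k
    proof -
      have "X k - ell2 f = ell2 (\<lambda>n. coef (X k) n - f n)"
        using M that by (intro ell2_eqI) (simp add: coef_diff coef_ell2 sf)
      then show ?thesis
        using M that \<open>e > 0\<close> by fastforce
    qed
    then show "\<exists>no. \<forall>n\<ge>no. norm (X n - ell2 f) < e" by blast
  qed
  then show "convergent X"
    by (auto simp: convergent_def)
qed

section \<open>Weighted shifts and complex scalars on l^2\<close>

text \<open>On the standard basis this is \<open>e\<^sub>n \<mapsto> d (n + j) e\<^bsub>n + j\<^esub>\<close>.\<close>

definition weighted_shift :: "(int \<Rightarrow> complex) \<Rightarrow> int \<Rightarrow> ell2 \<Rightarrow>\<^sub>L ell2" where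
  "weighted_shift d j = Blinfun (\<lambda>u. ell2 (\<lambda>n. d n * coef u (n - j)))"

text \<open>\<open>Blinfun\<close> is meaningful only for bounded linear maps. A bound for
  \<open>d\<close> bounds the operator because shifting the index set only relabels the sum of
  squares.\<close>

lemma coef_weighted_shift:
  assumes "bounded (range d)"
  shows "coef (weighted_shift d j u) n = d n * coef u (n - j)"
proof -
  obtain M where M: "\<And>n. cmod (d n) \<le> M"
    using assms by (auto simp: bounded_iff)
  then have "M \<ge> 0"
    using norm_ge_zero order_trans by blast
  have le: "cmod (d n * c) \<le> M * cmod c" for n c
    using M by (simp add: norm_mult mult_right_mono)
  have s: "square_summable (\<lambda>n. d n * coef u (n - j))" for u
    by (rule square_summable_bounded_mult[OF square_summable_shift[of "coef u" j]]) (use le in auto)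
  define A where "A u = ell2 (\<lambda>n. d n * coef u (n - j))" for u
  have A: "coef (A u) n = d n * coef u (n - j)" for u n
    by (simp add: A_def coef_ell2 s)
  have "bounded_linear A"
  proof (rule bounded_linear_intro[where K = M])
    show "norm (A u) \<le> norm u * M" for u
      unfolding A_def
    proof (rule ell2_bound)
      fix F :: "int set" assume F: "finite F"
      have "(\<Sum>n\<in>F. (cmod (d n * coef u (n - j)))\<^sup>2) \<le> (\<Sum>n\<in>F. M\<^sup>2 * (cmod (coef u (n - j)))\<^sup>2)"
        using power_mono[OF le norm_ge_zero, of _ _ 2] by (intro sum_mono) (simp add: power_mult_distrib)
      also have "\<dots> = M\<^sup>2 * (\<Sum>n\<in>(\<lambda>n. n - j) ` F. (cmod (coef u n))\<^sup>2)"
        by (subst sum.reindex) (auto simp: inj_on_def sum_distrib_left)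
      also have "\<dots> \<le> M\<^sup>2 * (norm u)\<^sup>2"
        using F by (intro mult_left_mono sum_le_norm_ell2) auto
      finally show "(\<Sum>n\<in>F. (cmod (d n * coef u (n - j)))\<^sup>2) \<le> (norm u * M)\<^sup>2"
        by (simp add: power_mult_distrib mult.commute)
    qed (use \<open>M \<ge> 0\<close> in simp)
  qed (auto intro!: ell2_eqI simp: A coef_simps algebra_simps)
  then show ?thesis
    by (simp add: weighted_shift_def bounded_linear_Blinfun_apply A flip: A_def)
qed

lemma bounded_range_mult:
  assumes "bounded (range d)" "bounded (range e)"
  shows "bounded (range (\<lambda>n. d n * (e (f n)) :: complex))"
proof -
  obtain M K where M: "\<And>n. cmod (d n) \<le> M" and K: "\<And>n. cmod (e n) \<le> K"
    using assms by (auto simp: bounded_iff)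
  have "cmod (d n * e (f n)) \<le> M * K" for n
    unfolding norm_mult using M K order_trans[OF norm_ge_zero M] by (intro mult_mono) auto
  then show ?thesis
    by (auto simp: bounded_iff)
qed

lemma bounded_range_cnj:
  "bounded (range d) \<Longrightarrow> bounded (range (\<lambda>n. cnj (d (f n))))"
  by (auto simp: bounded_iff)

lemma weighted_shift_compose:
  assumes "bounded (range d)" "bounded (range e)"
  shows "weighted_shift d j o\<^sub>L weighted_shift e l = weighted_shift (\<lambda>n. d n * e (n - j)) (j + l)"
  using bounded_range_mult[OF assms, of "\<lambda>n. n - j"]
  by (intro blinfun_eqI ell2_eqI) (simp add: coef_weighted_shift assms algebra_simps)

lemma weighted_shift_add:
  assumes "bounded (range d)" "bounded (range e)"
  shows "weighted_shift d j + weighted_shift e j = weighted_shift (\<lambda>n. d n + e n) j"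
proof -
  have "bounded (range (\<lambda>n. d n + e n))"
    using bounded_plus_comp[OF assms] by simp
  then show ?thesis
    by (intro blinfun_eqI ell2_eqI)
      (simp add: coef_weighted_shift assms blinfun.add_left coef_add algebra_simps)
qed

lemma weighted_shift_one: "weighted_shift (\<lambda>n. 1) 0 = id_blinfun"
  by (intro blinfun_eqI ell2_eqI) (simp add: coef_weighted_shift)

lemma weighted_shift_adjoint:
  assumes "bounded (range d)"
  shows "weighted_shift d j u \<bullet> v = u \<bullet> weighted_shift (\<lambda>n. cnj (d (n + j))) (- j) v"
proof -
  have bij: "bij_betw (\<lambda>n. n + j) UNIV (UNIV :: int set)"
    by (rule bij_betwI[of _ _ _ "\<lambda>n. n - j"]) auto
  have "weighted_shift d j u \<bullet> v = (\<Sum>\<^sub>\<infinity>n. (d n * coef u (n - j)) \<bullet> coef v n)"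
    by (simp add: inner_ell2_def coef_weighted_shift assms)
  also have "\<dots> = (\<Sum>\<^sub>\<infinity>n. (d (n + j) * coef u n) \<bullet> coef v (n + j))"
    using infsum_reindex_bij_betw[OF bij, of "\<lambda>n. (d n * coef u (n - j)) \<bullet> coef v n"] by simp
  also have "\<dots> = (\<Sum>\<^sub>\<infinity>n. coef u n \<bullet> (cnj (d (n + j)) * coef v (n + j)))"
    by (intro infsum_cong) (simp add: inner_complex_def algebra_simps)
  finally show ?thesis
    using bounded_range_cnj[OF assms, of "\<lambda>n. n + j"]
    by (simp add: inner_ell2_def coef_weighted_shift)
qed

text \<open>Operators carry real multiples only, so multiplication by a complex scalar is itself an
  operator and scaling means composing with it.\<close>

definition cmul :: "complex \<Rightarrow> ell2 \<Rightarrow>\<^sub>L ell2" where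
  "cmul c = weighted_shift (\<lambda>_. c) 0"

lemma coef_cmul [simp]: "coef (cmul c u) n = c * coef u n"
  by (simp add: cmul_def coef_weighted_shift image_constant_conv)

lemma cmul_compose: "cmul c o\<^sub>L cmul d = cmul (c * d)"
  by (intro blinfun_eqI ell2_eqI) simp

lemma cmul_add: "cmul c + cmul d = cmul (c + d)"
  by (intro blinfun_eqI ell2_eqI) (simp add: blinfun.add_left coef_add distrib_right)

lemma cmul_one: "cmul 1 = id_blinfun"
  by (intro blinfun_eqI ell2_eqI) simp

lemma cmul_adjoint: "cmul c u \<bullet> v = u \<bullet> cmul (cnj c) v"
  unfolding cmul_def by (subst weighted_shift_adjoint) (simp_all add: image_constant_conv)

lemma norm_cmul_le: "norm (cmul c) \<le> cmod c"
proof (rule norm_blinfun_bound)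
  fix u
  have "(norm (cmul c u))\<^sup>2 = (cmod c)\<^sup>2 * (norm u)\<^sup>2"
    unfolding norm_ell2_power2
    by (simp add: norm_mult power_mult_distrib infsum_cmult_right')
  then show "norm (cmul c u) \<le> cmod c * norm u"
    by (metis norm_ge_zero mult_nonneg_nonneg order_refl power2_eq_imp_eq power_mult_distrib)
qed simp

text \<open>The lower estimate is the upper one for \<open>inverse c\<close>, since \<open>T\<close>
  is recovered from \<open>cmul c o\<^sub>L T\<close>.\<close>

lemma norm_cmul_compose: "norm (cmul c o\<^sub>L T) = cmod c * norm T"
proof (cases "c = 0")
  case True
  then have "cmul c o\<^sub>L T = 0"
    by (intro blinfun_eqI ell2_eqI) (simp add: coef_zero)
  with True show ?thesis by simp
next
  case False
  have le: "norm (cmul c o\<^sub>L T) \<le> cmod c * norm T" for c T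
    using norm_blinfun_compose[of "cmul c" T] norm_cmul_le[of c]
    by (meson mult_right_mono norm_ge_zero order_trans)
  have "T = cmul (inverse c) o\<^sub>L (cmul c o\<^sub>L T)"
    using False by (intro blinfun_eqI ell2_eqI) simp
  then have "norm T \<le> cmod (inverse c) * norm (cmul c o\<^sub>L T)"
    using le by metis
  with False have "cmod c * norm T \<le> norm (cmul c o\<^sub>L T)"
    by (simp add: norm_inverse pos_le_divide_eq mult.commute flip: divide_inverse_commute)
  with le[of c T] show ?thesis by simp
qed

section \<open>The C*-algebra of adjointable operators\<close>

text \<open>Complex linearity is imposed separately because \<open>\<Rightarrow>\<^sub>L\<close> consists of real-linear maps.\<close>

definition operators :: "(ell2 \<Rightarrow>\<^sub>L ell2) set" where
  "operators = {T. (\<exists>S. \<forall>u v. blinfun_apply T u \<bullet> v = u \<bullet> blinfun_apply S v) \<and>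
     (\<forall>c. T o\<^sub>L cmul c = cmul c o\<^sub>L T)}"

text \<open>An adjoint exists by membership in \<open>operators\<close>. Inner products separate
  vectors, so it is unique and the choice is harmless.\<close>

definition adjoint_op :: "(ell2 \<Rightarrow>\<^sub>L ell2) \<Rightarrow> (ell2 \<Rightarrow>\<^sub>L ell2)" where
  "adjoint_op T = (SOME S. \<forall>u v. blinfun_apply T u \<bullet> v = u \<bullet> blinfun_apply S v)"

lemma adjoint_op:
  assumes "T \<in> operators"
  shows "blinfun_apply T u \<bullet> v = u \<bullet> adjoint_op T v"
proof -
  have "\<exists>S. \<forall>u v. blinfun_apply T u \<bullet> v = u \<bullet> blinfun_apply S v"
    using assms by (auto simp: operators_def)
  from someI_ex[OF this] show ?thesis
    unfolding adjoint_op_def by blast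
qed

lemma inner_ell2_eqI: "(\<And>u. u \<bullet> v = u \<bullet> v') \<Longrightarrow> v = (v' :: ell2)"
  using vector_eq_ldot[of v v'] by (simp add: inner_commute)

lemma operator_cmul:
  assumes "T \<in> operators"
  shows "T (cmul c u) = cmul c (T u)"
proof -
  have "T o\<^sub>L cmul c = cmul c o\<^sub>L T"
    using assms unfolding operators_def by blast
  then have "(T o\<^sub>L cmul c) u = (cmul c o\<^sub>L T) u"
    by (rule arg_cong)
  then show ?thesis by simp
qed

lemma operatorsI:
  assumes "\<And>u v. blinfun_apply T u \<bullet> v = u \<bullet> blinfun_apply S v"
    and "\<And>c u. T (cmul c u) = cmul c (T u)"
  shows "T \<in> operators" "adjoint_op T = S"
proof -
  show T: "T \<in> operators"
    using assms by (auto simp: operators_def intro!: blinfun_eqI)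
  show "adjoint_op T = S"
    using adjoint_op[OF T] assms(1) by (intro blinfun_eqI inner_ell2_eqI) simp
qed

lemma
  assumes "T \<in> operators"
  shows adjoint_op_closed: "adjoint_op T \<in> operators"
    and adjoint_op_adjoint_op: "adjoint_op (adjoint_op T) = T"
proof -
  have 1: "adjoint_op T u \<bullet> v = u \<bullet> T v" for u v
    by (metis adjoint_op[OF assms] inner_commute)
  have 2: "adjoint_op T (cmul c u) = cmul c (adjoint_op T u)" for c u
  proof (rule inner_ell2_eqI)
    fix v
    \<comment> \<open>Complex linearity passes to the adjoint: the scalar is moved, conjugated, to
      the other side and through \<open>T\<close>.\<close>
    have "v \<bullet> adjoint_op T (cmul c u) = T (cmul (cnj c) v) \<bullet> u"
      using cmul_adjoint[of "cnj c" "T v" u] by (simp add: operator_cmul[OF assms] flip: adjoint_op[OF assms])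
    then show "v \<bullet> adjoint_op T (cmul c u) = v \<bullet> cmul c (adjoint_op T u)"
      by (simp add: adjoint_op[OF assms] cmul_adjoint)
  qed
  show "adjoint_op T \<in> operators" "adjoint_op (adjoint_op T) = T"
    by (rule operatorsI[OF 1 2])+
qed

lemma
  assumes "T \<in> operators" "S \<in> operators"
  shows operators_add: "T + S \<in> operators"
    and adjoint_op_add: "adjoint_op (T + S) = adjoint_op T + adjoint_op S"
    and operators_diff: "T - S \<in> operators"
    and adjoint_op_diff: "adjoint_op (T - S) = adjoint_op T - adjoint_op S"
    and operators_compose: "T o\<^sub>L S \<in> operators"
    and adjoint_op_compose: "adjoint_op (T o\<^sub>L S) = adjoint_op S o\<^sub>L adjoint_op T"
proof -
  note simps = blinfun.bilinear_simps inner_simps adjoint_op assms operator_cmul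
  show "T + S \<in> operators" "adjoint_op (T + S) = adjoint_op T + adjoint_op S"
    by (rule operatorsI[of _ "adjoint_op T + adjoint_op S"]; simp add: simps)+
  show "T - S \<in> operators" "adjoint_op (T - S) = adjoint_op T - adjoint_op S"
    by (rule operatorsI[of _ "adjoint_op T - adjoint_op S"]; simp add: simps)+
  show "T o\<^sub>L S \<in> operators" "adjoint_op (T o\<^sub>L S) = adjoint_op S o\<^sub>L adjoint_op T"
    by (rule operatorsI[of _ "adjoint_op S o\<^sub>L adjoint_op T"]; simp add: simps)+
qed

lemma operators_zero: "0 \<in> operators"
  by (rule operatorsI(1)[of _ 0]) (auto simp: blinfun.bilinear_simps)

lemma operators_id: "id_blinfun \<in> operators"
  by (rule operatorsI(1)[of _ id_blinfun]) auto

lemma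
  shows operators_cmul: "cmul c \<in> operators"
    and adjoint_op_cmul: "adjoint_op (cmul c) = cmul (cnj c)"
  by (rule operatorsI[OF cmul_adjoint]; intro ell2_eqI; simp)+

lemma
  assumes "bounded (range d)"
  shows operators_weighted_shift: "weighted_shift d j \<in> operators"
    and adjoint_op_weighted_shift:
      "adjoint_op (weighted_shift d j) = weighted_shift (\<lambda>n. cnj (d (n + j))) (- j)"
  by (rule operatorsI[OF weighted_shift_adjoint[OF assms]]; intro ell2_eqI;
      simp add: coef_weighted_shift assms)+

lemma norm_adjoint_op_le:
  assumes "T \<in> operators"
  shows "norm (adjoint_op T) \<le> norm T"
proof (rule norm_blinfun_bound)
  fix v
  let ?v = "blinfun_apply (adjoint_op T) v"
  have "(norm ?v)\<^sup>2 = T ?v \<bullet> v"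
    by (simp add: power2_norm_eq_inner adjoint_op[OF assms])
  also have "\<dots> \<le> norm T * norm ?v * norm v"
    by (meson Cauchy_Schwarz_ineq2 abs_le_D1 mult_right_mono norm_blinfun norm_ge_zero order_trans)
  finally show "norm ?v \<le> norm T * norm v"
    by (cases "norm ?v = 0") (auto simp: power2_eq_square mult.commute mult.left_commute)
qed simp

lemma norm_adjoint_op: "T \<in> operators \<Longrightarrow> norm (adjoint_op T) = norm T"
  by (metis adjoint_op_adjoint_op adjoint_op_closed norm_adjoint_op_le order_antisym)

lemma norm_adjoint_op_compose:
  assumes "T \<in> operators"
  shows "norm (adjoint_op T o\<^sub>L T) = (norm T)\<^sup>2"
proof (rule order_antisym)
  show "norm (adjoint_op T o\<^sub>L T) \<le> (norm T)\<^sup>2"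
    using norm_blinfun_compose[of "adjoint_op T" T] by (simp add: norm_adjoint_op assms power2_eq_square)
  let ?B = "norm (adjoint_op T o\<^sub>L T)"
  have "norm T \<le> sqrt ?B"
  proof (rule norm_blinfun_bound)
    fix u
    have "(norm (T u))\<^sup>2 = u \<bullet> (adjoint_op T o\<^sub>L T) u"
      by (simp add: power2_norm_eq_inner adjoint_op[OF assms])
    also have "\<dots> \<le> norm u * (?B * norm u)"
      by (meson Cauchy_Schwarz_ineq2 abs_le_D1 mult_left_mono norm_blinfun norm_ge_zero order_trans)
    also have "\<dots> = (sqrt ?B * norm u)\<^sup>2"
      by (simp add: power_mult_distrib) (simp add: power2_eq_square)
    finally show "norm (T u) \<le> sqrt ?B * norm u"
      by (rule power2_le_imp_le) simp
  qed simp
  then show "(norm T)\<^sup>2 \<le> ?B"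
    by (metis norm_ge_zero real_le_rsqrt real_sqrt_le_iff real_sqrt_pow2_iff power_mono)
qed

text \<open>Taking adjoints is additive and isometric, so the adjoints converge as well, and their
  limit is an adjoint of the limit. This gives completeness of the operator algebra.\<close>

lemma operators_closed_sequentially:
  assumes T: "\<And>n. T n \<in> operators" and lim: "T \<longlonglongrightarrow> L"
  shows "L \<in> operators"
proof -
  have "Cauchy (\<lambda>n. adjoint_op (T n))"
  proof (rule CauchyI)
    fix e :: real assume "e > 0"
    then show "\<exists>M. \<forall>m\<ge>M. \<forall>n\<ge>M. norm (adjoint_op (T m) - adjoint_op (T n)) < e"
      using CauchyD[OF LIMSEQ_imp_Cauchy[OF lim]] T
      by (simp add: norm_adjoint_op operators_diff flip: adjoint_op_diff)
  qed
  then obtain S where S: "(\<lambda>n. adjoint_op (T n)) \<longlonglongrightarrow> S"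
    using Cauchy_convergent convergent_def by blast
  show ?thesis
  proof (rule operatorsI)
    fix u v
    have "(\<lambda>n. T n u \<bullet> v) \<longlonglongrightarrow> L u \<bullet> v" "(\<lambda>n. u \<bullet> adjoint_op (T n) v) \<longlonglongrightarrow> u \<bullet> S v"
      by (intro tendsto_intros lim S)+
    then show "L u \<bullet> v = u \<bullet> S v"
      using LIMSEQ_unique by (simp add: adjoint_op[OF T])
  next
    fix c u
    have "(\<lambda>n. T n (cmul c u)) \<longlonglongrightarrow> L (cmul c u)" "(\<lambda>n. cmul c (T n u)) \<longlonglongrightarrow> cmul c (L u)"
      by (intro tendsto_intros lim)+
    then show "L (cmul c u) = cmul c (L u)"
      using LIMSEQ_unique by (simp add: operator_cmul[OF T])
  qed
qed

section \<open>Operators determined by their matrices, and their coding as elements of a given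
  type\<close>

definition basis_ell2 :: "int \<Rightarrow> ell2" where
  "basis_ell2 j = ell2 (\<lambda>n. if n = j then 1 else 0)"

lemma coef_basis_ell2: "coef (basis_ell2 j) n = (if n = j then 1 else 0)"
proof -
  have "square_summable (\<lambda>n. if n = j then 1 else 0)"
    by (rule ell2_bound(1)[of _ 1]) (auto simp: if_distrib if_distribR sum.delta cong: if_cong)
  then show ?thesis
    by (simp add: basis_ell2_def coef_ell2)
qed

text \<open>The inner product being real, a complex coordinate is recovered only by letting the
  scalar \<open>c\<close> vary.\<close>

lemma inner_cmul_basis_ell2: "u \<bullet> cmul c (basis_ell2 j) = coef u j \<bullet> c"
proof -
  have "u \<bullet> cmul c (basis_ell2 j) = (\<Sum>\<^sub>\<infinity>n\<in>{j}. coef u n \<bullet> c)"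
    unfolding inner_ell2_def by (rule infsum_cong_neutral) (auto simp: coef_basis_ell2)
  then show ?thesis by simp
qed

lemma ell2_eqI_basis:
  assumes "\<And>c j. u \<bullet> cmul c (basis_ell2 j) = v \<bullet> cmul c (basis_ell2 j)"
  shows "u = v"
  using assms by (intro ell2_eqI) (metis inner_cmul_basis_ell2 inner_commute vector_eq_ldot)

text \<open>Pairing \<open>adjoint_op T v\<close> with multiples of basis vectors involves only the
  values of \<open>T\<close> on the basis. So the adjoints coincide, and with them the
  operators.\<close>

lemma operators_eqI:
  assumes T: "T \<in> operators" and S: "S \<in> operators"
    and eq: "\<And>j. T (basis_ell2 j) = S (basis_ell2 j)"
  shows "T = S"
proof -
  have "adjoint_op T v = adjoint_op S v" for v
    by (rule ell2_eqI_basis, subst (1 2) inner_commute)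
      (simp add: operator_cmul T S eq flip: adjoint_op[OF T] adjoint_op[OF S])
  then have "adjoint_op T = adjoint_op S"
    by (rule blinfun_eqI)
  then show ?thesis
    by (metis adjoint_op_adjoint_op T S)
qed

text \<open>Replacing each real and imaginary part by its rational lower cut turns a matrix into a
  subset of a countable set, and the sets of natural numbers embed in the reals.\<close>

lemma inj_matrix_real: "\<exists>g :: (int \<Rightarrow> int \<Rightarrow> complex) \<Rightarrow> real. inj g"
proof -
  define f :: "(int \<Rightarrow> int \<Rightarrow> complex) \<Rightarrow> (int \<times> int \<times> bool \<times> rat) set" where
    "f M = {(i, j, b, q). of_rat q < (if b then Re (M i j) else Im (M i j))}" for M
  have dense: "r = s" if "\<And>q. of_rat q < r \<longleftrightarrow> of_rat q < s" for r s :: real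
    using that by (metis linorder_neqE of_rat_dense order_less_asym order_less_irrefl)
  have f: "inj f"
  proof (rule injI, intro ext)
    fix M M' i j assume "f M = f M'"
    then have *: "(i, j, b, q) \<in> f M \<longleftrightarrow> (i, j, b, q) \<in> f M'" for b q by simp
    have "Re (M i j) = Re (M' i j)" "Im (M i j) = Im (M' i j)"
      by (rule dense, use *[of True] in \<open>simp add: f_def\<close>)
        (rule dense, use *[of False] in \<open>simp add: f_def\<close>)
    then show "M i j = M' i j" by (rule complex_eqI)
  qed
  obtain h :: "nat set \<Rightarrow> real" where h: "inj h"
    using eqpoll_imp_lepoll[OF nat_sets_eqpoll_reals] by (auto simp: lepoll_def)
  have "inj ((`) (to_nat :: int \<times> int \<times> bool \<times> rat \<Rightarrow> nat))"
    by (rule injI) (simp add: inj_image_eq_iff)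
  then show ?thesis
    using f h by (blast intro: inj_compose)
qed

text \<open>An operator is determined by its matrix, which is coded by one real number, and distinct
  real multiples of 1 are distinct elements of the target.\<close>

lemma inj_on_operators: "\<exists>\<iota> :: (ell2 \<Rightarrow>\<^sub>L ell2) \<Rightarrow> 'a::real_normed_algebra_1. inj_on \<iota> operators"
proof -
  obtain g :: "(int \<Rightarrow> int \<Rightarrow> complex) \<Rightarrow> real" where g: "inj g"
    using inj_matrix_real by blast
  have "inj_on (\<lambda>T. of_real (g (\<lambda>i j. coef (blinfun_apply T (basis_ell2 j)) i)) :: 'a) operators"
  proof (rule inj_onI)
    fix T S assume TS: "T \<in> operators" "S \<in> operators"
      and "of_real (g (\<lambda>i j. coef (blinfun_apply T (basis_ell2 j)) i)) = (of_real (g (\<lambda>i j. coef (blinfun_apply S (basis_ell2 j)) i)) :: 'a)"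
    then have "(\<lambda>i j. coef (blinfun_apply T (basis_ell2 j)) i) = (\<lambda>i j. coef (blinfun_apply S (basis_ell2 j)) i)"
      using injD[OF g] by simp
    then show "T = S"
      using TS by (intro operators_eqI ell2_eqI) (auto dest: fun_cong)
  qed
  then show ?thesis by blast
qed

text \<open>The universal property only ranges over algebras whose carrier consists of elements of
  \<open>'a\<close>, so the operators are coded as such elements by an injection \<open>\<iota>\<close>.\<close>

definition operator_alg :: "((ell2 \<Rightarrow>\<^sub>L ell2) \<Rightarrow> 'a) \<Rightarrow> 'a cstar" where
  "operator_alg \<iota> = (let \<kappa> = inv_into operators \<iota> in
     \<lparr>carrier = \<iota> ` operators, mult = (\<lambda>p q. \<iota> (\<kappa> p o\<^sub>L \<kappa> q)), one = \<iota> id_blinfun,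
      zero = \<iota> 0, add = (\<lambda>p q. \<iota> (\<kappa> p + \<kappa> q)), smult = (\<lambda>c p. \<iota> (cmul c o\<^sub>L \<kappa> p)),
      star = (\<lambda>p. \<iota> (adjoint_op (\<kappa> p))), nrm = (\<lambda>p. norm (\<kappa> p))\<rparr>)"

context
  fixes \<iota> :: "(ell2 \<Rightarrow>\<^sub>L ell2) \<Rightarrow> 'a"
  assumes inj: "inj_on \<iota> operators"
begin

lemma operator_alg_simps:
  "carrier (operator_alg \<iota>) = \<iota> ` operators"
  "one (operator_alg \<iota>) = \<iota> id_blinfun" "zero (operator_alg \<iota>) = \<iota> 0"
  "\<lbrakk>T \<in> operators; S \<in> operators\<rbrakk> \<Longrightarrow> \<iota> T \<otimes>\<^bsub>operator_alg \<iota>\<^esub> \<iota> S = \<iota> (T o\<^sub>L S)"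
  "\<lbrakk>T \<in> operators; S \<in> operators\<rbrakk> \<Longrightarrow> \<iota> T \<oplus>\<^bsub>operator_alg \<iota>\<^esub> \<iota> S = \<iota> (T + S)"
  "T \<in> operators \<Longrightarrow> c \<odot>\<^bsub>operator_alg \<iota>\<^esub> \<iota> T = \<iota> (cmul c o\<^sub>L T)"
  "T \<in> operators \<Longrightarrow> star (operator_alg \<iota>) (\<iota> T) = \<iota> (adjoint_op T)"
  "T \<in> operators \<Longrightarrow> nrm (operator_alg \<iota>) (\<iota> T) = norm T"
  by (simp_all add: operator_alg_def Let_def inv_into_f_f[OF inj])

lemma compose_assoc: "T o\<^sub>L (S o\<^sub>L R) = (T o\<^sub>L S) o\<^sub>L R"
  by (rule blinfun_eqI) simp

lemmas operators_closed = operators_add operators_diff operators_compose operators_zero operators_id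
  operators_cmul adjoint_op_closed

lemma cstar_alg_operator_alg: "cstar_alg (operator_alg \<iota>)"
proof -
  let ?B = "operator_alg \<iota>"
  note s = operator_alg_simps operators_closed
  have R: "ring ?B"
  proof (intro ringI abelian_groupI monoidI)
    fix x assume "x \<in> carrier ?B"
    then obtain T where T: "T \<in> operators" "x = \<iota> T" by (auto simp: s)
    have "\<iota> (0 - T) \<oplus>\<^bsub>?B\<^esub> x = \<zero>\<^bsub>?B\<^esub>" "\<iota> (0 - T) \<in> carrier ?B"
      unfolding T using T operators_diff[OF operators_zero T(1)] by (simp_all add: s del: diff_0)
    then show "\<exists>y\<in>carrier ?B. y \<oplus>\<^bsub>?B\<^esub> x = \<zero>\<^bsub>?B\<^esub>" by blast
  qed (auto simp: s compose_assoc add.assoc add.commute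
      blinfun.bilinear_simps intro!: arg_cong[of _ _ \<iota>] blinfun_eqI)
  then interpret R: ring ?B .
  have M: "Module.module complex_field ?B"
    by (rule moduleI[OF cring_complex_field R.abelian_group_axioms])
      (auto simp: complex_field_def s compose_assoc cmul_one simp flip: cmul_add cmul_compose
        intro!: arg_cong[of _ _ \<iota>] blinfun_eqI simp: blinfun.bilinear_simps)
  have minus: "\<iota> T \<ominus>\<^bsub>?B\<^esub> \<iota> S = \<iota> (T - S)" if "T \<in> operators" "S \<in> operators" for T S
  proof -
    have "\<ominus>\<^bsub>?B\<^esub> \<iota> S = \<iota> (0 - S)"
      using that operators_diff[OF operators_zero that(2)]
      by (intro R.minus_equality) (simp_all add: s del: diff_0)
    then show ?thesis
      using that operators_diff[OF operators_zero that(2)] by (simp add: a_minus_def s)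
  qed
  have compl: "\<exists>l\<in>carrier ?B. (\<lambda>n. nrm ?B (s n \<ominus>\<^bsub>?B\<^esub> l)) \<longlonglongrightarrow> 0"
    if ran: "range s \<subseteq> carrier ?B"
      and C: "\<forall>e>0. \<exists>N. \<forall>m\<ge>N. \<forall>n\<ge>N. nrm ?B (s m \<ominus>\<^bsub>?B\<^esub> s n) < e" for s :: "nat \<Rightarrow> 'a"
  proof -
    have "\<forall>n. \<exists>T\<in>operators. s n = \<iota> T"
      using ran by (auto simp: operator_alg_simps)
    then obtain T where T: "\<And>n. T n \<in> operators" "\<And>n. s n = \<iota> (T n)"
      by metis
    have "Cauchy T"
      using C by (intro CauchyI) (simp add: T minus operator_alg_simps operators_diff)
    then obtain L where L: "T \<longlonglongrightarrow> L"
      using Cauchy_convergent convergent_def by blast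
    then have "L \<in> operators"
      using operators_closed_sequentially T by blast
    moreover have "(\<lambda>n. norm (T n - L)) \<longlonglongrightarrow> 0"
      using L by (simp add: LIM_zero tendsto_norm_zero)
    ultimately show ?thesis
      by (intro bexI[of _ "\<iota> L"]) (simp_all add: T minus operator_alg_simps operators_diff)
  qed
  show ?thesis
    unfolding cstar_alg_def cstar_alg_axioms_def
  proof (intro conjI allI impI)
    fix a c assume "a \<in> carrier ?B"
    then obtain T where T: "T \<in> operators" "a = \<iota> T" by (auto simp: s)
    show "0 \<le> nrm ?B a" "(nrm ?B a = 0) = (a = \<zero>\<^bsub>?B\<^esub>)"
      "nrm ?B (c \<odot>\<^bsub>?B\<^esub> a) = cmod c * nrm ?B a"
      "star ?B a \<in> carrier ?B" "star ?B (star ?B a) = a"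
      "star ?B (c \<odot>\<^bsub>?B\<^esub> a) = cnj c \<odot>\<^bsub>?B\<^esub> star ?B a"
      "nrm ?B (star ?B a \<otimes>\<^bsub>?B\<^esub> a) = (nrm ?B a)\<^sup>2"
      using T inj_onD[OF inj, of T 0] operator_cmul[OF adjoint_op_closed[OF T(1)]]
      by (auto simp: s norm_cmul_compose adjoint_op_adjoint_op adjoint_op_compose adjoint_op_cmul
          norm_adjoint_op_compose intro!: arg_cong[of _ _ \<iota>] blinfun_eqI)
    fix b assume "b \<in> carrier ?B"
    then obtain S where S: "S \<in> operators" "b = \<iota> S" by (auto simp: s)
    show "(c \<odot>\<^bsub>?B\<^esub> a) \<otimes>\<^bsub>?B\<^esub> b = c \<odot>\<^bsub>?B\<^esub> (a \<otimes>\<^bsub>?B\<^esub> b)"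
      "a \<otimes>\<^bsub>?B\<^esub> (c \<odot>\<^bsub>?B\<^esub> b) = c \<odot>\<^bsub>?B\<^esub> (a \<otimes>\<^bsub>?B\<^esub> b)"
      using T S by (auto simp: s operator_cmul intro!: arg_cong[of _ _ \<iota>] blinfun_eqI)
    show "nrm ?B (a \<oplus>\<^bsub>?B\<^esub> b) \<le> nrm ?B a + nrm ?B b"
      "nrm ?B (a \<otimes>\<^bsub>?B\<^esub> b) \<le> nrm ?B a * nrm ?B b"
      "star ?B (a \<oplus>\<^bsub>?B\<^esub> b) = star ?B a \<oplus>\<^bsub>?B\<^esub> star ?B b"
      "star ?B (a \<otimes>\<^bsub>?B\<^esub> b) = star ?B b \<otimes>\<^bsub>?B\<^esub> star ?B a"
      using T S by (simp_all add: s norm_triangle_ineq norm_blinfun_compose adjoint_op_add adjoint_op_compose)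
  qed (use R M compl in auto)
qed

end

section \<open>Faithfulness of the functional calculus\<close>

text \<open>A nonzero value would persist on an arc, and the fractional parts of the multiples of
  \<theta> enter every arc.\<close>

lemma eq_zero_of_irrational_orbit:
  fixes f :: "complex \<Rightarrow> complex"
  assumes "\<theta> \<notin> \<rat>" and f: "continuous_on circle f"
    and zero: "\<And>n::int. f (cis (2 * pi * \<theta> * of_int n)) = 0" and "z \<in> circle"
  shows "f z = 0"
proof (rule ccontr)
  assume nz: "f z \<noteq> 0"
  obtain t where t: "z = cis (2 * pi * t)"
  proof
    show "z = cis (2 * pi * (Arg z / (2 * pi)))"
      using cis_Arg[of z] \<open>z \<in> circle\<close> by (cases "z = 0") (auto simp: sgn_eq)
  qed
  define g where "g t = f (cis (2 * pi * t))" for t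
  have "continuous_on UNIV g"
    unfolding g_def by (intro continuous_on_compose2[OF f] continuous_intros) auto
  then have "isCont g t"
    by (simp add: continuous_on_eq_continuous_at)
  then obtain e where "e > 0" and e: "\<And>s. dist t s < e \<Longrightarrow> g s \<noteq> 0"
    using continuous_at_avoid[of t g 0] nz by (auto simp: g_def t)
  obtain h k :: int where "\<bar>of_int k * \<theta> - of_int h - t\<bar> < e"
    using sequence_of_fractional_parts_is_dense[OF \<open>\<theta> \<notin> \<rat>\<close> \<open>e > 0\<close>] by metis
  then have "g (of_int k * \<theta> - of_int h) \<noteq> 0"
    by (intro e) (simp add: dist_real_def abs_minus_commute)
  moreover have "cis (2 * pi * (of_int k * \<theta> - of_int h)) = cis (2 * pi * \<theta> * of_int k)"
  proof -
    have "cis (2 * pi * (of_int k * \<theta> - of_int h)) = cis (2 * pi * \<theta> * of_int k) / cis (2 * pi * of_int h)"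
      by (simp add: cis_divide algebra_simps)
    then show ?thesis
      by (simp add: cis_multiple_2pi)
  qed
  ultimately show False
    by (simp add: g_def zero)
qed

text \<open>\<open>w\<close> acts on \<open>\<ell>\<^sup>2(\<int>)\<close> as multiplication by the orbit \<open>\<nu>\<close> of \<open>1\<close> and \<open>x\<close> as the bilateral
  shift weighted by \<open>sqrt (\<gamma> (\<nu> n))\<close>.\<close>

lemma regular_representation:
  fixes \<iota> :: "(ell2 \<Rightarrow>\<^sub>L ell2) \<Rightarrow> 'a" and \<theta> :: real
  assumes inj: "inj_on \<iota> operators"
    and \<gamma>: "continuous_on circle \<gamma>" "\<And>z. z \<in> circle \<Longrightarrow> 0 \<le> \<gamma> z"
  defines "\<nu> \<equiv> \<lambda>n. cis (2 * pi * \<theta> * of_int n)"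
  defines "\<Psi> \<equiv> \<lambda>f. \<iota> (weighted_shift (\<lambda>n. f (\<nu> n)) 0)"
  obtains x where "star_hom circle_alg (operator_alg \<iota>) \<Psi>"
    "rotation_rels \<theta> \<gamma> (operator_alg \<iota>) x (\<Psi> (restrict (\<lambda>z. z) circle))"
proof -
  let ?B = "operator_alg \<iota>"
  interpret B: cstar_alg ?B
    by (rule cstar_alg_operator_alg[OF inj])
  note s = operator_alg_simps[OF inj]
  have \<nu>: "\<nu> n \<in> circle" for n
    by (simp add: \<nu>_def)
  have bd: "bounded (range (\<lambda>n. f (\<nu> (h n))))" if "continuous_on circle f" for f h
    using compact_imp_bounded[OF compact_continuous_image[OF that compact_sphere]]
    by (rule bounded_subset) (use \<nu> in auto)
  define D where "D f = weighted_shift (\<lambda>n. f (\<nu> n)) 0" for f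
  have D: "D f \<in> operators" "bounded (range (\<lambda>n. f (\<nu> n)))" if "f \<in> carrier circle_alg" for f
    using circle_alg_carrierE(1)[OF that] unfolding D_def by (auto intro!: operators_weighted_shift bd)
  have \<Psi>: "\<Psi> f = \<iota> (D f)" for f
    by (simp add: \<Psi>_def D_def)
  have \<nu>1: "cmod (\<nu> n) = 1" for n
    by (simp add: \<nu>_def)
  have H: "star_hom circle_alg ?B \<Psi>"
    unfolding star_hom_def
  proof (intro conjI ring_hom_memI ballI allI)
    fix f g assume f: "f \<in> carrier circle_alg" and g: "g \<in> carrier circle_alg"
    show "\<Psi> f \<in> carrier ?B"
      by (simp add: \<Psi> s D f)
    show "\<Psi> (f \<otimes>\<^bsub>circle_alg\<^esub> g) = \<Psi> f \<otimes>\<^bsub>?B\<^esub> \<Psi> g"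
      using D[OF f] D[OF g] by (simp add: \<Psi> s circle_alg_simps) (simp add: D_def weighted_shift_compose \<nu>1)
    show "\<Psi> (f \<oplus>\<^bsub>circle_alg\<^esub> g) = \<Psi> f \<oplus>\<^bsub>?B\<^esub> \<Psi> g"
      using D[OF f] D[OF g] by (simp add: \<Psi> s circle_alg_simps) (simp add: D_def weighted_shift_add \<nu>1)
  next
    fix c f assume f: "f \<in> carrier circle_alg"
    have "weighted_shift (\<lambda>n. c * f (\<nu> n)) 0 = cmul c o\<^sub>L weighted_shift (\<lambda>n. f (\<nu> n)) 0"
      unfolding cmul_def using D[OF f] by (subst weighted_shift_compose) (auto simp: image_constant_conv)
    then show "\<Psi> (c \<odot>\<^bsub>circle_alg\<^esub> f) = c \<odot>\<^bsub>?B\<^esub> \<Psi> f"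
      using D[OF f] by (simp add: \<Psi> s circle_alg_simps) (simp add: D_def \<nu>1)
  next
    fix f assume f: "f \<in> carrier circle_alg"
    show "\<Psi> (star circle_alg f) = star ?B (\<Psi> f)"
      using D[OF f] by (simp add: \<Psi> s circle_alg_simps) (simp add: D_def adjoint_op_weighted_shift \<nu>1)
  qed (simp add: \<Psi> s circle_alg_simps D_def weighted_shift_one \<nu>1)
  \<comment> \<open>The weight at \<open>n\<close> belongs to the step from \<open>n - 1\<close> to
    \<open>n\<close>, hence the index \<open>n - 1\<close>. The adjoint times the shift then has
    diagonal \<open>\<gamma> (\<nu> n)\<close>, and the shift times the adjoint has
    \<open>\<gamma> (\<nu> (n - 1))\<close>, as the relations demand.\<close>
  define d where "d n = complex_of_real (sqrt (\<gamma> (\<nu> (n - 1))))" for n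
  have d: "bounded (range d)"
    unfolding d_def by (rule bd) (intro continuous_intros \<gamma>)
  let ?X = "weighted_shift d 1" and ?id = "restrict (\<lambda>z. z) circle"
  have X: "?X \<in> operators"
    by (rule operators_weighted_shift[OF d])
  have star_X: "adjoint_op ?X = weighted_shift (\<lambda>n. cnj (d (n + 1))) (- 1)"
    by (rule adjoint_op_weighted_shift[OF d])
  have id: "?id \<in> carrier circle_alg"
    by (intro restrict_mem_circle_alg continuous_intros)
  have cfc: "cfc ?B (\<Psi> ?id) f = \<iota> (D f)" if "continuous_on circle f" for f
    using B.cfc_eqI[OF H refl that] by (simp add: \<Psi> D_def \<nu>1)
  have rels: "rotation_rels \<theta> \<gamma> ?B (\<iota> ?X) (\<Psi> ?id)"
    unfolding rotation_rels_def
  proof (intro conjI)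
    show "\<iota> ?X \<in> carrier ?B"
      by (simp add: s X)
    have "\<Psi> (restrict (\<lambda>z. cnj z * z) circle) = \<Psi> (restrict (\<lambda>z. 1) circle)"
      by (intro arg_cong[of _ _ \<Psi>] restrict_cong_circle) (simp add: complex_norm_square[symmetric] mult.commute)
    then have "star ?B (\<Psi> ?id) \<otimes>\<^bsub>?B\<^esub> \<Psi> ?id = \<one>\<^bsub>?B\<^esub>"
      using circle_hom_mult[OF H, of cnj "\<lambda>z. z"] circle_hom_star[OF H, of "\<lambda>z. z"] circle_hom_one[OF H]
      by (simp add: continuous_intros)
    moreover have "\<Psi> (restrict (\<lambda>z. z * cnj z) circle) = \<Psi> (restrict (\<lambda>z. 1) circle)"
      by (intro arg_cong[of _ _ \<Psi>] restrict_cong_circle) (simp add: complex_norm_square[symmetric])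
    then have "\<Psi> ?id \<otimes>\<^bsub>?B\<^esub> star ?B (\<Psi> ?id) = \<one>\<^bsub>?B\<^esub>"
      using circle_hom_mult[OF H, of "\<lambda>z. z" cnj] circle_hom_star[OF H, of "\<lambda>z. z"] circle_hom_one[OF H]
      by (simp add: continuous_intros)
    ultimately show "unitary_in ?B (\<Psi> ?id)"
      using circle_hom_closed[OF H, of "\<lambda>z. z"] by (simp add: unitary_in_def continuous_intros)
    have sq: "d n * cnj (d n) = \<gamma> (\<nu> (n - 1))" "cnj (d n) * d n = \<gamma> (\<nu> (n - 1))" for n
      using \<gamma>(2)[OF \<nu>, of "n - 1"] by (simp_all add: d_def flip: of_real_mult)
    have "adjoint_op ?X o\<^sub>L ?X = D (\<lambda>z. \<gamma> z)"
      unfolding star_X D_def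
      by (subst weighted_shift_compose[OF bounded_range_cnj[OF d] d]) (simp add: sq)
    then show "star ?B (\<iota> ?X) \<otimes>\<^bsub>?B\<^esub> \<iota> ?X = cfc ?B (\<Psi> ?id) (\<lambda>z. complex_of_real (\<gamma> z))"
      by (subst cfc) (auto intro!: continuous_intros \<gamma> simp: s X adjoint_op_closed)
    have \<nu>_pred: "cis (- (2 * pi * \<theta>)) * \<nu> n = \<nu> (n - 1)" for n
      by (simp add: \<nu>_def cis_mult algebra_simps)
    have "?X o\<^sub>L adjoint_op ?X = D (\<lambda>z. \<gamma> (cis (- 2 * pi * \<theta>) * z))"
      unfolding star_X D_def
      by (subst weighted_shift_compose[OF d bounded_range_cnj[OF d]]) (simp add: sq \<nu>_pred)
    then show "\<iota> ?X \<otimes>\<^bsub>?B\<^esub> star ?B (\<iota> ?X) =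
        cfc ?B (\<Psi> ?id) (\<lambda>z. complex_of_real (\<gamma> (cis (- 2 * pi * \<theta>) * z)))"
      by (subst cfc) (auto intro!: continuous_intros continuous_on_compose2[OF \<gamma>(1)]
          simp: s X adjoint_op_closed norm_mult)
    have "?X o\<^sub>L D ?id = cmul (cis (- 2 * pi * \<theta>)) o\<^sub>L (D ?id o\<^sub>L ?X)"
    proof -
      have b: "bounded (range \<nu>)"
        using bd[of "\<lambda>z. z" "\<lambda>n. n"] by (simp add: continuous_intros)
      have "D ?id = weighted_shift \<nu> 0"
        by (simp add: D_def \<nu>1)
      then show ?thesis
        using d b by (intro blinfun_eqI ell2_eqI)
          (simp add: coef_weighted_shift flip: \<nu>_pred)
    qed
    then show "\<iota> ?X \<otimes>\<^bsub>?B\<^esub> \<Psi> ?id = cis (- 2 * pi * \<theta>) \<odot>\<^bsub>?B\<^esub> (\<Psi> ?id \<otimes>\<^bsub>?B\<^esub> \<iota> ?X)"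
      using D[OF id] X by (simp add: \<Psi> s operators_compose)
  qed
  show ?thesis
    by (rule that[OF H rels])
qed

text \<open>The homomorphism \<open>\<phi>\<close> supplied by the universal property, composed with
  \<open>\<Psi>\<close>, must be the explicit multiplication representation, by uniqueness. So
  \<open>f\<close> vanishes along the orbit as soon as its image is 0.\<close>

lemma universal_rotation_alg_faithful:
  fixes x w :: "'a::cstar_algebra"
  assumes "\<theta> \<notin> \<rat>" and \<gamma>: "continuous_on circle \<gamma>" "\<forall>z\<in>circle. 0 \<le> \<gamma> z"
    and univ: "universal_rotation_alg \<theta> \<gamma> x w"
    and H: "star_hom circle_alg type_alg \<Psi>" and w: "\<Psi> (restrict (\<lambda>z. z) circle) = w"
    and f: "continuous_on circle f" and eq0: "\<Psi> (restrict f circle) = 0" and "z \<in> circle"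
  shows "f z = 0"
proof -
  obtain \<iota> :: "(ell2 \<Rightarrow>\<^sub>L ell2) \<Rightarrow> 'a" where inj: "inj_on \<iota> operators"
    using inj_on_operators by blast
  let ?B = "operator_alg \<iota>"
  let ?\<nu> = "\<lambda>n. cis (2 * pi * \<theta> * of_int n)"
  let ?\<Psi> = "\<lambda>f. \<iota> (weighted_shift (\<lambda>n. f (?\<nu> n)) 0)"
  obtain x' where H': "star_hom circle_alg ?B ?\<Psi>"
    and rels: "rotation_rels \<theta> \<gamma> ?B x' (?\<Psi> (restrict (\<lambda>z. z) circle))"
    using regular_representation[OF inj \<gamma>(1), of \<theta>] \<gamma>(2) by blast
  interpret B: cstar_alg ?B
    by (rule cstar_alg_operator_alg[OF inj])
  obtain \<phi> where \<phi>: "star_hom type_alg ?B \<phi>" "\<phi> w = ?\<Psi> (restrict (\<lambda>z. z) circle)"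
    using univ rels B.cstar_alg_axioms unfolding universal_rotation_alg_def by metis
  have eq: "\<phi> (\<Psi> (restrict g circle)) = ?\<Psi> (restrict g circle)" if "continuous_on circle g" for g
    using B.circle_hom_unique[OF star_hom_comp[OF H \<phi>(1)] H' _ that] \<phi>(2) w by simp
  have "\<Psi> (restrict (\<lambda>z. 0) circle) = 0"
    using circle_hom_const[OF H, of 0] by simp
  then have "?\<Psi> (restrict f circle) = ?\<Psi> (restrict (\<lambda>z. 0) circle)"
    using eq[OF f] eq[of "\<lambda>z. 0"] eq0 by simp
  then have *: "\<iota> (weighted_shift (\<lambda>n. f (?\<nu> n)) 0) = \<iota> (weighted_shift (\<lambda>n. 0) 0)"
    by simp
  have b: "bounded (range (\<lambda>n. f (?\<nu> n)))"
    using compact_imp_bounded[OF compact_continuous_image[OF f compact_sphere]]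
    by (rule bounded_subset) auto
  have b0: "bounded (range (\<lambda>n::int. 0::complex))"
    by simp
  have "weighted_shift (\<lambda>n. f (?\<nu> n)) 0 = weighted_shift (\<lambda>n. 0) 0"
    by (rule inj_onD[OF inj *]) (intro operators_weighted_shift b b0)+
  then have "coef (weighted_shift (\<lambda>n. f (?\<nu> n)) 0 (basis_ell2 n)) n = coef (weighted_shift (\<lambda>n. 0) 0 (basis_ell2 n)) n" for n
    by simp
  then have "f (?\<nu> n) = 0" for n
    using b by (simp add: coef_weighted_shift coef_basis_ell2)
  then show ?thesis
    by (rule eq_zero_of_irrational_orbit[OF \<open>\<theta> \<notin> \<rat>\<close> f _ \<open>z \<in> circle\<close>])
qed

section \<open>Powers-Rieffel projections\<close>

text \<open>Fixing \<open>\<Psi>\<close> gives the functional calculus as an actual map, to which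
  the definite descriptions in the relations and in the trace can be reduced.\<close>

locale rotation_alg =
  fixes \<theta> :: real and \<gamma> :: "complex \<Rightarrow> real" and x w :: "'a::cstar_algebra"
    and \<Psi> :: "(complex \<Rightarrow> complex) \<Rightarrow> 'a"
  assumes \<theta>: "\<theta> \<notin> \<rat>" and \<gamma>: "continuous_on circle \<gamma>" "\<forall>z\<in>circle. 0 \<le> \<gamma> z"
    and univ: "universal_rotation_alg \<theta> \<gamma> x w"
    and H: "star_hom circle_alg type_alg \<Psi>" and \<Psi>_id: "\<Psi> (restrict (\<lambda>z. z) circle) = w"
begin

interpretation A: cstar_alg "type_alg :: 'a cstar"
  by (rule cstar_alg_type_alg)

definition F :: "(complex \<Rightarrow> complex) \<Rightarrow> 'a" where
  "F f = \<Psi> (restrict f circle)"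

lemma F_cong: "(\<And>z. z \<in> circle \<Longrightarrow> f z = g z) \<Longrightarrow> F f = F g"
  unfolding F_def by (intro arg_cong[of _ _ \<Psi>] restrict_cong_circle)

lemma
  shows F_add: "\<lbrakk>continuous_on circle f; continuous_on circle g\<rbrakk> \<Longrightarrow> F (\<lambda>z. f z + g z) = F f + F g"
    and F_diff: "\<lbrakk>continuous_on circle f; continuous_on circle g\<rbrakk> \<Longrightarrow> F (\<lambda>z. f z - g z) = F f - F g"
    and F_mult: "\<lbrakk>continuous_on circle f; continuous_on circle g\<rbrakk> \<Longrightarrow> F (\<lambda>z. f z * g z) = F f * F g"
    and F_adj: "continuous_on circle f \<Longrightarrow> F (\<lambda>z. cnj (f z)) = adj (F f)"
    and F_const: "F (\<lambda>z. c) = c *\<^sub>C 1"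
    and F_id: "F (\<lambda>z. z) = w"
    and F_norm_le: "\<lbrakk>continuous_on circle f; \<And>z. z \<in> circle \<Longrightarrow> cmod (f z) \<le> M; M > 0\<rbrakk> \<Longrightarrow> norm (F f) \<le> M"
proof -
  show add: "F (\<lambda>z. f z + g z) = F f + F g" if "continuous_on circle f" "continuous_on circle g" for f g
    using circle_hom_add[OF H that] by (simp add: F_def)
  show "F (\<lambda>z. f z - g z) = F f - F g" if "continuous_on circle f" "continuous_on circle g" for f g
    using add[of "\<lambda>z. f z - g z" g] that by (simp add: continuous_intros)
qed (use A.circle_hom_le[OF H] circle_hom_mult[OF H] circle_hom_star[OF H] circle_hom_const[OF H] \<Psi>_id
    in \<open>simp_all add: F_def\<close>)

lemma F_real_adj: "continuous_on circle a \<Longrightarrow> adj (F (\<lambda>z. complex_of_real (a z))) = F (\<lambda>z. complex_of_real (a z))"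
  using F_adj[of "\<lambda>z. complex_of_real (a z)"] by (simp add: continuous_intros)

lemma cfc_eq_F: "continuous_on circle f \<Longrightarrow> cfc type_alg w f = F f"
  unfolding F_def by (rule A.cfc_eqI[OF H \<Psi>_id])

lemma F_eq_0D: "\<lbrakk>F f = 0; continuous_on circle f; z \<in> circle\<rbrakk> \<Longrightarrow> f z = 0"
  unfolding F_def using universal_rotation_alg_faithful[OF \<theta> \<gamma> univ H \<Psi>_id] by blast

text \<open>The sign is that of the commutation rule: moving \<open>x\<close> to the right past
  \<open>F f\<close> replaces \<open>f\<close> by its composition with \<open>rot 1\<close>.\<close>

definition rot :: "real \<Rightarrow> complex \<Rightarrow> complex" where
  "rot t z = cis (- 2 * pi * t * \<theta>) * z"

lemma rot_circle: "z \<in> circle \<Longrightarrow> rot t z \<in> circle"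
  by (simp add: rot_def norm_mult)

lemma rot_rot: "rot s (rot t z) = rot (s + t) z"
  unfolding rot_def mult.assoc[symmetric] cis_mult by (simp add: algebra_simps)

lemma rot_0 [simp]: "rot 0 z = z"
  by (simp add: rot_def)

lemma continuous_on_rot:
  fixes f :: "complex \<Rightarrow> 'b::topological_space"
  shows "continuous_on circle f \<Longrightarrow> continuous_on circle (\<lambda>z. f (rot t z))"
  by (rule continuous_on_compose2[where t = circle])
    (auto simp: rot_circle[unfolded mem_sphere_0] rot_def norm_mult intro!: continuous_intros)

lemma
  shows x_adj_x: "adj x * x = F (\<lambda>z. of_real (\<gamma> z))"
    and x_x_adj: "x * adj x = F (\<lambda>z. of_real (\<gamma> (rot 1 z)))"
    and x_w: "x * w = cis (- 2 * pi * \<theta>) *\<^sub>C (w * x)"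
    and w_unitary: "adj w * w = 1" "w * adj w = 1"
proof -
  have r: "rotation_rels \<theta> \<gamma> type_alg x w"
    using univ by (simp add: universal_rotation_alg_def)
  show "x * w = cis (- 2 * pi * \<theta>) *\<^sub>C (w * x)" "adj w * w = 1" "w * adj w = 1"
    using r by (auto simp: rotation_rels_def unitary_in_def)
  show "adj x * x = F (\<lambda>z. of_real (\<gamma> z))"
    using r by (simp add: rotation_rels_def cfc_eq_F continuous_intros \<gamma>)
  have "continuous_on circle (\<lambda>z. complex_of_real (\<gamma> (rot 1 z)))"
    by (intro continuous_intros continuous_on_rot \<gamma>)
  then show "x * adj x = F (\<lambda>z. of_real (\<gamma> (rot 1 z)))"
    using r cfc_eq_F by (simp add: rotation_rels_def rot_def)
qed

text \<open>The rule holds for \<open>w\<close> by the defining relation and for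
  \<open>adj w\<close> as a consequence, and it passes to sums, products and uniform limits.\<close>

lemma x_F:
  assumes "continuous_on circle f"
  shows "x * F f = F (\<lambda>z. f (rot 1 z)) * x"
proof (rule circle_induct[where P = "\<lambda>f. x * F f = F (\<lambda>z. f (rot 1 z)) * x", OF assms])
  show "x * F (\<lambda>z. c) = F (\<lambda>z. c) * x" for c
    by (simp add: F_const mult_scaleC_left mult_scaleC_right)
  let ?c = "cis (- 2 * pi * \<theta>)"
  have "F (\<lambda>z. rot 1 z) = ?c *\<^sub>C w"
    using F_mult[of "\<lambda>z. ?c" "\<lambda>z. z"]
    by (simp add: rot_def continuous_intros F_const F_id mult_scaleC_left)
  then show "x * F (\<lambda>z. z) = F (\<lambda>z. rot 1 z) * x"
    by (simp add: F_id x_w mult_scaleC_left)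
  have "F (\<lambda>z. cnj (rot 1 z)) = cnj ?c *\<^sub>C adj w"
    using F_mult[of "\<lambda>z. cnj ?c" cnj] F_adj[of "\<lambda>z. z"]
    by (simp add: rot_def continuous_intros F_const F_id mult_scaleC_left)
  \<comment> \<open>The relation for \<open>w\<close>, multiplied by \<open>adj w\<close> on both
    sides.\<close>
  moreover have "adj w * x = ?c *\<^sub>C (x * adj w)"
  proof -
    have "adj w * x = adj w * (x * w) * adj w"
      by (simp add: mult.assoc w_unitary)
    also have "\<dots> = ?c *\<^sub>C ((adj w * w) * x * adj w)"
      by (simp add: x_w mult_scaleC_left mult_scaleC_right mult.assoc)
    finally show ?thesis by (simp add: w_unitary)
  qed
  ultimately show "x * F cnj = F (\<lambda>z. cnj (rot 1 z)) * x"
    using F_adj[of "\<lambda>z. z"]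
    by (simp add: F_id continuous_intros mult_scaleC_left scaleC_scaleC cis_cnj cis_mult)
next
  fix f g :: "complex \<Rightarrow> complex"
  assume *: "continuous_on circle f" "continuous_on circle g" "x * F f = F (\<lambda>z. f (rot 1 z)) * x"
    "x * F g = F (\<lambda>z. g (rot 1 z)) * x"
  show "x * F (\<lambda>z. f z + g z) = F (\<lambda>z. f (rot 1 z) + g (rot 1 z)) * x"
    using * by (simp add: F_add continuous_on_rot distrib_left distrib_right)
  show "x * F (\<lambda>z. f z * g z) = F (\<lambda>z. f (rot 1 z) * g (rot 1 z)) * x"
    using * by (simp add: F_mult continuous_on_rot) (metis mult.assoc)
next
  fix f :: "complex \<Rightarrow> complex"
  assume f: "continuous_on circle f"
    and lim: "\<And>e::real. e > 0 \<Longrightarrow> \<exists>g. continuous_on circle g \<and>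
      x * F g = F (\<lambda>z. g (rot 1 z)) * x \<and> (\<forall>z\<in>circle. cmod (f z - g z) < e)"
  have "norm (x * F f - F (\<lambda>z. f (rot 1 z)) * x) \<le> 0 + e" if "e > 0" for e
  proof -
    \<comment> \<open>Two errors of size \<open>norm x * d\<close> will occur; the summand 1 keeps
      the denominator positive even for \<open>x = 0\<close>.\<close>
    define d where "d = e / (2 * norm x + 1)"
    have d: "d > 0" "2 * norm x * d \<le> e"
      using that norm_ge_zero[of x] by (auto simp: d_def field_simps add_pos_nonneg simp del: norm_ge_zero)
    obtain g where g: "continuous_on circle g" "x * F g = F (\<lambda>z. g (rot 1 z)) * x"
      "\<And>z. z \<in> circle \<Longrightarrow> cmod (f z - g z) < d"
      using lim[OF d(1)] by metis
    have 1: "norm (F f - F g) \<le> d"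
      using F_norm_le[of "\<lambda>z. f z - g z" d] g(1) g(3)[THEN less_imp_le] f d(1)
      by (simp add: F_diff continuous_intros)
    have 2: "norm (F (\<lambda>z. f (rot 1 z)) - F (\<lambda>z. g (rot 1 z))) \<le> d"
      using F_norm_le[of "\<lambda>z. f (rot 1 z) - g (rot 1 z)" d] g(1) g(3)[OF rot_circle, THEN less_imp_le] f d(1)
      by (simp add: F_diff continuous_on_rot continuous_intros)
    have "x * F f - F (\<lambda>z. f (rot 1 z)) * x =
        x * (F f - F g) - (F (\<lambda>z. f (rot 1 z)) - F (\<lambda>z. g (rot 1 z))) * x"
      by (simp add: algebra_simps g(2))
    also have "norm \<dots> \<le> norm x * d + d * norm x"
      by (intro norm_triangle_le_diff add_mono order_trans[OF norm_mult_ineq] mult_mono 1 2) (use d in auto)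
    also have "\<dots> \<le> e"
      using d(2) by (simp add: mult_ac)
    finally show ?thesis by simp
  qed
  then have "norm (x * F f - F (\<lambda>z. f (rot 1 z)) * x) \<le> 0"
    by (rule field_le_epsilon)
  then show "x * F f = F (\<lambda>z. f (rot 1 z)) * x"
    by simp
qed

lemma x_power_F:
  assumes "continuous_on circle f"
  shows "x ^ k * F f = F (\<lambda>z. f (rot (real k) z)) * x ^ k"
  using assms
proof (induction k arbitrary: f)
  case (Suc k)
  have "x ^ Suc k * F f = x * (F (\<lambda>z. f (rot k z)) * x ^ k)"
    by (simp add: mult.assoc Suc)
  also have "\<dots> = F (\<lambda>z. f (rot k (rot 1 z))) * x * x ^ k"
    using x_F[OF continuous_on_rot[OF Suc.prems, of k]] by (simp flip: mult.assoc)
  finally show ?case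
    by (simp add: rot_rot mult.assoc add.commute)
qed simp

text \<open>This is \<open>G\<close> of the overview. Negative arguments of \<open>rot\<close>
  rotate forwards, so the factors are the values of \<gamma> along a forward orbit.\<close>

definition weight :: "nat \<Rightarrow> complex \<Rightarrow> real" where
  "weight k z = (\<Prod>j<k. \<gamma> (rot (- real j) z))"

lemma continuous_on_weight: "continuous_on circle (weight k)"
  unfolding weight_def
  by (intro continuous_on_prod continuous_on_compose2[OF \<gamma>(1)])
    (auto simp: rot_def norm_mult intro!: continuous_intros)

lemma weight_nonneg: "z \<in> circle \<Longrightarrow> 0 \<le> weight k z"
  unfolding weight_def using \<gamma>(2) rot_circle by (intro prod_nonneg) auto

lemma continuous_on_rot_real:
  "continuous_on circle a \<Longrightarrow> continuous_on circle (\<lambda>z. complex_of_real (a (rot t z)))"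
  by (intro continuous_intros continuous_on_rot)

lemma adj_x_power_x_power: "adj (x ^ k) * x ^ k = F (\<lambda>z. of_real (weight k z))"
proof (induction k)
  case 0
  then show ?case by (simp add: weight_def F_const)
next
  case (Suc k)
  have "adj (x ^ Suc k) * x ^ Suc k = adj x * (adj (x ^ k) * x ^ k) * x"
    by (simp only: power_Suc2 adj_mult mult.assoc)
  \<comment> \<open>The inserted \<open>rot (- 1) (rot 1 z)\<close> lets \<open>x_F\<close>, read
    from right to left, move the function to the right of \<open>x\<close>, so that
    \<open>adj x * x\<close> appears.\<close>
  also have "\<dots> = adj x * (F (\<lambda>z. of_real (weight k (rot (- 1) (rot 1 z)))) * x)"
    by (simp add: Suc rot_rot mult.assoc)
  also have "\<dots> = adj x * x * F (\<lambda>z. of_real (weight k (rot (- 1) z)))"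
    using x_F[OF continuous_on_rot_real[OF continuous_on_weight], of k "- 1"] by (simp add: mult.assoc)
  also have "\<dots> = F (\<lambda>z. of_real (\<gamma> z) * of_real (weight k (rot (- 1) z)))"
    unfolding x_adj_x by (intro F_mult[symmetric] continuous_intros continuous_on_rot_real continuous_on_weight \<gamma>)
  also have "(\<lambda>z. complex_of_real (\<gamma> z) * of_real (weight k (rot (- 1) z))) = (\<lambda>z. of_real (weight (Suc k) z))"
    by (simp add: weight_def prod.lessThan_Suc_shift rot_rot minus_diff_commute[of _ 1] del: prod.lessThan_Suc)
  finally show ?case .
qed

lemma x_power_adj_x_power: "x ^ k * adj (x ^ k) = F (\<lambda>z. of_real (weight k (rot (real k) z)))"
proof (induction k)
  case 0
  then show ?case by (simp add: weight_def F_const)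
next
  case (Suc k)
  have "x ^ Suc k * adj (x ^ Suc k) = x * (x ^ k * adj (x ^ k)) * adj x"
    by (simp add: adj_mult mult.assoc)
  also have "\<dots> = F (\<lambda>z. of_real (weight k (rot (real k) (rot 1 z)))) * x * adj x"
    using x_F[OF continuous_on_rot_real[OF continuous_on_weight], of k "real k"] by (simp add: Suc)
  also have "\<dots> = F (\<lambda>z. of_real (weight k (rot (real (Suc k)) z))) * F (\<lambda>z. of_real (\<gamma> (rot 1 z)))"
    by (simp add: rot_rot mult.assoc x_x_adj add.commute)
  also have "\<dots> = F (\<lambda>z. of_real (weight k (rot (real (Suc k)) z)) * of_real (\<gamma> (rot 1 z)))"
    by (intro F_mult[symmetric] continuous_intros continuous_on_rot_real continuous_on_weight \<gamma>)
  also have "(\<lambda>z. complex_of_real (weight k (rot (real (Suc k)) z)) * of_real (\<gamma> (rot 1 z))) =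
      (\<lambda>z. of_real (weight (Suc k) (rot (real (Suc k)) z)))"
    by (simp add: weight_def rot_rot)
  finally show ?case .
qed

text \<open>Sort the square of \<open>A + s + adj s\<close> by degree in \<open>x\<close>: the part
  of degree \<open>2 * k\<close> must vanish, that of degree \<open>k\<close> must be
  \<open>s\<close>, that of degree 0 must be \<open>A\<close>. The three pointwise conditions say
  this, and adjoints give the negative degrees.\<close>

lemma powers_rieffel_projection:
  assumes a: "continuous_on circle a" and b: "continuous_on circle b"
    and 1: "\<And>z. z \<in> circle \<Longrightarrow> b z * b (rot k z) = 0"
    and 2: "\<And>z. z \<in> circle \<Longrightarrow> b (rot k z) * (a z + a (rot k z)) = b (rot k z)"
    and 3: "\<And>z. z \<in> circle \<Longrightarrow>
      (a z)\<^sup>2 + (b z)\<^sup>2 * weight k z + (b (rot k z))\<^sup>2 * weight k (rot k z) = a z"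
  defines "s \<equiv> x ^ k * F (\<lambda>z. complex_of_real (b z))"
  shows "projection (F (\<lambda>z. complex_of_real (a z)) + (s + adj s))"
proof -
  define A B C y where "A = F (\<lambda>z. complex_of_real (a z))" and "B = F (\<lambda>z. complex_of_real (b z))"
    and "C = F (\<lambda>z. complex_of_real (b (rot k z)))" and "y = x ^ k"
  have c: "continuous_on circle (\<lambda>z. complex_of_real (a z))" "continuous_on circle (\<lambda>z. complex_of_real (b z))"
    "continuous_on circle (\<lambda>z. complex_of_real (weight k z))"
    by (intro continuous_intros a b continuous_on_weight)+
  note c' = a b continuous_on_weight continuous_on_rot[OF a] continuous_on_rot[OF b]
    continuous_on_rot[OF continuous_on_weight]
  note cr = continuous_on_rot_real[OF a] continuous_on_rot_real[OF b] continuous_on_rot_real[OF continuous_on_weight]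
  have adj [simp]: "adj A = A" "adj B = B" "adj C = C"
    unfolding A_def B_def C_def using F_real_adj[OF a] F_real_adj[OF b] F_adj[OF cr(2), of k] by auto
  \<comment> \<open>Both forms are kept because each product of \<open>s\<close> and
    \<open>adj s\<close> calls for the one that brings functions, or powers of \<open>x\<close> and
    their adjoints, next to each other.\<close>
  have s: "s = y * B" "s = C * y"
    using x_power_F[OF c(2), of k] by (simp_all add: s_def y_def B_def C_def)
  have ss: "s * s = 0"
  proof -
    have "B * C = F (\<lambda>z. of_real (b z) * of_real (b (rot k z)))"
      unfolding B_def C_def by (intro F_mult[symmetric] c cr)
    also have "\<dots> = F (\<lambda>z. 0)"
      by (rule F_cong) (use 1 in \<open>simp flip: of_real_mult\<close>)
    finally have "B * C = 0" by (simp add: F_const)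
    then have "y * (B * C) * y = 0" by simp
    then show ?thesis
      using s by (metis mult.assoc)
  qed
  then have ss': "adj s * adj s = 0"
    using adj_mult[of s s] adj_diff[of 0 "0::'a"] by simp
  have As: "A * s + s * A = s"
  proof -
    have yA: "y * A = F (\<lambda>z. of_real (a (rot k z))) * y"
      using x_power_F[OF c(1), of k] by (simp add: y_def A_def)
    have "C * (A + F (\<lambda>z. of_real (a (rot k z)))) = F (\<lambda>z. of_real (b (rot k z)) * (of_real (a z) + of_real (a (rot k z))))"
      unfolding A_def C_def by (simp add: F_mult F_add c cr continuous_on_add c')
    also have "\<dots> = C"
      unfolding C_def by (rule F_cong) (use 2 in \<open>simp flip: of_real_mult of_real_add\<close>)
    finally have CA: "C * (A + F (\<lambda>z. of_real (a (rot k z)))) = C" .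
    have AC: "A * C = C * A"
    proof -
      have "A * C = F (\<lambda>z. of_real (a z) * of_real (b (rot k z)))"
        unfolding A_def C_def by (intro F_mult[symmetric] c cr)
      also have "\<dots> = C * A"
        unfolding A_def C_def by (subst F_mult[symmetric]) (simp_all add: c cr c' mult.commute)
      finally show ?thesis .
    qed
    have "A * s + s * A = A * C * y + C * (y * A)"
      by (simp add: s(2) mult.assoc)
    also have "\<dots> = C * (A + F (\<lambda>z. of_real (a (rot k z)))) * y"
      by (simp add: AC yA algebra_simps)
    finally show ?thesis
      by (simp add: CA s(2))
  qed
  have As': "A * adj s + adj s * A = adj s"
    using arg_cong[OF As, of adj] by (simp add: adj_add adj_mult add.commute)
  have sq: "A * A + adj s * s + s * adj s = A"
  proof -
    have "adj s * s = B * (adj y * y) * B"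
      by (simp add: s(1) adj_mult mult.assoc)
    also have "\<dots> = F (\<lambda>z. of_real (b z) * of_real (weight k z) * of_real (b z))"
      unfolding y_def adj_x_power_x_power B_def by (simp add: F_mult c continuous_on_mult c')
    finally have 4: "adj s * s = \<dots>" .
    have "s * adj s = C * (y * adj y) * C"
      by (simp add: s(2) adj_mult mult.assoc)
    also have "\<dots> = F (\<lambda>z. of_real (b (rot k z)) * of_real (weight k (rot k z)) * of_real (b (rot k z)))"
      unfolding y_def x_power_adj_x_power C_def by (simp add: F_mult cr continuous_on_mult c')
    finally have 5: "s * adj s = \<dots>" .
    have "A * A + adj s * s + s * adj s = F (\<lambda>z. of_real (a z) * of_real (a z) +
        of_real (b z) * of_real (weight k z) * of_real (b z) +
        of_real (b (rot k z)) * of_real (weight k (rot k z)) * of_real (b (rot k z)))"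
      unfolding 4 5 A_def by (simp add: F_add F_mult c cr continuous_on_mult continuous_on_add c')
    also have "\<dots> = A"
      unfolding A_def
    proof (rule F_cong)
      fix z :: complex assume "z \<in> circle"
      from 3[OF this] show "complex_of_real (a z) * of_real (a z) +
        of_real (b z) * of_real (weight k z) * of_real (b z) +
        of_real (b (rot k z)) * of_real (weight k (rot k z)) * of_real (b (rot k z)) = of_real (a z)"
        unfolding of_real_mult[symmetric] of_real_add[symmetric] of_real_eq_iff
        by (simp add: power2_eq_square mult_ac)
    qed
    finally show ?thesis .
  qed
  have "(A + (s + adj s)) * (A + (s + adj s)) =
      (A * A + adj s * s + s * adj s) + (A * s + s * A) + (A * adj s + adj s * A) + s * s + adj s * adj s"
    by (simp add: algebra_simps)
  also have "\<dots> = A + (s + adj s)"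
    unfolding sq As As' ss ss' by (simp add: add.assoc)
  finally show ?thesis
    by (simp add: projection_def adj_add adj_adj add.commute flip: A_def)
qed

end

section \<open>The gauge action and the trace\<close>

context rotation_alg
begin

lemma hom_eqI:
  fixes \<phi> \<psi> :: "'a \<Rightarrow> 'a"
  assumes "star_hom type_alg type_alg \<phi>" "star_hom type_alg type_alg \<psi>" "\<phi> x = \<psi> x" "\<phi> w = \<psi> w"
  shows "\<phi> = \<psi>"
  using univ by (intro star_hom_eqI[OF assms(1,2), of "{x, w}"])
    (auto simp: universal_rotation_alg_def assms)

lemma gauge_hom_exists:
  "\<exists>\<rho> :: 'a \<Rightarrow> 'a. star_hom type_alg type_alg \<rho> \<and> \<rho> x = cis (2 * pi * t) *\<^sub>C x \<and> \<rho> w = w"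
proof -
  let ?c = "cis (2 * pi * t)"
  have r: "rotation_rels \<theta> \<gamma> type_alg x w"
    using univ by (simp add: universal_rotation_alg_def)
  have "rotation_rels \<theta> \<gamma> type_alg (?c *\<^sub>C x) w"
    using r unfolding rotation_rels_def
    by (simp add: adj_scaleC mult_scaleC_left mult_scaleC_right scaleC_scaleC cis_cnj cis_mult mult.commute)
  then show ?thesis
    using univ cstar_alg_type_alg unfolding universal_rotation_alg_def by blast
qed

text \<open>Existence is the universal property for the rescaled generator, uniqueness is generation
  by \<open>x\<close> and \<open>w\<close>, and bijectivity holds because the homomorphism for
  \<open>- t\<close> is the inverse.\<close>

lemma gauge_aut:
  "star_hom type_alg type_alg (gauge_aut x w t)"
  "gauge_aut x w t x = cis (2 * pi * t) *\<^sub>C x" "gauge_aut x w t w = w"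
proof -
  obtain \<rho> :: "'a \<Rightarrow> 'a" where \<rho>: "star_hom type_alg type_alg \<rho>" "\<rho> x = cis (2 * pi * t) *\<^sub>C x" "\<rho> w = w"
    using gauge_hom_exists by blast
  obtain \<rho>' :: "'a \<Rightarrow> 'a" where \<rho>': "star_hom type_alg type_alg \<rho>'" "\<rho>' x = cis (2 * pi * (- t)) *\<^sub>C x" "\<rho>' w = w"
    using gauge_hom_exists[of "- t"] by blast
  have id: "star_hom (type_alg :: 'a cstar) type_alg id"
    by (simp add: star_hom_def ring_hom_def)
  have "\<rho> \<circ> \<rho>' = id" "\<rho>' \<circ> \<rho> = id"
    by (intro hom_eqI star_hom_comp[OF \<rho>'(1) \<rho>(1)] star_hom_comp[OF \<rho>(1) \<rho>'(1)] id;
        simp add: \<rho> \<rho>' star_hom_scaleC[OF \<rho>(1)] star_hom_scaleC[OF \<rho>'(1)] scaleC_scaleC cis_mult)+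
  then have "bij \<rho>"
    using o_bij by blast
  have "gauge_aut x w t = \<rho>"
    unfolding gauge_aut_def
  proof (rule the_equality)
    fix \<rho>'' :: "'a \<Rightarrow> 'a"
    assume "star_hom type_alg type_alg \<rho>'' \<and> bij \<rho>'' \<and> \<rho>'' x = cis (2 * pi * t) *\<^sub>C x \<and> \<rho>'' w = w"
    then show "\<rho>'' = \<rho>"
      using \<rho> by (intro hom_eqI) auto
  qed (use \<rho> \<open>bij \<rho>\<close> in auto)
  with \<rho> show "star_hom type_alg type_alg (gauge_aut x w t)"
    "gauge_aut x w t x = cis (2 * pi * t) *\<^sub>C x" "gauge_aut x w t w = w" by simp_all
qed

lemmas gauge_simps = star_hom_add[OF gauge_aut(1)] star_hom_mult[OF gauge_aut(1)]
  star_hom_adj[OF gauge_aut(1)] star_hom_one[OF gauge_aut(1)] star_hom_scaleC[OF gauge_aut(1)]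

lemma gauge_F:
  assumes "continuous_on circle f"
  shows "gauge_aut x w t (F f) = F f"
proof -
  interpret A: cstar_alg "type_alg :: 'a cstar"
    by (rule cstar_alg_type_alg)
  show ?thesis
    using A.circle_hom_unique[OF star_hom_comp[OF H gauge_aut(1)] H _ assms, of t]
    by (simp add: F_def \<Psi>_id gauge_aut)
qed

lemma gauge_x_power: "gauge_aut x w t (x ^ k) = cis (2 * pi * k * t) *\<^sub>C x ^ k"
  by (induction k)
    (simp_all add: gauge_simps gauge_aut mult_scaleC_left mult_scaleC_right scaleC_scaleC cis_mult algebra_simps)

text \<open>\<open>s\<close> has nonzero degree under the gauge action, so \<open>s\<close> and
  \<open>adj s\<close> average to 0 and only \<open>F f\<close> remains. Faithfulness then allows
  \<open>f\<close> to be recovered by \<open>inv_into\<close>.\<close>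

lemma rotation_trace_eq:
  assumes f: "continuous_on circle f" and "k \<noteq> 0"
    and s: "\<And>t. gauge_aut x w t s = cis (2 * pi * of_int k * t) *\<^sub>C s"
  shows "rotation_trace x w (F f + (s + adj s)) = haar_integral f"
proof -
  have "((\<lambda>t. F f + (cis (2 * pi * of_int k * t) *\<^sub>C s + cis (2 * pi * of_int (- k) * t) *\<^sub>C adj s))
      has_integral 1 *\<^sub>R F f + ((if k = 0 then 1 else 0) *\<^sub>C s + (if - k = 0 then 1 else 0) *\<^sub>C adj s)) {0..1}"
    using has_integral_linear[OF has_integral_cis[of k] bounded_linear_scaleC_left[of s]]
      has_integral_linear[OF has_integral_cis[of "- k"] bounded_linear_scaleC_left[of "adj s"]]
      has_integral_const_real[of "F f" 0 1]
    by (intro has_integral_add) (simp_all add: o_def)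
  moreover have "gauge_aut x w t (F f + (s + adj s)) =
      F f + (cis (2 * pi * of_int k * t) *\<^sub>C s + cis (2 * pi * of_int (- k) * t) *\<^sub>C adj s)" for t
    by (simp add: gauge_simps gauge_F[OF f] s adj_scaleC cis_cnj)
  ultimately have E: "cond_exp x w (F f + (s + adj s)) = F f"
    using \<open>k \<noteq> 0\<close> by (simp add: cond_exp_def integral_unique)
  have inj: "inj_on (cfc type_alg w) (carrier circle_alg)"
  proof (rule inj_onI)
    fix g h assume g: "g \<in> carrier circle_alg" and h: "h \<in> carrier circle_alg"
      and eq: "cfc type_alg w g = cfc type_alg w h"
    note c = circle_alg_carrierE(1)[OF g] circle_alg_carrierE(1)[OF h]
    have "F (\<lambda>z. g z - h z) = 0"
      using eq by (simp add: cfc_eq_F F_diff c)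
    then have "g z - h z = 0" if "z \<in> circle" for z
      by (rule F_eq_0D) (use that c in \<open>auto intro!: continuous_intros\<close>)
    then have "restrict g circle = restrict h circle"
      by (intro restrict_cong_circle) auto
    then show "g = h"
      using circle_alg_carrierE(2)[OF g] circle_alg_carrierE(2)[OF h] by metis
  qed
  \<comment> \<open>The inverse takes values among functions that are undefined off the circle, so
    it returns the restriction of \<open>f\<close>; the integral sees only the circle.\<close>
  have rc: "continuous_on circle (restrict f circle)"
    by (rule circle_alg_carrierE(1)[OF restrict_mem_circle_alg[OF f]])
  have "F f = cfc type_alg w (restrict f circle)"
    using cfc_eq_F[OF rc] by (simp add: F_def)
  then have "inv_into (carrier circle_alg) (cfc type_alg w) (F f) = restrict f circle"
    by (simp only: inv_into_f_f[OF inj restrict_mem_circle_alg[OF f]])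
  then show ?thesis
    by (simp add: rotation_trace_def E haar_integral_def)
qed

end

section \<open>The functions of a Rieffel projection\<close>

lemma cis_Arg2pi_quotient:
  assumes "cmod z = 1" "cmod l = 1"
  shows "z = l * cis (2 * pi * (Arg2pi (z / l) / (2 * pi)))"
proof -
  have *: "cis (Arg2pi u) = u" if "cmod u = 1" for u
    using Arg2pi[of u] that by (simp add: is_Arg_def cis_conv_exp)
  have "cis (Arg2pi (z / l)) = z / l"
    by (rule *) (simp add: norm_divide assms)
  moreover have "l \<noteq> 0"
    using assms by auto
  ultimately show ?thesis by simp
qed

text \<open>The circle is a quotient of the compact interval: preimages of closed sets under
  \<open>F\<close> are images of compact sets, hence closed.\<close>

lemma continuous_on_circle_param:
  fixes h :: "real \<Rightarrow> real" and l :: complex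
  assumes h: "continuous_on {0..1} h" "h 0 = h 1" and l: "cmod l = 1"
    and F: "\<And>t. t \<in> {0..1} \<Longrightarrow> F (l * cis (2 * pi * t)) = h t"
  shows "continuous_on (sphere 0 1) F"
proof -
  define p where "p t = l * cis (2 * pi * t)" for t
  have p: "continuous_on S p" for S
    unfolding p_def by (intro continuous_intros)
  have surj: "\<exists>t\<in>{0..1}. z = p t" if "z \<in> sphere 0 1" for z
  proof (intro bexI)
    show "z = p (Arg2pi (z / l) / (2 * pi))"
      unfolding p_def using that l by (intro cis_Arg2pi_quotient) auto
    show "Arg2pi (z / l) / (2 * pi) \<in> {0..1}"
      using Arg2pi[of "z / l"] by auto
  qed
  have "closed (F -` C \<inter> sphere 0 1)" if "closed C" for C
  proof -
    have "F -` C \<inter> sphere 0 1 = p ` (h -` C \<inter> {0..1})"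
    proof (intro equalityI subsetI)
      fix z assume z: "z \<in> F -` C \<inter> sphere 0 1"
      then obtain t where "t \<in> {0..1}" "z = p t"
        using surj by blast
      with z F[of t] show "z \<in> p ` (h -` C \<inter> {0..1})"
        by (auto simp: p_def)
    next
      fix z assume "z \<in> p ` (h -` C \<inter> {0..1})"
      then obtain t where t: "t \<in> {0..1}" "h t \<in> C" "z = p t" by blast
      then have "cmod z = 1"
        using l by (simp add: p_def norm_mult)
      with t F[of t] show "z \<in> F -` C \<inter> sphere 0 1"
        by (simp add: p_def)
    qed
    moreover have "compact (h -` C \<inter> {0..1})"
      using continuous_closed_preimage[OF h(1) closed_real_atLeastAtMost that]
      by (metis Int_commute bounded_closed_interval bounded_Int compact_eq_bounded_closed)
    ultimately show ?thesis
      by (simp add: compact_imp_closed compact_continuous_image p)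
  qed
  then show ?thesis
    using continuous_on_closed_vimage[OF closed_sphere] by blast
qed

text \<open>Cut at \<open>t0\<close>: each piece is a translate of a piece of \<open>h\<close> up to
  endpoints. It is needed because the functions below are parametrized from a point other than
  1.\<close>

lemma has_integral_frac_shift:
  fixes h :: "real \<Rightarrow> real"
  assumes h: "(h has_integral I) {0..1}" and "h 0 = h 1" and "t0 \<in> {0..1}"
  shows "((\<lambda>t. h (frac (t - t0))) has_integral I) {0..1}"
proof -
  have on: "h integrable_on {0..1}"
    using h by blast
  have i1: "(h has_integral integral {0..1 - t0} h) {0..1 - t0}"
    and i2: "(h has_integral integral {1 - t0..1} h) {1 - t0..1}"
    using assms by (auto intro!: integrable_integral integrable_on_subinterval[OF on])
  have I: "I = integral {1 - t0..1} h + integral {0..1 - t0} h"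
    using Henstock_Kurzweil_Integration.integral_combine[OF _ _ on, of "1 - t0"] assms by (simp add: integral_unique add.commute)
  have "((\<lambda>t. h (t + (1 - t0))) has_integral integral {1 - t0..1} h) {0..t0}"
    using has_integral_affinity'[of h _ "1 - t0" 1 1 "1 - t0"] i2 by (simp add: cbox_interval)
  then have "((\<lambda>t. h (frac (t - t0))) has_integral integral {1 - t0..1} h) {0..t0}"
  proof (rule has_integral_spike_finite[of "{t0, 0}", rotated -1])
    fix t assume "t \<in> {0..t0} - {t0, 0}"
    then have "frac (t - t0) = t + (1 - t0)"
      using assms by (subst frac_unique_iff) auto
    then show "h (frac (t - t0)) = h (t + (1 - t0))" by simp
  qed simp
  moreover have "((\<lambda>t. h (t + (- t0))) has_integral integral {0..1 - t0} h) {t0..1}"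
    using has_integral_affinity'[of h _ 0 "1 - t0" 1 "- t0"] i1 by (simp add: cbox_interval)
  then have "((\<lambda>t. h (frac (t - t0))) has_integral integral {0..1 - t0} h) {t0..1}"
  proof (rule has_integral_spike_finite[of "{t0, 1}", rotated -1])
    fix t assume "t \<in> {t0..1} - {t0, 1}"
    then have "frac (t - t0) = t + (- t0)"
      using assms by (subst frac_unique_iff) auto
    then show "h (frac (t - t0)) = h (t + (- t0))" by simp
  qed simp
  ultimately show ?thesis
    unfolding I using assms by (intro has_integral_combine[of 0 t0 1]) auto
qed

text \<open>Rieffel's function: it rises on \<open>{0..e}\<close>, stays 1 up to \<beta> and falls
  on \<open>{\<beta>..\<beta> + e}\<close>. Values on the two slopes at distance \<beta> add up to
  1, and the integral over \<open>{0..1}\<close> is \<beta> for every admissible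
  \<open>e\<close>.\<close>

definition trapezoid :: "real \<Rightarrow> real \<Rightarrow> real \<Rightarrow> real" where
  "trapezoid e \<beta> t = max 0 (min 1 (min (t / e) ((\<beta> + e - t) / e)))"

lemma trapezoid_eq:
  assumes "0 < e" "e < \<beta>"
  shows "t \<in> {0..e} \<Longrightarrow> trapezoid e \<beta> t = t / e"
    and "t \<in> {e..\<beta>} \<Longrightarrow> trapezoid e \<beta> t = 1"
    and "t \<in> {\<beta>..\<beta> + e} \<Longrightarrow> trapezoid e \<beta> t = (\<beta> + e - t) / e"
    and "t \<ge> \<beta> + e \<Longrightarrow> trapezoid e \<beta> t = 0"
  using assms by (auto simp: trapezoid_def min_def max_def field_simps)

lemma has_integral_trapezoid:
  assumes e: "0 < e" "e < \<beta>" "\<beta> + e < 1"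
  shows "(trapezoid e \<beta> has_integral \<beta>) {0..1}"
proof -
  have lin: "((\<lambda>t. (c - t) / e) has_integral ((c - a)\<^sup>2 / (2 * e) - (c - b)\<^sup>2 / (2 * e))) {a..b}" if "a \<le> b" for a b c
  proof -
    have "((\<lambda>t. (c - t) / e) has_integral (- (c - b)\<^sup>2 / (2 * e)) - (- (c - a)\<^sup>2 / (2 * e))) {a..b}"
    proof (rule fundamental_theorem_of_calculus[OF that])
      fix t
      show "((\<lambda>t. - (c - t)\<^sup>2 / (2 * e)) has_vector_derivative (c - t) / e) (at t within {a..b})"
        unfolding has_real_derivative_iff_has_vector_derivative[symmetric]
        using e(1) by (auto intro!: derivative_eq_intros simp: field_simps)
    qed
    then show ?thesis by simp
  qed
  have 1: "(trapezoid e \<beta> has_integral e / 2) {0..e}"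
  proof (rule has_integral_eq)
    show "((\<lambda>t. - ((0 - t) / e)) has_integral e / 2) {0..e}"
      using has_integral_neg[OF lin[of 0 e 0]] e by (simp add: power2_eq_square)
  qed (use trapezoid_eq(1)[OF e(1,2)] in auto)
  have 2: "(trapezoid e \<beta> has_integral \<beta> - e) {e..\<beta>}"
  proof (rule has_integral_eq)
    show "((\<lambda>t. 1) has_integral \<beta> - e) {e..\<beta>}"
      using has_integral_const_real[of "1::real" e \<beta>] e by simp
  qed (use trapezoid_eq(2)[OF e(1,2)] in auto)
  have 3: "(trapezoid e \<beta> has_integral e / 2) {\<beta>..\<beta> + e}"
  proof (rule has_integral_eq)
    show "((\<lambda>t. (\<beta> + e - t) / e) has_integral e / 2) {\<beta>..\<beta> + e}"
      using lin[of \<beta> "\<beta> + e" "\<beta> + e"] e by (simp add: power2_eq_square)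
  qed (use trapezoid_eq(3)[OF e(1,2)] in auto)
  have 4: "(trapezoid e \<beta> has_integral 0) {\<beta> + e..1}"
  proof (rule has_integral_eq)
    show "((\<lambda>t. 0) has_integral (0::real)) {\<beta> + e..1}" by simp
  qed (use trapezoid_eq(4)[OF e(1,2)] in auto)
  have "(trapezoid e \<beta> has_integral e / 2 + (\<beta> - e)) {0..\<beta>}"
    using e by (intro has_integral_combine[OF _ _ 1 2]) auto
  then have "(trapezoid e \<beta> has_integral e / 2 + (\<beta> - e) + e / 2) {0..\<beta> + e}"
    using e by (intro has_integral_combine[OF _ _ _ 3]) auto
  then have "(trapezoid e \<beta> has_integral e / 2 + (\<beta> - e) + e / 2 + 0) {0..1}"
    using e by (intro has_integral_combine[OF _ _ _ 4]) auto
  then show ?thesis by simp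
qed

lemma continuous_on_trapezoid: "e > 0 \<Longrightarrow> continuous_on S (trapezoid e \<beta>)"
  unfolding trapezoid_def by (intro continuous_intros) auto

lemma trapezoid_bounds: "0 \<le> trapezoid e \<beta> t" "trapezoid e \<beta> t \<le> 1"
  by (auto simp: trapezoid_def)

text \<open>The factor \<open>G\<close> compensates for \<open>x ^ k\<close> not being unitary; it only has to be nonzero on the
  short arc carrying \<open>b\<close>.\<close>

lemma rieffel_functions:
  fixes G :: "complex \<Rightarrow> real" and l :: complex and \<beta> :: real
  assumes \<beta>: "0 < \<beta>" "\<beta> < 1" and G: "continuous_on (sphere 0 1) G" "\<And>z. z \<in> sphere 0 1 \<Longrightarrow> 0 \<le> G z"
    and l: "cmod l = 1" "G l \<noteq> 0"
  obtains a b :: "complex \<Rightarrow> real"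
  where "continuous_on (sphere 0 1) a" "continuous_on (sphere 0 1) b"
    and "\<And>z u. \<lbrakk>u \<in> sphere 0 1; z = cis (2 * pi * \<beta>) * u\<rbrakk> \<Longrightarrow>
      b z * b u = 0 \<and> b u * (a z + a u) = b u \<and> (a z)\<^sup>2 + (b z)\<^sup>2 * G z + (b u)\<^sup>2 * G u = a z"
    and "((\<lambda>t. a (cis (2 * pi * t))) has_integral \<beta>) {0..1}"
proof -
  define p where "p t = l * cis (2 * pi * t)" for t
  have p_sphere: "p t \<in> sphere 0 1" for t
    using l by (simp add: p_def norm_mult)
  have Gp: "continuous_on S (\<lambda>t. G (p t))" for S
    by (rule continuous_on_compose2[OF G(1)]) (use p_sphere in \<open>auto simp: p_def intro!: continuous_intros\<close>)
  then have "isCont (\<lambda>t. G (p t)) 0"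
    by (metis continuous_on_eq_continuous_at open_UNIV UNIV_I)
  then obtain d where d: "d > 0" "\<And>t. dist 0 t < d \<Longrightarrow> G (p t) \<noteq> 0"
    using continuous_at_avoid[of 0 "\<lambda>t. G (p t)" 0] l by (auto simp: p_def)
  \<comment> \<open>The three bounds keep \<open>G\<close> nonzero on the rising arc, leave room for
    a plateau before \<beta>, and make the falling slope end before 1.\<close>
  define e where "e = min (d / 2) (min (\<beta> / 2) ((1 - \<beta>) / 2))"
  have "e \<le> d / 2" "e \<le> \<beta> / 2" "e \<le> (1 - \<beta>) / 2"
    by (simp_all only: e_def min_le_iff_disj order_refl simp_thms)
  moreover have "0 < e"
    using d \<beta> by (simp add: e_def)
  ultimately have e: "0 < e" "e < \<beta>" "\<beta> + e < 1" "e < d"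
    using d \<beta> by (auto simp: field_simps)
  have Gpos: "G (p t) > 0" if "t \<in> {0..e}" for t
    using d(2)[of t] G(2)[OF p_sphere, of t] that e by (force simp: order_less_le)
  define h where "h = trapezoid e \<beta>"
  \<comment> \<open>The solution of \<open>k^2 * G = h - h^2\<close> on the rising slope. It
    vanishes at both ends since \<open>h\<close> is 0 and 1 there, hence extends continuously by
    0.\<close>
  define k where "k t = (if t \<le> e then sqrt ((h t - (h t)\<^sup>2) / G (p t)) else 0)" for t
  note h_eq = trapezoid_eq[OF e(1,2), folded h_def]
  have h01: "h 0 = 0" "h 1 = 0" "h e = 1"
    using h_eq(1)[of 0] h_eq(4)[of 1] h_eq(2)[of e] e by auto
  have k01: "k 0 = k 1"
    using e h01 by (simp add: k_def)
  have ch: "continuous_on S h" for S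
    using continuous_on_trapezoid e by (simp add: h_def)
  have "continuous_on ({0..e} \<union> {e..1}) k"
    unfolding k_def
  proof (intro continuous_on_cases_le)
    have S: "{t \<in> {0..e} \<union> {e..1}. t \<le> e} = {0..e}" using e by auto
    show "continuous_on {t \<in> {0..e} \<union> {e..1}. t \<le> e} (\<lambda>t. sqrt ((h t - (h t)\<^sup>2) / G (p t)))"
      unfolding S by (intro continuous_intros ch Gp) (use Gpos in force)
  qed (use h01 in \<open>auto intro!: continuous_intros\<close>)
  moreover have "{0..e} \<union> {e..1} = {0..1}" using e by auto
  ultimately have ck: "continuous_on {0..1} k" by simp
  have k2: "(k t)\<^sup>2 * G (p t) = h t - (h t)\<^sup>2" if "t \<in> {0..e}" for t
  proof -
    have "0 \<le> h t - (h t)\<^sup>2"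
      using trapezoid_bounds[of e \<beta> t] by (simp add: h_def power2_eq_square mult_left_le)
    then show ?thesis
      using Gpos[OF that] that by (simp add: k_def)
  qed
  have k0: "k t = 0" if "t > e" for t
    using that by (simp add: k_def)
  \<comment> \<open>The angle in full turns, measured from \<open>l\<close>, where the rising slope
    begins.\<close>
  define \<tau> where "\<tau> z = Arg2pi (z / l) / (2 * pi)" for z
  have \<tau>: "\<tau> (p t) = frac t" for t
  proof -
    have "p t / l = cis (2 * pi * t)"
      using l by (auto simp: p_def)
    also have "\<dots> = cis (2 * pi * frac t) * cis (2 * pi * of_int \<lfloor>t\<rfloor>)"
      unfolding cis_mult by (simp add: frac_def algebra_simps)
    also have "\<dots> = 1 * exp (\<i> * of_real (2 * pi * frac t))"
      by (simp add: cis_multiple_2pi) (simp add: cis_conv_exp)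
    finally have "Arg2pi (p t / l) = 2 * pi * frac t"
      using frac_lt_1[of t] by (intro Arg2pi_unique[of 1, symmetric, THEN sym]) (auto simp: frac_ge_0)
    then show ?thesis by (simp add: \<tau>_def)
  qed
  have param: "f (frac t) = f t" if "t \<in> {0..1}" "f 0 = f 1" for f :: "real \<Rightarrow> real" and t
    using that by (cases "t = 1") (auto simp: frac_eq)
  have surj: "\<exists>t. 0 \<le> t \<and> t < 1 \<and> u = p t" if "u \<in> sphere 0 1" for u
  proof (intro exI conjI)
    show "u = p (\<tau> u)"
      unfolding p_def \<tau>_def using that l by (intro cis_Arg2pi_quotient) auto
    show "0 \<le> \<tau> u" "\<tau> u < 1"
      using Arg2pi[of "u / l"] by (auto simp: \<tau>_def)
  qed
  show thesis
  proof
    show "continuous_on (sphere 0 1) (\<lambda>z. h (\<tau> z))"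
      by (rule continuous_on_circle_param[OF ch _ l(1)])
        (use h01 \<tau> param[of _ h] in \<open>auto simp: p_def\<close>)
    show "continuous_on (sphere 0 1) (\<lambda>z. k (\<tau> z))"
      by (rule continuous_on_circle_param[OF ck k01 l(1)])
        (use k01 \<tau> param[of _ k] in \<open>auto simp: p_def\<close>)
    fix z u assume u: "u \<in> sphere 0 1" and z: "z = cis (2 * pi * \<beta>) * u"
    obtain t where t: "0 \<le> t" "t < 1" "u = p t"
      using surj[OF u] by blast
    have zp: "z = p (t + \<beta>)"
      by (simp add: z t p_def cis_mult algebra_simps)
    define s where "s = frac (t + \<beta>)"
    have ts: "\<tau> u = t" "\<tau> z = s"
      using t by (simp_all add: zp \<tau> s_def frac_eq)
    have s: "s = (if t + \<beta> < 1 then t + \<beta> else t + \<beta> - 1)"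
      unfolding s_def using t \<beta> by (auto simp: frac_unique_iff)
    have Gz: "G z = G (p s)"
    proof -
      have "cis (2 * pi * (t + \<beta>)) = cis (2 * pi * s) * cis (2 * pi * of_int \<lfloor>t + \<beta>\<rfloor>)"
        unfolding cis_mult s_def by (simp add: frac_def algebra_simps)
      then show ?thesis
        by (simp add: zp p_def cis_multiple_2pi)
    qed
    \<comment> \<open>If \<open>u\<close> lies on the rising slope, then \<open>z\<close> is on the
      falling one with complementary value of \<open>h\<close>. If only \<open>z\<close> is rising,
      the equation defining \<open>k\<close> applies at \<open>z\<close>. Otherwise both values of
      \<open>k\<close> vanish and \<open>h\<close> is 0 or 1 at \<open>z\<close>.\<close>
    consider "t \<le> e" | "t > e" "s \<le> e" | "t > e" "s > e" by linarith
    then show "k (\<tau> z) * k (\<tau> u) = 0 \<and> k (\<tau> u) * (h (\<tau> z) + h (\<tau> u)) = k (\<tau> u) \<and>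
        (h (\<tau> z))\<^sup>2 + (k (\<tau> z))\<^sup>2 * G z + (k (\<tau> u))\<^sup>2 * G u = h (\<tau> z)"
    proof cases
      case 1
      then have s': "s = t + \<beta>"
        using e s by simp
      have ht: "h t = t / e" and hs: "h s = 1 - t / e"
        using h_eq(1)[of t] h_eq(3)[of s] 1 t e s' by (simp_all add: field_simps)
      have "k s = 0"
        using k0 s' e t by simp
      then show ?thesis
        using k2[of t] 1 t unfolding ts by (simp add: ht hs) (simp add: power2_eq_square algebra_simps)
    next
      case 2
      have "0 \<le> s" by (simp add: s_def)
      then show ?thesis
        using k2[of s] k0[of t] 2 Gz unfolding ts by simp
    next
      case 3
      have "h s = 0 \<or> h s = 1"
        using 3 t \<beta> e s h_eq(2)[of s] h_eq(4)[of s] by (cases "t + \<beta> < 1") auto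
      then show ?thesis
        using k0 3 unfolding ts by auto
    qed
  next
    \<comment> \<open>The integral starts at the point 1, the coordinate \<open>\<tau>\<close> at
      \<open>l\<close>; \<open>t0\<close> is the angle of \<open>l\<close> in turns.\<close>
    obtain t0 where t0: "0 \<le> t0" "t0 < 1" "1 = p (- t0)"
    proof -
      have "l = cis (Arg2pi l)"
        using cis_Arg2pi_quotient[of l 1] l by simp
      then have "1 = l * cis (- Arg2pi l)"
        by (metis cis_mult add.right_inverse cis_zero)
      then show ?thesis
        using that[of "Arg2pi l / (2 * pi)"] Arg2pi[of l] by (simp add: p_def)
    qed
    have "cis (2 * pi * t) = p (t - t0)" for t
    proof -
      have "cis (2 * pi * t) = p (- t0) * cis (2 * pi * t)"
        using t0 by simp
      also have "\<dots> = p (t - t0)"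
        unfolding p_def mult.assoc cis_mult by (simp add: algebra_simps)
      finally show ?thesis .
    qed
    then have "(\<lambda>t. h (\<tau> (cis (2 * pi * t)))) = (\<lambda>t. h (frac (t - t0)))"
      by (simp add: \<tau>)
    moreover have "((\<lambda>t. h (frac (t - t0))) has_integral \<beta>) {0..1}"
      using t0 h01 has_integral_trapezoid[OF e(1-3)] by (intro has_integral_frac_shift) (auto simp: h_def)
    ultimately show "((\<lambda>t. h (\<tau> (cis (2 * pi * t)))) has_integral \<beta>) {0..1}"
      by simp
  qed
qed

section \<open>Projections of prescribed trace\<close>

context rotation_alg
begin

lemma rieffel_projection_exists:
  assumes "k > 0" and \<mu>: "\<mu> \<in> circle" "\<And>n::nat. \<gamma> (\<mu> * cis (2 * pi * real n * \<theta>)) \<noteq> 0"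
  obtains a s where "continuous_on circle a" "projection (F (\<lambda>z. complex_of_real (a z)) + (s + adj s))"
    "\<And>t. gauge_aut x w t s = cis (2 * pi * of_int (int k) * t) *\<^sub>C s"
    "haar_integral (\<lambda>z. complex_of_real (a z)) = of_real (frac (real k * \<theta>))"
proof -
  define \<beta> where "\<beta> = frac (real k * \<theta>)"
  have "real k * \<theta> \<notin> \<int>"
  proof
    assume "real k * \<theta> \<in> \<int>"
    then have "(real k * \<theta>) / real k \<in> \<rat>"
      using Ints_subset_Rats by (intro Rats_divide) auto
    then show False using \<theta> \<open>k > 0\<close> by simp
  qed
  then have \<beta>: "0 < \<beta>" "\<beta> < 1"
    by (auto simp: \<beta>_def frac_gt_0_iff frac_lt_1)
  \<comment> \<open>The factors of the weight at \<open>\<mu>\<close> are the values of \<gamma> at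
    the first \<open>k\<close> points of the given orbit.\<close>
  have wt: "cmod \<mu> = 1" "weight k \<mu> \<noteq> 0"
    using \<mu> by (simp_all add: weight_def rot_def mult.commute)
  obtain a b where ab: "continuous_on circle a" "continuous_on circle b"
    and rel: "\<And>z u. \<lbrakk>u \<in> circle; z = cis (2 * pi * \<beta>) * u\<rbrakk> \<Longrightarrow>
      b z * b u = 0 \<and> b u * (a z + a u) = b u \<and>
      (a z)\<^sup>2 + (b z)\<^sup>2 * weight k z + (b u)\<^sup>2 * weight k u = a z"
    and int: "((\<lambda>t. a (cis (2 * pi * t))) has_integral \<beta>) {0..1}"
    using rieffel_functions[OF \<beta> continuous_on_weight weight_nonneg wt] by blast
  have "cis (2 * pi * \<beta>) = cis (2 * pi * real k * \<theta>)"
  proof -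
    have "cis (2 * pi * real k * \<theta>) = cis (2 * pi * \<beta>) * cis (2 * pi * of_int \<lfloor>real k * \<theta>\<rfloor>)"
      unfolding cis_mult \<beta>_def by (simp add: frac_def algebra_simps)
    then show ?thesis by (simp add: cis_multiple_2pi)
  qed
  \<comment> \<open>Rotating by \<beta> undoes \<open>rot k\<close> because \<beta> and
    \<open>k * \<theta>\<close> differ by an integer. So \<open>rot k z\<close> plays the role of
    \<open>u\<close> in the relations for \<open>a\<close> and \<open>b\<close>.\<close>
  then have z: "z = cis (2 * pi * \<beta>) * rot (real k) z" for z
    by (simp add: rot_def cis_mult flip: mult.assoc)
  let ?s = "x ^ k * F (\<lambda>z. complex_of_real (b z))"
  show ?thesis
  proof
    show "projection (F (\<lambda>z. complex_of_real (a z)) + (?s + adj ?s))"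
      by (rule powers_rieffel_projection[OF ab]) (use rel[OF rot_circle z] in auto)
    have "continuous_on circle (\<lambda>z. complex_of_real (b z))"
      by (intro continuous_intros ab)
    then show "gauge_aut x w t ?s = cis (2 * pi * of_int (int k) * t) *\<^sub>C ?s" for t
      by (simp add: gauge_simps gauge_x_power gauge_F mult_scaleC_left)
    show "haar_integral (\<lambda>z. complex_of_real (a z)) = of_real (frac (real k * \<theta>))"
      using has_integral_linear[OF int bounded_linear_of_real]
      by (auto simp: haar_integral_def o_def \<beta>_def intro!: integral_unique)
  qed (rule ab)
qed

end

theorem theorem5p3:
  fixes \<theta> :: real and \<gamma> :: "complex \<Rightarrow> real" and x w :: "'a::cstar_algebra" and \<alpha> :: real
  assumes "0 < \<theta>" and "\<theta> < 1" and "\<theta> \<notin> \<rat>"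
    and "continuous_on circle \<gamma>" and "\<forall>z\<in>circle. 0 \<le> \<gamma> z"
    and "\<exists>z\<in>circle. \<forall>n::nat. \<gamma> (z * cis (2 * pi * real n * \<theta>)) \<noteq> 0"
    and "universal_rotation_alg \<theta> \<gamma> x w"
    and "\<exists>(m::int) (k::int). \<alpha> = of_int m + of_int k * \<theta>" and "\<alpha> \<in> {0..1}"
  shows "\<exists>p. projection p \<and> rotation_trace x w p = complex_of_real \<alpha>"
proof -
  have "adj w * w = 1" "w * adj w = 1"
    using assms(7) by (auto simp: universal_rotation_alg_def rotation_rels_def unitary_in_def)
  then interpret W: unitary w by unfold_locales
  obtain \<Psi> where "star_hom circle_alg type_alg \<Psi>" "\<Psi> (restrict (\<lambda>z. z) circle) = w"
    using W.circle_hom_exists by blast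
  then interpret rotation_alg \<theta> \<gamma> x w \<Psi>
    using assms by unfold_locales auto
  obtain \<mu> where \<mu>: "\<mu> \<in> circle" "\<And>n::nat. \<gamma> (\<mu> * cis (2 * pi * real n * \<theta>)) \<noteq> 0"
    using assms(6) by blast
  obtain m k :: int where mk: "\<alpha> = of_int m + of_int k * \<theta>"
    using assms(8) by blast
  \<comment> \<open>A number of this form in the closed unit interval is determined by
    \<open>n\<close>: irrationality excludes the value 1, where the fractional part would
    jump.\<close>
  have frac_eqI: "\<beta> = frac (real n * \<theta>)"
    if "n > 0" and \<beta>: "\<beta> = of_int j + real n * \<theta>" "0 \<le> \<beta>" "\<beta> \<le> 1" for \<beta> n and j :: int
  proof -
    have "\<beta> \<noteq> 1"
    proof
      assume "\<beta> = 1"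
      then have "\<theta> = of_int (1 - j) / real n"
        using \<beta> \<open>n > 0\<close> by (simp add: field_simps)
      moreover have "of_int (1 - j) / real n \<in> \<rat>"
        by (intro Rats_divide Rats_of_int Rats_of_nat)
      ultimately show False using assms(3) by simp
    qed
    then show ?thesis
      using \<beta> by (intro frac_unique_iff[THEN iffD2, symmetric]) auto
  qed
  consider "k = 0" | "k > 0" | "k < 0" by linarith
  then show ?thesis
  proof cases
    case 1
    then have "\<alpha> = 0 \<or> \<alpha> = 1"
      using mk assms(9) by auto
    \<comment> \<open>\<open>s = 0\<close> is homogeneous of every degree, so the trace formula
      covers scalars, with degree 1 chosen arbitrarily.\<close>
    moreover have "rotation_trace x w (F (\<lambda>z. of_real \<alpha>) + (0 + adj 0)) = haar_integral (\<lambda>z. of_real \<alpha>)"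
      using gauge_simps(5)[of _ 0 0] by (intro rotation_trace_eq[of _ 1]) simp_all
    ultimately show ?thesis
      by (intro exI[of _ "F (\<lambda>z. of_real \<alpha>) + (0 + adj 0)"])
        (auto simp: projection_def F_const haar_integral_def)
  next
    case 2
    define n where "n = nat k"
    have n: "n > 0" "\<alpha> = of_int m + real n * \<theta>"
      using 2 mk by (simp_all add: n_def)
    obtain a s where a: "continuous_on circle a" "projection (F (\<lambda>z. complex_of_real (a z)) + (s + adj s))"
      and s: "\<And>t. gauge_aut x w t s = cis (2 * pi * of_int (int n) * t) *\<^sub>C s"
      and int: "haar_integral (\<lambda>z. complex_of_real (a z)) = of_real (frac (real n * \<theta>))"
      using rieffel_projection_exists[OF n(1) \<mu>] by metis
    have "rotation_trace x w (F (\<lambda>z. complex_of_real (a z)) + (s + adj s)) = of_real (frac (real n * \<theta>))"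
      unfolding int[symmetric] by (rule rotation_trace_eq[OF _ _ s]) (use n a in \<open>auto intro!: continuous_intros\<close>)
    then show ?thesis
      using a(2) frac_eqI[OF n] assms(9) by auto
  next
    case 3
    define n where "n = nat (- k)"
    \<comment> \<open>Passing to \<open>1 - \<alpha>\<close> makes the coefficient of \<theta>
      positive.\<close>
    have n: "n > 0" "1 - \<alpha> = of_int (1 - m) + real n * \<theta>"
      using 3 mk by (simp_all add: n_def)
    obtain a s where a: "continuous_on circle a" "projection (F (\<lambda>z. complex_of_real (a z)) + (s + adj s))"
      and s: "\<And>t. gauge_aut x w t s = cis (2 * pi * of_int (int n) * t) *\<^sub>C s"
      and int: "haar_integral (\<lambda>z. complex_of_real (a z)) = of_real (frac (real n * \<theta>))"
      using rieffel_projection_exists[OF n(1) \<mu>] by metis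
    let ?p = "F (\<lambda>z. complex_of_real (a z)) + (s + adj s)"
    have ac: "continuous_on circle (\<lambda>z. complex_of_real (a z))"
      by (intro continuous_intros a)
    \<comment> \<open>The complement has the same shape, with \<open>1 - a\<close> and
      \<open>- s\<close>, so its trace is again an integral.\<close>
    have eq: "1 - ?p = F (\<lambda>z. 1 - complex_of_real (a z)) + (- s + adj (- s))"
      using F_diff[of "\<lambda>z. 1" "\<lambda>z. of_real (a z)"] ac adj_diff[of 0 s]
      by (simp add: F_const)
    have tr: "rotation_trace x w (F (\<lambda>z. 1 - complex_of_real (a z)) + (- s + adj (- s))) =
        haar_integral (\<lambda>z. 1 - complex_of_real (a z))"
    proof (rule rotation_trace_eq[of _ "int n"])
      show "gauge_aut x w t (- s) = cis (2 * pi * of_int (int n) * t) *\<^sub>C (- s)" for t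
        using s[of t] by (simp add: scaleC_scaleC gauge_simps mult.commute flip: scaleC_minus1)
    qed (use n ac in \<open>auto intro!: continuous_intros\<close>)
    have int': "haar_integral (\<lambda>z. 1 - complex_of_real (a z)) = of_real (1 - frac (real n * \<theta>))"
    proof -
      have on: "(\<lambda>t. complex_of_real (a (cis (2 * pi * t)))) integrable_on {0..1}"
        by (intro integrable_continuous_real continuous_on_compose2[OF ac] continuous_intros) auto
      have "((\<lambda>t. 1 - complex_of_real (a (cis (2 * pi * t)))) has_integral
          1 - of_real (frac (real n * \<theta>))) {0..1}"
        using has_integral_diff[OF has_integral_const_real[of 1 0 1] integrable_integral[OF on]] int
        by (simp add: haar_integral_def)
      then show ?thesis
        by (simp add: haar_integral_def integral_unique)
    qed
    have "projection (1 - ?p)"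
      using a(2) by (simp add: projection_def algebra_simps adj_diff)
    moreover have "\<alpha> = 1 - frac (real n * \<theta>)"
      using frac_eqI[OF n] assms(9) by auto
    ultimately show ?thesis
      by (intro exI[of _ "1 - ?p"]) (simp only: eq tr int')
  qed
qed

end
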